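(* Let $L\in\mathcal R_0$, $\alpha\ge0$, and let $\mu,\nu\in\mathcal M_+$ with $\nu\neq\delta_0$ be such that $$\mu\big((x,+\infty)\big)\sim x^{-\alpha}L(x)\qquad\text{and}\qquad m_{\lfloor\alpha+1\rfloor}(\nu)<+\infty .$$ Then $$(\mu\boxtimes\nu)\big((x,+\infty)\big)\sim m_1(\nu)^{\alpha}\,\mu\big((x,+\infty)\big).$$
   Context: $\mathcal M_+$ is the set of Borel probability measures on $[0,+\infty)$; $m_q(\nu)=\int_{[0,+\infty)}t^q\,\nu(\mathrm dt)$; $\lfloor\cdot\rfloor$ is the integer part. $f(x)\sim g(x)$ means $f(x)/g(x)\to1$ as $x\to+\infty$. $\mathcal R_0$ is the class of slowly varying functions: (positive, measurable) $f$ on a neighborhood of $+\infty$ with $f(\lambda x)/f(x)\to1$ as $x\to+\infty$ for every $\lambda>0$. For $\mu\in\mathcal M_+$, $\mu\ne\delta_0$, put $\delta=\mu(\{0\})<1$ and $\psi_\mu(z)=\int_{[0,+\infty)}\frac{zt}{1-zt}\,\mu(\mathrm dt)$, $z<0$. The map $\psi_\mu:(-\infty,0)\to(\delta-1,0)$ is invertible with inverse $\chi_\mu$, and the $S$-transform is $S_\mu(z)=\frac{z+1}{z}\chi_\mu(z)$, $z\in(\delta-1,0)$; it determines $\mu$ uniquely. For $\mu,\nu\in\mathcal M_+$ different from $\delta_0$, the free multiplicative convolution $\mu\boxtimes\nu\in\mathcal M_+$ is the measure satisfying $S_{\mu\boxtimes\nu}=S_\mu S_\nu$ on some interval $(-\varepsilon,0)$.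 *)

theory Defs
  imports "HOL-Probability.Probability"
begin

text \<open>
  Borel probability measures on $[0,+\infty)$ are represented as Borel probability measures on the
  whole real line that give no mass to the negative half-line.
\<close>
definition M_plus :: "real measure set" where
  "M_plus = {\<mu>. real_distribution \<mu> \<and> measure \<mu> {..<0} = 0}"

abbreviation dirac0 :: "real measure" where
  "dirac0 \<equiv> return borel 0"

definition moment :: "nat \<Rightarrow> real measure \<Rightarrow> ennreal" where
  "moment q \<nu> = (\<integral>\<^sup>+ t\<in>{0..}. ennreal (t ^ q) \<partial>\<nu>)"

text \<open>
  Only the values near $+\infty$ are constrained. Measurability is Lebesgue measurability, which
  covers Borel functions as well.
\<close>
definition slowly_varying :: "(real \<Rightarrow> real) \<Rightarrow> bool" where
  "slowly_varying f \<longleftrightarrow>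
     (\<exists>a. (\<forall>x>a. f x > 0) \<and> f \<in> borel_measurable (lebesgue_on {a<..})) \<and>
     (\<forall>c>0. ((\<lambda>x. f (c * x) / f x) \<longlongrightarrow> 1) at_top)"

definition psi_transform :: "real measure \<Rightarrow> real \<Rightarrow> real" where
  "psi_transform \<mu> z = (LINT t:{0..}|\<mu>. z * t / (1 - z * t))"

definition chi_transform :: "real measure \<Rightarrow> real \<Rightarrow> real" where
  "chi_transform \<mu> = the_inv_into {..<0} (psi_transform \<mu>)"

text \<open>
  The value is meaningful only for \<open>\<mu> \<in> M_plus\<close> with \<open>\<mu> \<noteq> dirac0\<close> and
  \<open>measure \<mu> {0} - 1 < z < 0\<close>; elsewhere it is unspecified.
\<close>
definition S_transform :: "real measure \<Rightarrow> real \<Rightarrow> real" where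
  "S_transform \<mu> z = (z + 1) / z * chi_transform \<mu> z"

text \<open>
  \<open>is_free_mult_conv \<mu> \<nu> \<rho>\<close> says that \<open>\<rho>\<close> is the free multiplicative convolution of \<open>\<mu>\<close> and
  \<open>\<nu>\<close>, both assumed to lie in \<open>M_plus\<close> and to differ from \<open>dirac0\<close>. As \<open>\<epsilon>\<close> may always be
  decreased, it can be taken so small that all three S-transforms are defined on $(-\epsilon,0)$;
  unspecified values play no role.
\<close>
definition is_free_mult_conv :: "real measure \<Rightarrow> real measure \<Rightarrow> real measure \<Rightarrow> bool" where
  "is_free_mult_conv \<mu> \<nu> \<rho> \<longleftrightarrow>
     \<rho> \<in> M_plus \<and> \<rho> \<noteq> dirac0 \<and>
     (\<exists>\<epsilon>>0. \<forall>z\<in>{-\<epsilon><..<0}. S_transform \<rho> z = S_transform \<mu> z * S_transform \<nu> z)"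

end

theory Submission
  imports Defs "HOL-Real_Asymp.Real_Asymp"
begin

text \<open>
  Put \<open>m = m\<^sub>1(\<nu>)\<close>, \<open>p = \<lfloor>\<alpha>\<rfloor>\<close>, and let \<open>M\<close> be the law of \<open>m X\<close> for \<open>X\<close> of law \<open>\<mu>\<close>. By regular variation
  \<open>M((x, \<infinity>)) \<sim> m\<^sup>\<alpha> \<mu>((x, \<infinity>))\<close>, so the claim is that \<open>\<rho> = \<mu> \<boxtimes> \<nu>\<close> and \<open>M\<close> have equivalent tails.
  Write \<open>b x = M((x, \<infinity>))\<close>; throughout, \<open>w < 0\<close> tends to \<open>0\<close> and \<open>x = -1/w\<close>.

  The identity of S-transforms, solved for \<open>\<chi>\<^sub>\<mu>\<close>, is a fixed point equation
  \<open>\<psi>\<^sub>\<rho>(w) = \<psi>\<^sub>M(w g(\<psi>\<^sub>\<rho>(w)))\<close> with \<open>g = 1 / (m S\<^sub>\<nu>)\<close> and \<open>g(0-) = 1\<close>: \<open>\<rho>\<close> has the psi-transform of \<open>M\<close> up to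
  a perturbation of the argument by a factor that tends to \<open>1\<close> (\<open>psi_free_mult_conv\<close>). The \<open>p + 1\<close>
  moments of \<open>\<nu>\<close> serve to expand \<open>g\<close> as a polynomial up to \<open>O(|z|\<^sup>p)\<close> (\<open>poly_upto_recip_S_transform\<close>).

  Expand \<open>1 + \<psi>\<^sub>M(w) = \<Sum>\<^sub>j\<^sub><\<^sub>p m\<^sub>j w\<^sup>j + w\<^sup>p S\<^sub>p(w)\<close> with \<open>S\<^sub>p(w) = \<integral> t\<^sup>p / (1 - w t) dM\<close>. In the polynomial part the
  perturbation produces a polynomial up to \<open>o(b x)\<close>, once the expansion of \<open>\<psi>\<^sub>\<rho>\<close> has been bootstrapped
  through the fixed point equation. In \<open>w\<^sup>p S\<^sub>p(w)\<close> it produces only \<open>o(b x)\<close>: dilating the argument of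
  \<open>S\<^sub>p\<close> by \<open>h \<rightarrow> 1\<close> costs at most \<open>2 |h - 1|\<close> times the integral of a kernel whose mass is comparable to
  \<open>b x\<close>. Hence \<open>\<psi>\<^sub>\<rho> - \<psi>\<^sub>M\<close> is a polynomial up to \<open>o(b x)\<close> (\<open>composition_difference\<close>). Comparing coefficients,
  \<open>\<rho>\<close> has finite moments below order \<open>p\<close>, and its \<open>S\<^sub>p\<close> differs from that of \<open>M\<close> by a constant, up
  to \<open>o(x\<^sup>p b x)\<close> (\<open>remainder_difference\<close>). The constant matters: for integral \<open>\<alpha>\<close> the function
  \<open>S\<^sub>p\<close> can be of larger order than \<open>x\<^sup>p b x\<close>, and only its increments \<open>S\<^sub>p(-1/x) - S\<^sub>p(-l/x)\<close> see
  the tail. In these increments the constant cancels; for \<open>p = 0\<close> it is zero and \<open>1 - S\<^sub>0(-l/x)\<close> takes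
  their place.

  The increments are integrals of \<open>1 / (1 - \<theta> y)\<close>, \<open>y = 1 / (1 + t/x)\<close>, against the kernel \<open>kappa\<close>. So
  the two measures with density \<open>kappa p (t/x)\<close> with respect to \<open>\<rho>\<close> and \<open>M\<close>, transported to the variable
  \<open>y \<in> [0,1]\<close>, have mass \<open>O(b x)\<close> and agree up to \<open>o(b x)\<close> on all functions \<open>1 / (1 - \<theta> y)\<close> with
  \<open>0 < \<theta> < 1\<close>. These functions span a dense subspace of \<open>C[0,1]\<close> (\<open>resolvents_total\<close>), so the measures
  agree up to \<open>o(b x)\<close> on every continuous function. Trapping indicators between continuous ramps compares
  the tails at \<open>x\<close> and \<open>(1 + \<delta>) x\<close>, and regular variation of \<open>b\<close> lets \<open>\<delta>\<close> tend to \<open>0\<close>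
  (\<open>tail_ratio_tendsto_1\<close>).
\<close>

section \<open>Polynomial expansions at 0 from the left\<close>

text \<open>
  Real exponents are needed: the remainders below are of order \<open>|w|\<^sup>s\<close> with \<open>s\<close> just below \<open>p\<close> or \<open>p + 1\<close>,
  where a tail of index \<open>\<alpha> = p\<close> need not have a finite \<open>p\<close>-th moment. The degree of the polynomial is
  not bounded, since terms of degree at least \<open>r\<close> are absorbed in the error.
\<close>
definition poly_upto :: "real \<Rightarrow> (real \<Rightarrow> real) \<Rightarrow> bool" where
  "poly_upto r f \<longleftrightarrow> (\<exists>q. (\<lambda>w. f w - poly q w) \<in> O[at_left 0](\<lambda>w. \<bar>w\<bar> powr r))"

lemma eventually_at_left_0_small: "e > 0 \<Longrightarrow> eventually (\<lambda>w::real. -e < w \<and> w < 0) (at_left 0)"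
  by (auto simp: eventually_at_left_field intro!: exI[of _ "-e"])

lemma powr_bigo_powr_at_left_0:
  assumes "s \<le> r" shows "(\<lambda>w::real. \<bar>w\<bar> powr r) \<in> O[at_left 0](\<lambda>w. \<bar>w\<bar> powr s)"
proof (rule bigoI[of _ 1])
  show "eventually (\<lambda>w. norm (\<bar>w\<bar> powr r) \<le> 1 * norm (\<bar>w\<bar> powr s)) (at_left (0::real))"
    using eventually_at_left_0_small[of 1] by (rule eventually_mono) (use assms in \<open>auto intro!: powr_mono'\<close>)
qed

lemma powr_smallo_powr_at_left_0:
  assumes "s < r" shows "(\<lambda>w::real. \<bar>w\<bar> powr r) \<in> o[at_left 0](\<lambda>w. \<bar>w\<bar> powr s)"
proof (rule smalloI_tendsto)
  have "((\<lambda>w::real. (-w) powr (r - s)) \<longlongrightarrow> 0) (at_left 0)"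
    by (rule tendsto_eq_rhs[OF tendsto_powr']) (use assms in \<open>auto intro!: tendsto_eq_intros eventually_at_leftI[of "-1"]\<close>)
  then show "((\<lambda>w::real. \<bar>w\<bar> powr r / \<bar>w\<bar> powr s) \<longlongrightarrow> 0) (at_left 0)"
    by (rule Lim_transform_eventually)
       (auto simp: powr_diff intro!: eventually_mono[OF eventually_at_left_0_small[of 1]])
  show "eventually (\<lambda>w::real. \<bar>w\<bar> powr s \<noteq> 0) (at_left 0)"
    by (intro eventually_mono[OF eventually_at_left_0_small[of 1]]) auto
qed

lemma power_eq_powr_at_left_0:
  "eventually (\<lambda>w::real. \<bar>w\<bar> ^ k = \<bar>w\<bar> powr k) (at_left 0)"
  by (intro eventually_mono[OF eventually_at_left_0_small[of 1]]) (auto simp: powr_realpow)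

lemma poly_bigo_1: "poly q \<in> O[at_left 0](\<lambda>_. 1 :: real)"
proof -
  have "(poly q \<longlongrightarrow> poly q 0) (at_left (0::real))"
    by (intro tendsto_intros)
  then show ?thesis by (intro bigoI_tendsto[where c = "poly q 0"]) auto
qed

lemma poly_upto_bigo: "f \<in> O[at_left 0](\<lambda>w. \<bar>w\<bar> powr r) \<Longrightarrow> poly_upto r f"
  unfolding poly_upto_def by (rule exI[of _ 0]) simp

lemma poly_upto_poly: "poly_upto r (poly q)"
  unfolding poly_upto_def by (rule exI[of _ q]) simp

lemma poly_upto_const: "poly_upto r (\<lambda>_. c)"
  unfolding poly_upto_def by (rule exI[of _ "[:c:]"]) simp

lemma poly_upto_id: "poly_upto r (\<lambda>w. w)"
  unfolding poly_upto_def by (rule exI[of _ "[:0, 1:]"]) simp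

lemma poly_upto_add: "poly_upto r f \<Longrightarrow> poly_upto r g \<Longrightarrow> poly_upto r (\<lambda>w. f w + g w)"
  unfolding poly_upto_def
proof safe
  fix q q'
  assume "(\<lambda>w. f w - poly q w) \<in> O[at_left 0](\<lambda>w. \<bar>w\<bar> powr r)" "(\<lambda>w. g w - poly q' w) \<in> O[at_left 0](\<lambda>w. \<bar>w\<bar> powr r)"
  from sum_in_bigo(1)[OF this] show "\<exists>q. (\<lambda>w. f w + g w - poly q w) \<in> O[at_left 0](\<lambda>w. \<bar>w\<bar> powr r)"
    by (intro exI[of _ "q + q'"]) (simp add: algebra_simps)
qed

lemma poly_upto_cong:
  assumes "eventually (\<lambda>w. f w = g w) (at_left 0)"
  shows "poly_upto r f \<longleftrightarrow> poly_upto r g"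
  unfolding poly_upto_def
  by (intro ex_cong1 landau_o.big.in_cong eventually_mono[OF assms]) auto

lemma poly_upto_mono: "poly_upto r f \<Longrightarrow> s \<le> r \<Longrightarrow> poly_upto s f"
  unfolding poly_upto_def using powr_bigo_powr_at_left_0 landau_o.big_trans by blast

lemma poly_upto_bounded:
  assumes "poly_upto r f" "r \<ge> 0" shows "f \<in> O[at_left 0](\<lambda>_. 1)"
proof -
  from assms obtain q where q: "(\<lambda>w. f w - poly q w) \<in> O[at_left 0](\<lambda>w. \<bar>w\<bar> powr r)"
    unfolding poly_upto_def by auto
  have "(\<lambda>w::real. \<bar>w\<bar> powr r) \<in> O[at_left 0](\<lambda>_. 1)"
    by (rule bigoI[of _ 1], rule eventually_mono[OF eventually_at_left_0_small[of 1]])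
       (use assms(2) in \<open>auto simp: powr_le1\<close>)
  from sum_in_bigo(1)[OF landau_o.big_trans[OF q this] poly_bigo_1[of q]] show ?thesis by simp
qed

lemma poly_upto_mult:
  assumes "poly_upto r f" "poly_upto r g" "r \<ge> 0"
  shows "poly_upto r (\<lambda>w. f w * g w)"
proof -
  let ?R = "\<lambda>w::real. \<bar>w\<bar> powr r"
  from assms obtain q q' where q: "(\<lambda>w. f w - poly q w) \<in> O[at_left 0](?R)"
    and q': "(\<lambda>w. g w - poly q' w) \<in> O[at_left 0](?R)"
    unfolding poly_upto_def by auto
  have 1: "(\<lambda>w. (f w - poly q w) * g w) \<in> O[at_left 0](\<lambda>w. ?R w * 1)"
    by (intro landau_o.big.mult q poly_upto_bounded[OF assms(2,3)])
  have 2: "(\<lambda>w. poly q w * (g w - poly q' w)) \<in> O[at_left 0](\<lambda>w. 1 * ?R w)"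
    by (intro landau_o.big.mult q' poly_bigo_1)
  from sum_in_bigo(1)[OF 1[simplified] 2[simplified]] show ?thesis
    unfolding poly_upto_def by (intro exI[of _ "q * q'"]) (simp add: algebra_simps)
qed

lemma poly_upto_cmult: "poly_upto r f \<Longrightarrow> poly_upto r (\<lambda>w. c * f w)"
  unfolding poly_upto_def
proof safe
  fix q assume "(\<lambda>w. f w - poly q w) \<in> O[at_left 0](\<lambda>w. \<bar>w\<bar> powr r)"
  then have "(\<lambda>w. c * (f w - poly q w)) \<in> O[at_left 0](\<lambda>w. \<bar>w\<bar> powr r)"
    by (cases "c = 0") simp_all
  then show "\<exists>q. (\<lambda>w. c * f w - poly q w) \<in> O[at_left 0](\<lambda>w. \<bar>w\<bar> powr r)"
    by (intro exI[of _ "smult c q"]) (simp add: algebra_simps)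
qed

lemma poly_upto_diff: "poly_upto r f \<Longrightarrow> poly_upto r g \<Longrightarrow> poly_upto r (\<lambda>w. f w - g w)"
  using poly_upto_add[of r f "\<lambda>w. (-1) * g w"] poly_upto_cmult[of r g "-1"] by simp

lemma poly_upto_power: "poly_upto r f \<Longrightarrow> r \<ge> 0 \<Longrightarrow> poly_upto r (\<lambda>w. f w ^ k)"
  by (induction k) (auto intro: poly_upto_const poly_upto_mult)

lemma poly_upto_sum: "(\<And>i. i \<in> A \<Longrightarrow> poly_upto r (f i)) \<Longrightarrow> poly_upto r (\<lambda>w. \<Sum>i\<in>A. f i w)"
  by (induction A rule: infinite_finite_induct) (auto intro: poly_upto_const poly_upto_add)

lemma poly_upto_poly_comp: "poly_upto r f \<Longrightarrow> r \<ge> 0 \<Longrightarrow> poly_upto r (\<lambda>w. poly q (f w))"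
  unfolding poly_altdef by (intro poly_upto_sum poly_upto_cmult poly_upto_power)

lemma poly_upto_times_id:
  assumes "poly_upto r f" shows "poly_upto (r + 1) (\<lambda>w. w * f w)"
proof -
  from assms obtain q where q: "(\<lambda>w. f w - poly q w) \<in> O[at_left 0](\<lambda>w. \<bar>w\<bar> powr r)"
    unfolding poly_upto_def by auto
  have "(\<lambda>w. w * (f w - poly q w)) \<in> O[at_left 0](\<lambda>w. w * \<bar>w\<bar> powr r)"
    by (intro landau_o.big.mult q) auto
  also have "(\<lambda>w. w * \<bar>w\<bar> powr r) \<in> O[at_left 0](\<lambda>w. \<bar>w\<bar> powr (r + 1))"
    by (rule bigoI[of _ 1], rule eventually_mono[OF eventually_at_left_0_small[of 1]])
       (auto simp: powr_add abs_mult)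
  finally show ?thesis
    unfolding poly_upto_def by (intro exI[of _ "[:0, 1:] * q"]) (simp add: algebra_simps)
qed

text \<open>
  The growth bound \<open>F = O(|w|\<^sup>s)\<close> is separate from the expansion of \<open>F\<close> because the error of \<open>f\<close>, of order
  \<open>|F|\<^sup>r\<close>, has to be measured in \<open>w\<close>, while polynomials in \<open>F\<close> inherit the precision of \<open>F\<close>.
\<close>
lemma poly_upto_compose:
  assumes f: "poly_upto r f" and F0: "filterlim F (at_left 0) (at_left 0)"
    and Fs: "F \<in> O[at_left 0](\<lambda>w. \<bar>w\<bar> powr s)" and F: "poly_upto k F"
    and k: "k \<ge> 0" "k \<le> r * s" and r: "r \<ge> 0"
  shows "poly_upto k (\<lambda>w. f (F w))"
proof -
  from f obtain q where q: "(\<lambda>w. f w - poly q w) \<in> O[at_left 0](\<lambda>w. \<bar>w\<bar> powr r)"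
    unfolding poly_upto_def by auto
  have "(\<lambda>w. f (F w) - poly q (F w)) \<in> O[at_left 0](\<lambda>w. \<bar>F w\<bar> powr r)"
    using landau_o.big.compose[OF q F0] by simp
  also have "(\<lambda>w. \<bar>F w\<bar> powr r) \<in> O[at_left 0](\<lambda>w. \<bar>w\<bar> powr (r * s))"
  proof -
    from Fs obtain c where c: "c > 0" "eventually (\<lambda>w. \<bar>F w\<bar> \<le> c * \<bar>w\<bar> powr s) (at_left 0)"
      by (auto elim!: landau_o.bigE)
    show ?thesis
    proof (rule bigoI[of _ "c powr r"])
      show "eventually (\<lambda>w. norm (\<bar>F w\<bar> powr r) \<le> c powr r * norm (\<bar>w\<bar> powr (r * s))) (at_left 0)"
        using c(2)
      proof eventually_elim
        case (elim w)
        have "\<bar>F w\<bar> powr r \<le> (c * \<bar>w\<bar> powr s) powr r"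
          by (rule powr_mono2) (use r elim in auto)
        then show ?case using c(1) by (simp add: powr_mult powr_powr mult.commute)
      qed
    qed
  qed
  also have "(\<lambda>w. \<bar>w\<bar> powr (r * s)) \<in> O[at_left 0](\<lambda>w. \<bar>w\<bar> powr k)"
    by (rule powr_bigo_powr_at_left_0) fact
  finally have "poly_upto k (\<lambda>w. f (F w) - poly q (F w))" by (rule poly_upto_bigo)
  from poly_upto_add[OF this poly_upto_poly_comp[OF F k(1), of q]] show ?thesis by simp
qed

lemma poly_upto_geometric: "poly_upto (real p) (\<lambda>z. 1 / (1 + z))"
proof -
  have "poly_upto p (\<lambda>z. (\<Sum>j<p. (-1)^j * z ^ j) + (-z)^p / (1 + z))"
  proof (intro poly_upto_add poly_upto_sum poly_upto_cmult poly_upto_power poly_upto_id)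
    have "(\<lambda>z::real. (-z)^p / (1 + z)) \<in> O[at_left 0](\<lambda>z. \<bar>z\<bar> powr p)"
    proof (rule bigoI[of _ 2], rule eventually_mono[OF eventually_at_left_0_small[of "1/2"]])
      fix z :: real assume z: "- (1 / 2) < z \<and> z < 0"
      then have "\<bar>z\<bar> ^ p / (1 + z) \<le> \<bar>z\<bar>^p / (1/2)"
        by (intro divide_left_mono) auto
      with z show "norm ((- z) ^ p / (1 + z)) \<le> 2 * norm (\<bar>z\<bar> powr real p)"
        by (simp add: powr_realpow power_abs abs_divide)
    qed auto
    then show "poly_upto p (\<lambda>z. (-z)^p / (1 + z))" by (rule poly_upto_bigo)
  qed auto
  moreover have "eventually (\<lambda>z::real. (\<Sum>j<p. (-1)^j * z ^ j) + (-z)^p / (1 + z) = 1 / (1 + z)) (at_left 0)"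
  proof (rule eventually_mono[OF eventually_at_left_0_small[of "1/2"]])
    fix z :: real assume z: "- (1 / 2) < z \<and> z < 0"
    have "(\<Sum>j<p. (-1)^j * z ^ j) = (\<Sum>j<p. (-z)^j)"
      by (intro sum.cong refl) (simp add: power_minus[of z])
    also have "\<dots> = ((-z) ^ p - 1) / (-z - 1)" using z by (subst geometric_sum) auto
    finally show "(\<Sum>j<p. (-1)^j * z ^ j) + (-z)^p / (1 + z) = 1 / (1 + z)" using z
      by (simp add: divide_simps) (simp add: algebra_simps)
  qed auto
  ultimately show ?thesis by (simp add: poly_upto_cong)
qed

lemma poly_smallo_coeff:
  assumes "poly q \<in> o[at_left 0](\<lambda>w::real. w ^ k)" "j \<le> k"
  shows "coeff q j = 0"
  using assms
proof (induction k arbitrary: q j)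
  case 0
  then have "((\<lambda>w. poly q w / 1) \<longlongrightarrow> 0) (at_left (0::real))"
    by (intro smalloD_tendsto) auto
  moreover have "(poly q \<longlongrightarrow> poly q 0) (at_left (0::real))" by (intro tendsto_intros)
  ultimately have "poly q 0 = 0" by (intro tendsto_unique[of "at_left (0::real)" "poly q"]) auto
  with 0 show ?case by (simp add: poly_0_coeff_0)
next
  case (Suc k)
  have *: "(\<lambda>w::real. w ^ Suc k) \<in> O[at_left 0](\<lambda>w. w ^ k)"
    by (rule bigoI[of _ 1], rule eventually_mono[OF eventually_at_left_0_small[of 1]])
       (use mult_right_mono[of "-x" 1 "\<bar>x ^ k\<bar>" for x :: real] in \<open>auto simp: abs_mult\<close>)
  have q0: "coeff q 0 = 0"
    by (rule Suc.IH[OF landau_o.small_big_trans[OF Suc.prems(1) *]]) auto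
  then obtain q' where q': "q = pCons 0 q'" by (cases q) auto
  have nz: "eventually (\<lambda>w::real. w \<noteq> 0) (at_left 0)"
    by (rule eventually_mono[OF eventually_at_left_0_small[of 1]]) auto
  have "((\<lambda>w. poly q w / w ^ Suc k) \<longlongrightarrow> 0) (at_left (0::real))"
    by (intro smalloD_tendsto Suc.prems)
  then have "((\<lambda>w. poly q' w / w ^ k) \<longlongrightarrow> 0) (at_left (0::real))"
    by (rule Lim_transform_eventually) (use nz in eventually_elim, simp add: q')
  then have "poly q' \<in> o[at_left 0](\<lambda>w::real. w ^ k)"
    by (intro smalloI_tendsto eventually_mono[OF nz]) auto
  then have "coeff q' (j - 1) = 0" if "j > 0"
    using Suc.IH[of q' "j - 1"] Suc.prems(2) that by auto
  with q0 show ?case by (cases j) (auto simp: q')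
qed

section \<open>Stieltjes transforms and moments\<close>

locale nonneg_distribution = real_distribution M for M :: "real measure" +
  assumes AE_nonneg: "AE t in M. 0 \<le> t"

lemma M_plus_imp_nonneg_distribution:
  assumes "M \<in> M_plus" shows "nonneg_distribution M"
proof -
  interpret real_distribution M using assms by (simp add: M_plus_def)
  have "{..<0} \<in> null_sets M"
    using assms by (auto simp: M_plus_def null_sets_def emeasure_eq_measure)
  then have "AE t in M. t \<notin> {..<0}" by (rule AE_not_in)
  then show ?thesis by unfold_locales (auto simp: not_less)
qed

text \<open>
  For \<open>k = 0\<close> this is \<open>1 + \<psi>\<^sub>M\<close>; for larger \<open>k\<close> it is the remainder of its Taylor expansion, divided by
  \<open>w\<^sup>k\<close>.
\<close>
definition stieltjes :: "real measure \<Rightarrow> nat \<Rightarrow> real \<Rightarrow> real" where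
  "stieltjes M k w = (\<integral>t. t ^ k / (1 - w * t) \<partial>M)"

lemma one_minus_mult_ge_1: "w \<le> 0 \<Longrightarrow> 0 \<le> t \<Longrightarrow> 1 \<le> 1 - w * t" for w t :: real
  by (simp add: mult_nonpos_nonneg)

lemma stieltjes_kernel_bounds:
  fixes w t :: real
  assumes "w \<le> 0" "0 \<le> t"
  shows "0 \<le> t ^ k / (1 - w * t)" "t ^ k / (1 - w * t) \<le> t ^ k"
    "\<bar>t ^ k / (1 - w * t)\<bar> \<le> \<bar>t ^ k\<bar>"
proof -
  note * = one_minus_mult_ge_1[OF assms]
  show "0 \<le> t ^ k / (1 - w * t)" using * assms by simp
  have "t ^ k / (1 - w * t) \<le> t ^ k / 1" using * assms by (intro divide_left_mono) auto
  then show "t ^ k / (1 - w * t) \<le> t ^ k" by simp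
  with * assms show "\<bar>t ^ k / (1 - w * t)\<bar> \<le> \<bar>t ^ k\<bar>" by simp
qed

lemma stieltjes_kernel_Suc_le:
  fixes w t :: real
  assumes "w \<le> 0" "0 \<le> t"
  shows "\<bar>w * (t ^ Suc k / (1 - w * t))\<bar> \<le> t ^ k"
proof -
  note * = one_minus_mult_ge_1[OF assms]
  have "\<bar>w\<bar> * t * t ^ k \<le> t ^ k * (1 - w * t)" using assms by (simp add: algebra_simps)
  with * assms show ?thesis by (simp add: abs_divide abs_mult divide_simps mult_ac)
qed

context nonneg_distribution
begin

lemma prob_UNIV [simp]: "prob UNIV = 1"
  using prob_space by simp

lemma integrable_stieltjes:
  assumes "\<And>j. j < k \<Longrightarrow> integrable M (\<lambda>t. t ^ j)" "w < 0"
  shows "integrable M (\<lambda>t. t ^ k / (1 - w * t))"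
proof (cases k)
  case 0
  show ?thesis unfolding 0
    by (rule integrable_const_bound[of _ 1])
       (use AE_nonneg in \<open>eventually_elim, use assms(2) stieltjes_kernel_bounds[of w _ 0] in auto\<close>)
next
  case (Suc j)
  have "integrable M (\<lambda>t. 1 / -w * t ^ j)" using assms(1)[of j] Suc by auto
  then show ?thesis
  proof (rule Bochner_Integration.integrable_bound)
    show "AE t in M. norm (t ^ k / (1 - w * t)) \<le> norm (1 / - w * t ^ j)"
      using AE_nonneg
    proof eventually_elim
      case (elim t)
      from stieltjes_kernel_Suc_le[of w t j] elim assms(2)
      have "\<bar>w\<bar> * \<bar>t ^ k / (1 - w * t)\<bar> \<le> t ^ j" by (simp add: Suc abs_mult)
      with assms(2) elim show ?case by (simp add: field_simps)
    qed
  qed auto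
qed

lemma integrable_stieltjes':
  assumes "integrable M (\<lambda>t. t ^ k)" "w \<le> 0"
  shows "integrable M (\<lambda>t. t ^ k / (1 - w * t))"
  using assms(1)
proof (rule Bochner_Integration.integrable_bound)
  show "AE t in M. norm (t ^ k / (1 - w * t)) \<le> norm (t ^ k)"
    using AE_nonneg
    by eventually_elim (use stieltjes_kernel_bounds(3)[of w _ k] assms(2) in \<open>simp del: abs_divide\<close>)
qed auto

lemma stieltjes_nonneg: "w \<le> 0 \<Longrightarrow> 0 \<le> stieltjes M k w"
  unfolding stieltjes_def
  by (rule integral_nonneg_AE) (use AE_nonneg in \<open>eventually_elim, use stieltjes_kernel_bounds[of w _ k] in auto\<close>)

lemma stieltjes_le_moment:
  assumes "integrable M (\<lambda>t. t ^ k)" "w \<le> 0"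
  shows "stieltjes M k w \<le> (\<integral>t. t ^ k \<partial>M)"
  unfolding stieltjes_def
proof (rule integral_mono_AE[OF integrable_stieltjes'[OF assms] assms(1)])
  show "AE t in M. t ^ k / (1 - w * t) \<le> t ^ k"
    using AE_nonneg
    by eventually_elim (use stieltjes_kernel_bounds[of w _ k] assms(2) in auto)
qed

lemma stieltjes_Suc:
  assumes "\<And>j. j \<le> k \<Longrightarrow> integrable M (\<lambda>t. t ^ j)" "w < 0"
  shows "stieltjes M k w = (\<integral>t. t ^ k \<partial>M) + w * stieltjes M (Suc k) w"
proof -
  have "stieltjes M k w = (\<integral>t. t ^ k + w * (t ^ Suc k / (1 - w * t)) \<partial>M)"
    unfolding stieltjes_def
  proof (rule integral_cong_AE)
    show "AE t in M. t ^ k / (1 - w * t) = t ^ k + w * (t ^ Suc k / (1 - w * t))"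
      using AE_nonneg
    proof eventually_elim
      case (elim t)
      with one_minus_mult_ge_1[of w t] assms(2) show ?case by (simp add: field_simps)
    qed
  qed auto
  also have "\<dots> = (\<integral>t. t ^ k \<partial>M) + w * stieltjes M (Suc k) w"
    unfolding stieltjes_def
    using assms integrable_stieltjes[of "Suc k" w]
    by (subst Bochner_Integration.integral_add)
       (auto simp del: times_divide_eq_right power_Suc simp: integral_mult_right_zero)
  finally show ?thesis .
qed

lemma stieltjes_expansion:
  assumes "\<And>j. j < i + k \<Longrightarrow> integrable M (\<lambda>t. t ^ j)" "w < 0"
  shows "stieltjes M i w = (\<Sum>j<k. (\<integral>t. t ^ (i + j) \<partial>M) * w ^ j) + w ^ k * stieltjes M (i + k) w"
  using assms(1)
proof (induction k)
  case (Suc k)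
  have "stieltjes M i w = (\<Sum>j<k. (\<integral>t. t ^ (i + j) \<partial>M) * w ^ j) + w ^ k * stieltjes M (i + k) w"
    using Suc by simp
  also have "stieltjes M (i + k) w = (\<integral>t. t ^ (i + k) \<partial>M) + w * stieltjes M (Suc (i + k)) w"
    by (intro stieltjes_Suc assms Suc.prems) auto
  finally show ?case by (simp add: algebra_simps)
qed auto

lemma poly_upto_stieltjes:
  assumes "\<And>j. j \<le> i + k \<Longrightarrow> integrable M (\<lambda>t. t ^ j)"
  shows "poly_upto (real k) (stieltjes M i)"
proof -
  have "(\<lambda>w. w ^ k * stieltjes M (i + k) w) \<in> O[at_left 0](\<lambda>w. \<bar>w\<bar> powr real k)"
  proof (rule bigoI[of _ "\<integral>t. t ^ (i + k) \<partial>M"])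
    show "eventually (\<lambda>w. norm (w ^ k * stieltjes M (i + k) w)
        \<le> (\<integral>t. t ^ (i + k) \<partial>M) * norm (\<bar>w\<bar> powr real k)) (at_left 0)"
      using eventually_at_left_0_small[of 1, simplified] power_eq_powr_at_left_0[of k]
    proof eventually_elim
      case (elim w)
      with stieltjes_le_moment[OF assms[of "i + k"], of w] stieltjes_nonneg[of w "i + k"]
      show ?case by (auto simp: abs_mult power_abs mult.commute intro!: mult_right_mono simp flip: elim(2))
    qed
  qed
  then have "poly_upto (real k) (\<lambda>w. (\<Sum>j<k. (\<integral>t. t ^ (i + j) \<partial>M) * w ^ j) + w ^ k * stieltjes M (i + k) w)"
    by (intro poly_upto_add poly_upto_sum poly_upto_cmult poly_upto_power poly_upto_id poly_upto_bigo) auto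
  then show ?thesis
    by (subst poly_upto_cong[OF eventually_mono[OF eventually_at_left_0_small[of 1] stieltjes_expansion]])
       (use assms in auto)
qed

lemma stieltjes_tendsto_moment:
  assumes "integrable M (\<lambda>t. t ^ k)"
  shows "(stieltjes M k \<longlongrightarrow> (\<integral>t. t ^ k \<partial>M)) (at_left 0)"
proof (rule tendsto_at_left_sequentially[of "-1"])
  fix S :: "nat \<Rightarrow> real" assume S: "\<And>n. S n < 0" "S \<longlonglongrightarrow> 0"
  show "(\<lambda>n. stieltjes M k (S n)) \<longlonglongrightarrow> (\<integral>t. t ^ k \<partial>M)"
    unfolding stieltjes_def
  proof (rule integral_dominated_convergence[where w = "\<lambda>t. \<bar>t ^ k\<bar>"])
    show "AE t in M. (\<lambda>n. t ^ k / (1 - S n * t)) \<longlonglongrightarrow> t ^ k"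
      using S(2) by (auto intro!: tendsto_eq_intros AE_I2)
    show "AE t in M. norm (t ^ k / (1 - S n * t)) \<le> \<bar>t ^ k\<bar>" for n
      using AE_nonneg
      by eventually_elim (use stieltjes_kernel_bounds(3)[of "S n" _ k] S(1)[of n] in \<open>simp del: abs_divide\<close>)
  qed (use assms in auto)
qed auto

text \<open>
  The transform of order \<open>k + 1\<close> may be unbounded when only \<open>k\<close> moments are finite, but it is
  always \<open>o(1/|w|)\<close>, by dominated convergence.
\<close>
lemma id_times_stieltjes_tendsto_0:
  assumes "integrable M (\<lambda>t. t ^ k)"
  shows "((\<lambda>w. w * stieltjes M (Suc k) w) \<longlongrightarrow> 0) (at_left 0)"
proof (rule tendsto_at_left_sequentially[of "-1"])
  fix S :: "nat \<Rightarrow> real" assume S: "\<And>n. S n < 0" "S \<longlonglongrightarrow> 0"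
  have "(\<lambda>n. \<integral>t. S n * (t ^ Suc k / (1 - S n * t)) \<partial>M) \<longlonglongrightarrow> (\<integral>t. 0 \<partial>M)"
  proof (rule integral_dominated_convergence[where w = "\<lambda>t. \<bar>t ^ k\<bar>"])
    show "AE t in M. (\<lambda>n. S n * (t ^ Suc k / (1 - S n * t))) \<longlonglongrightarrow> 0"
      using S(2) by (auto intro!: tendsto_eq_intros AE_I2)
    show "AE t in M. norm (S n * (t ^ Suc k / (1 - S n * t))) \<le> \<bar>t ^ k\<bar>" for n
      using AE_nonneg
      by eventually_elim (use stieltjes_kernel_Suc_le[of "S n" _ k] S(1)[of n] in auto)
  qed (use assms in auto)
  then show "(\<lambda>n. S n * stieltjes M (Suc k) (S n)) \<longlonglongrightarrow> 0"
    unfolding stieltjes_def by (simp del: times_divide_eq_right power_Suc)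
qed auto

text \<open>
  Fatou's lemma along \<open>w = -1/(n + 1)\<close>, since the integrands converge to \<open>t\<^sup>k\<close>.
\<close>
lemma integrable_power_if_stieltjes_bounded:
  assumes "\<And>j. j < k \<Longrightarrow> integrable M (\<lambda>t. t ^ j)" "stieltjes M k \<in> O[at_left 0](\<lambda>_. 1)"
  shows "integrable M (\<lambda>t. t ^ k)"
proof -
  from assms(2) obtain C where C: "C > 0" "eventually (\<lambda>w. \<bar>stieltjes M k w\<bar> \<le> C) (at_left 0)"
    by (auto elim!: landau_o.bigE)
  have lim: "filterlim (\<lambda>n. - 1 / real (Suc n)) (at_left 0) sequentially"
    unfolding filterlim_at using LIMSEQ_inverse_real_of_nat[THEN tendsto_minus] by (auto simp: inverse_eq_divide)
  have "(\<integral>\<^sup>+t. liminf (\<lambda>n. ennreal (t ^ k / (1 - (-1 / real (Suc n)) * t))) \<partial>M) \<le>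
        liminf (\<lambda>n. \<integral>\<^sup>+t. ennreal (t ^ k / (1 - (-1 / real (Suc n)) * t)) \<partial>M)"
    by (rule nn_integral_liminf) auto
  also have "\<dots> \<le> liminf (\<lambda>_. ennreal C)"
  proof (rule Liminf_mono)
    show "eventually (\<lambda>n. (\<integral>\<^sup>+t. ennreal (t ^ k / (1 - (-1 / real (Suc n)) * t)) \<partial>M) \<le> ennreal C) sequentially"
      using filterlim_iff[THEN iffD1, OF lim, rule_format, OF C(2)]
    proof eventually_elim
      case (elim n)
      define w where "w = - 1 / real (Suc n)"
      have w: "w < 0" by (simp add: w_def)
      have "(\<integral>\<^sup>+t. ennreal (t ^ k / (1 - w * t)) \<partial>M) = ennreal (stieltjes M k w)"
        unfolding stieltjes_def
      proof (rule nn_integral_eq_integral)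
        show "integrable M (\<lambda>t. t ^ k / (1 - w * t))" by (intro integrable_stieltjes assms(1) w)
        show "AE t in M. 0 \<le> t ^ k / (1 - w * t)" using AE_nonneg
          by eventually_elim (use stieltjes_kernel_bounds[of w _ k] w in auto)
      qed
      with elim show ?case unfolding w_def[symmetric] by (auto intro!: ennreal_leI)
    qed
  qed
  also have "liminf (\<lambda>_::nat. ennreal C) = ennreal C" by (rule Liminf_const) simp
  also have "(\<integral>\<^sup>+t. liminf (\<lambda>n. ennreal (t ^ k / (1 - (-1 / real (Suc n)) * t))) \<partial>M) = (\<integral>\<^sup>+t. ennreal (t ^ k) \<partial>M)"
  proof (rule nn_integral_cong)
    fix t
    have "(\<lambda>n. - 1 / real (Suc n)) \<longlonglongrightarrow> 0" using lim by (simp add: filterlim_at)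
    then have "(\<lambda>n. ennreal (t ^ k / (1 - (-1 / real (Suc n)) * t))) \<longlonglongrightarrow> ennreal (t ^ k)"
      by (intro tendsto_ennrealI tendsto_eq_rhs[OF tendsto_divide[OF tendsto_const
            tendsto_diff[OF tendsto_const tendsto_mult[OF _ tendsto_const]]]]) auto
    then show "liminf (\<lambda>n. ennreal (t ^ k / (1 - (-1 / real (Suc n)) * t))) = ennreal (t ^ k)"
      by (intro lim_imp_Liminf) auto
  qed
  finally have "(\<integral>\<^sup>+t. ennreal (t ^ k) \<partial>M) \<le> ennreal C" .
  also have "\<dots> < \<infinity>" by simp
  finally show ?thesis
    by (intro integrableI_nonneg) (use AE_nonneg in auto)
qed

lemma psi_transform_eq_stieltjes: "w < 0 \<Longrightarrow> psi_transform M w = stieltjes M 0 w - 1"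
proof -
  assume w: "w < 0"
  have "psi_transform M w = (\<integral>t. t ^ 0 / (1 - w * t) - 1 \<partial>M)"
    unfolding psi_transform_def set_lebesgue_integral_def
  proof (rule integral_cong_AE)
    show "AE t in M. indicat_real {0..} t *\<^sub>R (w * t / (1 - w * t)) = t ^ 0 / (1 - w * t) - 1"
      using AE_nonneg
      by eventually_elim (use one_minus_mult_ge_1[of w] w in \<open>fastforce simp: field_simps\<close>)
  qed auto
  also have "\<dots> = stieltjes M 0 w - 1"
    unfolding stieltjes_def
    using integrable_stieltjes[of 0 w] w by (subst Bochner_Integration.integral_diff) (auto simp: prob_space)
  finally show ?thesis .
qed

lemma stieltjes_0_diff:
  assumes "v < 0" "w < 0"
  shows "stieltjes M 0 w - stieltjes M 0 v = (\<integral>t. (w - v) * t / ((1 - v * t) * (1 - w * t)) \<partial>M)"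
    "integrable M (\<lambda>t. (w - v) * t / ((1 - v * t) * (1 - w * t)))"
proof -
  have *: "AE t in M. 1 / (1 - w * t) - 1 / (1 - v * t) = (w - v) * t / ((1 - v * t) * (1 - w * t))"
    using AE_nonneg
  proof eventually_elim
    case (elim t)
    with one_minus_mult_ge_1[of w t] one_minus_mult_ge_1[of v t] assms show ?case
      by (simp add: divide_simps) (simp add: algebra_simps)?
  qed
  have i: "integrable M (\<lambda>t. 1 / (1 - w * t) - 1 / (1 - v * t))"
    using integrable_stieltjes[of 0] assms by auto
  show "integrable M (\<lambda>t. (w - v) * t / ((1 - v * t) * (1 - w * t)))"
    using i by (subst integrable_cong_AE[OF _ _ AE_symmetric[OF *]]) auto
  show "stieltjes M 0 w - stieltjes M 0 v = (\<integral>t. (w - v) * t / ((1 - v * t) * (1 - w * t)) \<partial>M)"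
  proof -
    have "stieltjes M 0 w - stieltjes M 0 v = (\<integral>t. 1 / (1 - w * t) - 1 / (1 - v * t) \<partial>M)"
      unfolding stieltjes_def using integrable_stieltjes[of 0] assms
      by (subst Bochner_Integration.integral_diff) auto
    also have "\<dots> = (\<integral>t. (w - v) * t / ((1 - v * t) * (1 - w * t)) \<partial>M)"
      by (intro integral_cong_AE *) auto
    finally show ?thesis .
  qed
qed

lemma continuous_on_stieltjes_0: "continuous_on {..<0} (stieltjes M 0)"
proof -
  have le_imp_div: "a / d \<le> 1 / c" if "c > 0" "d > 0" "a * c \<le> d" for a c d :: real
    using that by (simp add: field_simps)
  have lip: "\<bar>stieltjes M 0 w - stieltjes M 0 v\<bar> \<le> \<bar>w - v\<bar> / \<bar>v\<bar>" if "v < 0" "w < 0" for v w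
  proof -
    have "\<bar>stieltjes M 0 w - stieltjes M 0 v\<bar> \<le> (\<integral>t. \<bar>w - v\<bar> / \<bar>v\<bar> \<partial>M)"
      unfolding stieltjes_0_diff(1)[OF that]
    proof (rule order_trans[OF integral_abs_bound integral_mono_AE])
      show "AE t in M. \<bar>(w - v) * t / ((1 - v * t) * (1 - w * t))\<bar> \<le> \<bar>w - v\<bar> / \<bar>v\<bar>"
        using AE_nonneg
      proof eventually_elim
        case (elim t)
        note * = one_minus_mult_ge_1[of w t] one_minus_mult_ge_1[of v t]
        have "t * \<bar>v\<bar> \<le> 1 - v * t" using elim that by (simp add: algebra_simps)
        also have "\<dots> \<le> (1 - v * t) * (1 - w * t)" using * that elim by (simp add: mult_le_cancel_left1)
        finally have "t * \<bar>v\<bar> \<le> (1 - v * t) * (1 - w * t)" .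
        moreover have "(1 - v * t) * (1 - w * t) > 0" using * elim that by (intro mult_pos_pos) auto
        ultimately have "t / ((1 - v * t) * (1 - w * t)) \<le> 1 / \<bar>v\<bar>"
          using that le_imp_div[of "\<bar>v\<bar>"] by auto
        then have "\<bar>w - v\<bar> * (t / ((1 - v * t) * (1 - w * t))) \<le> \<bar>w - v\<bar> * (1 / \<bar>v\<bar>)"
          by (intro mult_left_mono) auto
        then show ?case using * that elim by (simp add: abs_mult abs_divide)
      qed
    qed (use integrable_abs[OF stieltjes_0_diff(2)[OF that]] in \<open>simp_all del: abs_divide\<close>)
    then show ?thesis by (simp add: prob_space)
  qed
  show ?thesis
    unfolding continuous_on_def
  proof
    fix v :: real assume v: "v \<in> {..<0}"
    show "(stieltjes M 0 \<longlongrightarrow> stieltjes M 0 v) (at v within {..<0})"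
    proof (rule LIM_zero_cancel, rule tendsto_0_le[where K = 1])
      show "((\<lambda>w. \<bar>w - v\<bar> / \<bar>v\<bar>) \<longlongrightarrow> 0) (at v within {..<0})"
        using v by (auto intro!: tendsto_eq_intros)
      show "eventually (\<lambda>w. norm (stieltjes M 0 w - stieltjes M 0 v) \<le> norm (\<bar>w - v\<bar> / \<bar>v\<bar>) * 1) (at v within {..<0})"
        using lip[of v] v by (auto simp: eventually_at_filter)
    qed
  qed
qed

lemma psi_transform_tendsto_0: "(psi_transform M \<longlongrightarrow> 0) (at_left 0)"
proof -
  have "((\<lambda>w. stieltjes M 0 w - 1) \<longlongrightarrow> (\<integral>t. t ^ 0 \<partial>M) - 1) (at_left 0)"
    by (intro tendsto_intros stieltjes_tendsto_moment) auto
  then show ?thesis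
    by (rule Lim_transform_eventually[OF tendsto_eq_rhs])
       (auto simp: psi_transform_eq_stieltjes intro!: eventually_mono[OF eventually_at_left_0_small[of 1]])
qed

end

locale nontrivial_nonneg_distribution = nonneg_distribution +
  assumes not_dirac0: "M \<noteq> dirac0"
begin

lemma not_AE_0: "\<not> (AE t in M. t = 0)"
proof
  assume *: "AE t in M. t = 0"
  have "M = distr M borel (\<lambda>t. t)" by (intro measure_eqI) (auto simp: emeasure_distr)
  also have "\<dots> = distr M borel (\<lambda>t. 0)" by (rule distr_cong_AE) (use * in auto)
  also have "\<dots> = dirac0" by simp
  finally show False using not_dirac0 by simp
qed

lemma integral_pos_of_pos:
  assumes "integrable M f" "\<And>t. t > 0 \<Longrightarrow> f t > 0" "f 0 = 0"
  shows "(\<integral>t. f t \<partial>M) > (0::real)"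
proof -
  have nn: "AE t in M. 0 \<le> f t"
    using AE_nonneg by eventually_elim (use assms(2,3) in \<open>metis less_eq_real_def\<close>)
  have "(\<integral>t. f t \<partial>M) \<noteq> 0"
  proof
    assume "(\<integral>t. f t \<partial>M) = 0"
    then have "AE t in M. f t = 0" using integral_nonneg_eq_0_iff_AE[OF assms(1) nn] by simp
    with AE_nonneg have "AE t in M. t = 0"
      by eventually_elim (use assms(2) in \<open>metis less_eq_real_def less_irrefl\<close>)
    with not_AE_0 show False by simp
  qed
  with integral_nonneg_AE[OF nn] show ?thesis by simp
qed

lemma psi_transform_strict_mono:
  assumes "v < w" "w < 0" shows "psi_transform M v < psi_transform M w"
proof -
  have "stieltjes M 0 w - stieltjes M 0 v > 0"
  proof (subst stieltjes_0_diff)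
    show "0 < (\<integral>t. (w - v) * t / ((1 - v * t) * (1 - w * t)) \<partial>M)"
    proof (rule integral_pos_of_pos[OF stieltjes_0_diff(2)])
      fix t :: real assume "t > 0"
      then show "(w - v) * t / ((1 - v * t) * (1 - w * t)) > 0"
        using one_minus_mult_ge_1[of w t] one_minus_mult_ge_1[of v t] assms by simp
    qed (use assms in auto)
  qed (use assms in auto)
  with assms show ?thesis by (simp add: psi_transform_eq_stieltjes)
qed

lemma psi_transform_neg: "w < 0 \<Longrightarrow> psi_transform M w < 0"
proof -
  assume w: "w < 0"
  have "psi_transform M w < psi_transform M (w / 2)"
    using w by (intro psi_transform_strict_mono) auto
  also have "\<dots> \<le> 0"
  proof (rule tendsto_lowerbound[OF psi_transform_tendsto_0])
    show "eventually (\<lambda>v. psi_transform M (w / 2) \<le> psi_transform M v) (at_left 0)"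
      by (rule eventually_mono[OF eventually_at_left_0_small[of "-w/2"]])
         (use w in \<open>auto intro!: less_imp_le[OF psi_transform_strict_mono]\<close>)
  qed auto
  finally show ?thesis .
qed

lemma filterlim_psi_transform: "filterlim (psi_transform M) (at_left 0) (at_left 0)"
  unfolding filterlim_at
  by (intro conjI psi_transform_tendsto_0 eventually_mono[OF eventually_at_left_0_small[of 1]])
     (auto dest: psi_transform_neg)

lemma inj_on_psi_transform: "inj_on (psi_transform M) {..<0}"
proof (rule inj_onI)
  fix v w assume "v \<in> {..<0}" "w \<in> {..<0}" "psi_transform M v = psi_transform M w"
  then show "v = w"
    using psi_transform_strict_mono[of v w] psi_transform_strict_mono[of w v]
    by (cases v w rule: linorder_cases) auto
qed

lemma chi_psi: "w < 0 \<Longrightarrow> chi_transform M (psi_transform M w) = w"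
  unfolding chi_transform_def by (intro the_inv_into_f_f inj_on_psi_transform) auto

text \<open>
  The inverse function exists near \<open>0\<close> by the intermediate value theorem: \<open>\<psi>\<close> is continuous, increases strictly,
  and tends to \<open>0\<close> from the left. The third conclusion is monotonicity of \<open>\<chi>\<close> in a form that
  yields \<open>\<chi>(z) \<rightarrow> 0\<close>.
\<close>
lemma psi_chi:
  assumes "psi_transform M v \<le> z" "v < 0" "z < 0"
  shows "chi_transform M z < 0" "psi_transform M (chi_transform M z) = z" "v \<le> chi_transform M z"
proof -
  have "eventually (\<lambda>w. psi_transform M w > z \<and> v < w \<and> w < 0) (at_left 0)"
    using order_tendstoD(1)[OF psi_transform_tendsto_0 assms(3)] eventually_at_left_0_small[of "-v"] assms(2)
    by (auto elim: eventually_elim2)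
  then obtain w where w: "psi_transform M w > z" "v < w" "w < 0"
    using eventually_happens' trivial_limit_at_left_real by blast
  have "continuous_on {v..w} (psi_transform M)"
  proof -
    have "continuous_on {..<0} (\<lambda>w. stieltjes M 0 w - 1)"
      by (intro continuous_intros continuous_on_stieltjes_0)
    then have "continuous_on {v..w} (\<lambda>w. stieltjes M 0 w - 1)"
      by (rule continuous_on_subset) (use w in auto)
    then show ?thesis
      by (rule continuous_on_eq) (use w in \<open>auto simp: psi_transform_eq_stieltjes\<close>)
  qed
  then obtain u where u: "v \<le> u" "u \<le> w" "psi_transform M u = z"
    using IVT'[of "psi_transform M" v z w] w assms by auto
  then have "chi_transform M z = u" using chi_psi[of u] w by auto
  with u w show "chi_transform M z < 0" "psi_transform M (chi_transform M z) = z" "v \<le> chi_transform M z"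
    by auto
qed

lemma eventually_psi_chi:
  "eventually (\<lambda>z. chi_transform M z < 0 \<and> psi_transform M (chi_transform M z) = z) (at_left 0)"
proof (rule eventually_mono[OF eventually_at_left_0_small[of "- psi_transform M (-1)"]])
  fix z assume "- (- psi_transform M (- 1)) < z \<and> z < 0"
  then show "chi_transform M z < 0 \<and> psi_transform M (chi_transform M z) = z"
    using psi_chi(1,2)[of "-1" z] by simp
qed (use psi_transform_neg[of "-1"] in auto)

lemma filterlim_chi_transform: "filterlim (chi_transform M) (at_left 0) (at_left 0)"
  unfolding filterlim_at
proof (intro conjI)
  show "eventually (\<lambda>z. chi_transform M z \<in> {..<0} \<and> chi_transform M z \<noteq> 0) (at_left 0)"
    using eventually_psi_chi by eventually_elim auto
  show "(chi_transform M \<longlongrightarrow> 0) (at_left 0)"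
  proof (rule order_tendstoI)
    fix a :: real assume "a < 0"
    show "eventually (\<lambda>z. a < chi_transform M z) (at_left 0)"
    proof (rule eventually_mono[OF eventually_at_left_0_small[of "- psi_transform M (a/2)"]])
      fix z assume "- (- psi_transform M (a / 2)) < z \<and> z < 0"
      then have "a / 2 \<le> chi_transform M z" using \<open>a < 0\<close> by (intro psi_chi(3)) auto
      with \<open>a < 0\<close> show "a < chi_transform M z" by simp
    qed (use psi_transform_neg[of "a/2"] \<open>a < 0\<close> in auto)
  next
    fix a :: real assume "a > 0"
    show "eventually (\<lambda>z. chi_transform M z < a) (at_left 0)"
      using eventually_psi_chi by eventually_elim (use \<open>a > 0\<close> in auto)
  qed
qed

end

section \<open>Expansion of the S-transform at 0\<close>

context nontrivial_nonneg_distribution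
begin

lemma first_moment_pos: "integrable M (\<lambda>t. t) \<Longrightarrow> (\<integral>t. t \<partial>M) > 0"
  by (rule integral_pos_of_pos) auto

text \<open>
  Substituting \<open>v = \<chi>(z)\<close> in \<open>\<psi>(v) = v S\<^sub>1(v)\<close> expresses \<open>z / \<chi>(z)\<close> through a transform whose expansion
  in \<open>v\<close> is known.
\<close>
lemma id_div_chi_eq:
  assumes "integrable M (\<lambda>t. t)"
  shows "eventually (\<lambda>z. z / chi_transform M z = stieltjes M 1 (chi_transform M z)) (at_left 0)"
  using eventually_psi_chi
proof eventually_elim
  case (elim z)
  have "z = stieltjes M 0 (chi_transform M z) - 1"
    using elim psi_transform_eq_stieltjes by metis
  also have "stieltjes M 0 (chi_transform M z) = 1 + chi_transform M z * stieltjes M 1 (chi_transform M z)"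
    using stieltjes_Suc[of 0 "chi_transform M z"] elim by auto
  finally show ?case using elim by (simp add: field_simps)
qed

lemma id_div_chi_tendsto:
  assumes "integrable M (\<lambda>t. t)"
  shows "((\<lambda>z. z / chi_transform M z) \<longlongrightarrow> (\<integral>t. t \<partial>M)) (at_left 0)"
proof -
  have "((\<lambda>z. stieltjes M 1 (chi_transform M z)) \<longlongrightarrow> (\<integral>t. t ^ 1 \<partial>M)) (at_left 0)"
    by (rule filterlim_compose[OF stieltjes_tendsto_moment filterlim_chi_transform]) (use assms in simp)
  then show ?thesis
    unfolding power_one_right by (rule Lim_transform_eventually) (use id_div_chi_eq[OF assms] in eventually_elim, simp)
qed

lemma chi_bigo: "integrable M (\<lambda>t. t) \<Longrightarrow> chi_transform M \<in> O[at_left 0](\<lambda>w. \<bar>w\<bar> powr 1)"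
proof -
  assume i: "integrable M (\<lambda>t. t)"
  have "((\<lambda>z. inverse (z / chi_transform M z)) \<longlongrightarrow> inverse (\<integral>t. t \<partial>M)) (at_left 0)"
    using first_moment_pos[OF i] by (intro tendsto_inverse id_div_chi_tendsto i) auto
  then have "((\<lambda>z. chi_transform M z / z) \<longlongrightarrow> inverse (\<integral>t. t \<partial>M)) (at_left 0)"
    by (simp add: inverse_eq_divide)
  then have "chi_transform M \<in> O[at_left 0](\<lambda>z. z)"
    by (rule bigoI_tendsto) (auto intro: eventually_mono[OF eventually_at_left_0_small[of 1]])
  also have "(\<lambda>z::real. z) \<in> O[at_left 0](\<lambda>w. \<bar>w\<bar> powr 1)"
    by (rule bigoI[of _ 1]) auto
  finally show ?thesis .
qed

text \<open>
  For \<open>y = \<chi>(z) / z\<close> the relation \<open>1 = y S\<^sub>1(z y) = y (m + z y S\<^sub>2(z y))\<close> reads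
  \<open>y = (1 - z y\<^sup>2 S\<^sub>2(z y)) / m\<close>. The factor \<open>z\<close> on the right gains one order of precision at each substitution,
  which is the induction step; it can be repeated up to order \<open>p\<close>, since
  \<open>S\<^sub>2\<close> is known to order \<open>p - 1\<close>.
\<close>
lemma poly_upto_chi_div_id:
  assumes "\<And>j. j \<le> Suc p \<Longrightarrow> integrable M (\<lambda>t. t ^ j)" "k \<le> p"
  shows "poly_upto (real k) (\<lambda>z. chi_transform M z / z)"
  using assms(2)
proof (induction k)
  case 0
  have i: "integrable M (\<lambda>t. t)" using assms(1)[of 1] by simp
  have "(\<lambda>z. chi_transform M z / z) \<in> O[at_left 0](\<lambda>z. (\<bar>z\<bar> powr 1) / z)"
    by (intro landau_o.big.divide_right chi_bigo i) (auto intro: eventually_mono[OF eventually_at_left_0_small[of 1]])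
  also have "(\<lambda>z::real. (\<bar>z\<bar> powr 1) / z) \<in> O[at_left 0](\<lambda>z. \<bar>z\<bar> powr 0)"
    by (rule bigoI[of _ 1]) auto
  finally show ?case by (auto intro: poly_upto_bigo)
next
  case (Suc k)
  define m where "m = (\<integral>t. t \<partial>M)"
  define y where "y = (\<lambda>z. chi_transform M z / z)"
  have i: "integrable M (\<lambda>t. t)" using assms(1)[of 1] by simp
  have m: "m > 0" unfolding m_def by (rule first_moment_pos[OF i])
  have y: "poly_upto k y" unfolding y_def using Suc by simp
  have chi_y: "eventually (\<lambda>z. chi_transform M z = z * y z) (at_left 0)"
    by (rule eventually_mono[OF eventually_at_left_0_small[of 1]]) (auto simp: y_def)
  have chi: "poly_upto k (chi_transform M)"
    by (subst poly_upto_cong[OF chi_y]) (rule poly_upto_mono[OF poly_upto_times_id[OF y]], simp)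
  have S2: "poly_upto (real (p - 1)) (stieltjes M 2)"
    by (rule poly_upto_stieltjes) (use assms Suc in auto)
  have "poly_upto k (\<lambda>z. stieltjes M 2 (chi_transform M z))"
    by (rule poly_upto_compose[OF S2 filterlim_chi_transform chi_bigo[OF i] chi]) (use Suc.prems in auto)
  then have "poly_upto (real k + 1) (\<lambda>z. z * (y z * y z * stieltjes M 2 (chi_transform M z)))"
    by (intro poly_upto_times_id poly_upto_mult y) auto
  then have "poly_upto (real k + 1) (\<lambda>z. 1 / m * (1 - z * (y z * y z * stieltjes M 2 (chi_transform M z))))"
    by (intro poly_upto_cmult poly_upto_diff poly_upto_const)
  also have "?this \<longleftrightarrow> poly_upto (real (Suc k)) y"
    unfolding of_nat_Suc add.commute[of "real k"]
  proof (rule poly_upto_cong)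
    show "eventually (\<lambda>z. 1 / m * (1 - z * (y z * y z * stieltjes M 2 (chi_transform M z))) = y z) (at_left 0)"
      using id_div_chi_eq[OF i] eventually_psi_chi eventually_at_left_0_small[of 1, simplified]
    proof eventually_elim
      case (elim z)
      have "stieltjes M 1 (chi_transform M z) = m + chi_transform M z * stieltjes M 2 (chi_transform M z)"
        using stieltjes_Suc[of 1 "chi_transform M z"] elim assms(1) Suc.prems by (auto simp: m_def numeral_2_eq_2)
      with elim(1) have "1 = y z * (m + z * y z * stieltjes M 2 (chi_transform M z))"
        using elim(2,3) by (auto simp: y_def divide_eq_eq mult_ac)
      then show ?case using m by (simp add: field_simps)
    qed
  qed
  finally show ?case unfolding y_def .
qed

lemma recip_S_transform_eq:
  assumes "integrable M (\<lambda>t. t)"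
  shows "eventually (\<lambda>z. 1 / S_transform M z = 1 / (1 + z) * stieltjes M 1 (chi_transform M z)) (at_left 0)"
  using id_div_chi_eq[OF assms] eventually_at_left_0_small[of 1, simplified]
proof eventually_elim
  case (elim z)
  have "1 / S_transform M z = 1 / (1 + z) * (z / chi_transform M z)"
    using elim(2) by (simp add: S_transform_def add.commute)
  with elim show ?case by simp
qed

lemma recip_S_transform_tendsto:
  assumes "integrable M (\<lambda>t. t)"
  shows "((\<lambda>z. 1 / S_transform M z) \<longlongrightarrow> (\<integral>t. t \<partial>M)) (at_left 0)"
proof -
  have "((\<lambda>z. stieltjes M 1 (chi_transform M z)) \<longlongrightarrow> (\<integral>t. t ^ 1 \<partial>M)) (at_left 0)"
    by (rule filterlim_compose[OF stieltjes_tendsto_moment filterlim_chi_transform]) (use assms in simp)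
  then have "((\<lambda>z. 1 / (1 + z) * stieltjes M 1 (chi_transform M z)) \<longlongrightarrow> (\<integral>t. t \<partial>M)) (at_left 0)"
    by (auto intro!: tendsto_eq_intros)
  then show ?thesis
    by (rule Lim_transform_eventually) (use recip_S_transform_eq[OF assms] in eventually_elim, simp)
qed

lemma poly_upto_recip_S_transform:
  assumes "\<And>j. j \<le> Suc p \<Longrightarrow> integrable M (\<lambda>t. t ^ j)"
  shows "poly_upto (real p) (\<lambda>z. 1 / S_transform M z)"
proof -
  have i: "integrable M (\<lambda>t. t)" using assms(1)[of 1] by simp
  have chi_y: "eventually (\<lambda>z. chi_transform M z = z * (chi_transform M z / z)) (at_left 0)"
    by (rule eventually_mono[OF eventually_at_left_0_small[of 1]]) auto
  have chi: "poly_upto p (chi_transform M)"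
    by (subst poly_upto_cong[OF chi_y], rule poly_upto_mono[OF poly_upto_times_id[OF poly_upto_chi_div_id[of p p]]])
       (use assms in auto)
  have S1: "poly_upto (real p) (stieltjes M 1)"
    by (rule poly_upto_stieltjes) (use assms in auto)
  have "poly_upto p (\<lambda>z. stieltjes M 1 (chi_transform M z))"
    by (rule poly_upto_compose[OF S1 filterlim_chi_transform chi_bigo[OF i] chi]) auto
  then have "poly_upto p (\<lambda>z. 1 / (1 + z) * stieltjes M 1 (chi_transform M z))"
    by (intro poly_upto_mult poly_upto_geometric) auto
  then show ?thesis by (subst poly_upto_cong[OF recip_S_transform_eq[OF i]])
qed

end

text \<open>
  For \<open>z = \<psi>\<^sub>\<rho>(w)\<close> one has \<open>\<chi>\<^sub>\<rho>(z) = w\<close>, and dividing the identity of S-transforms by \<open>(z + 1) / z\<close>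
  gives \<open>\<chi>\<^sub>\<mu>(z) = w / S\<^sub>\<nu>(z)\<close>. Applying \<open>\<psi>\<^sub>\<mu>\<close> gives the fixed point equation.
\<close>
lemma psi_free_mult_conv:
  assumes \<mu>: "nontrivial_nonneg_distribution \<mu>" and \<nu>: "nontrivial_nonneg_distribution \<nu>"
    and \<rho>: "is_free_mult_conv \<mu> \<nu> \<rho>"
  shows "nontrivial_nonneg_distribution \<rho>"
    "eventually (\<lambda>w. psi_transform \<rho> w = psi_transform \<mu> (w * (1 / S_transform \<nu> (psi_transform \<rho> w)))) (at_left 0)"
proof -
  interpret \<mu>: nontrivial_nonneg_distribution \<mu> by fact
  interpret \<nu>: nontrivial_nonneg_distribution \<nu> by fact
  show *: "nontrivial_nonneg_distribution \<rho>"
    using \<rho> M_plus_imp_nonneg_distribution[of \<rho>]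
    by (auto simp: is_free_mult_conv_def nontrivial_nonneg_distribution_def nontrivial_nonneg_distribution_axioms_def)
  interpret \<rho>: nontrivial_nonneg_distribution \<rho> by fact
  from \<rho> obtain \<epsilon> where \<epsilon>: "\<epsilon> > 0" "\<And>z. z \<in> {-\<epsilon><..<0} \<Longrightarrow> S_transform \<rho> z = S_transform \<mu> z * S_transform \<nu> z"
    unfolding is_free_mult_conv_def by auto
  have "eventually (\<lambda>z. chi_transform \<rho> z / S_transform \<nu> z = chi_transform \<mu> z \<and>
      psi_transform \<mu> (chi_transform \<mu> z) = z) (at_left 0)"
    using eventually_at_left_0_small[OF \<epsilon>(1)] eventually_at_left_0_small[of 1, simplified]
      \<mu>.eventually_psi_chi \<nu>.eventually_psi_chi
  proof eventually_elim
    case (elim z)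
    have "S_transform \<nu> z \<noteq> 0" using elim by (auto simp: S_transform_def)
    moreover have "(z + 1) / z * chi_transform \<rho> z = (z + 1) / z * (chi_transform \<mu> z * S_transform \<nu> z)"
      using \<epsilon>(2)[of z] elim by (simp add: S_transform_def)
    moreover have "(z + 1) / z \<noteq> 0" using elim by auto
    ultimately show ?case using elim by (metis mult_left_cancel nonzero_mult_div_cancel_right)
  qed
  from eventually_compose_filterlim[OF this \<rho>.filterlim_psi_transform] eventually_at_left_0_small[of 1, simplified]
  show "eventually (\<lambda>w. psi_transform \<rho> w = psi_transform \<mu> (w * (1 / S_transform \<nu> (psi_transform \<rho> w)))) (at_left 0)"
    by eventually_elim (simp add: \<rho>.chi_psi)
qed

section \<open>Estimates for a regularly varying tail\<close>

text \<open>
  With truncated subtraction this is \<open>u / (1 + u)\<close> for \<open>p = 0\<close> and \<open>u\<^sup>p\<^sup>+\<^sup>1 / (1 + u)\<^sup>2\<close> for \<open>p \<ge> 1\<close>. At the origin it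
  vanishes to order \<open>p + 1 > \<alpha>\<close> and at infinity it grows with exponent below \<open>\<alpha>\<close> (or stays bounded if
  \<open>p = 0\<close>), so its integral against a tail of index \<open>\<alpha> \<in> [p, p + 1)\<close> at scale \<open>x\<close> is of the order of the
  tail at \<open>x\<close>. It does not decay at infinity relative to the indicator of \<open>(1, \<infinity>)\<close>, so no mass
  at infinity escapes.
\<close>
definition kappa :: "nat \<Rightarrow> real \<Rightarrow> real" where
  "kappa p u = (u / (1 + u)) ^ (p + 1) * (1 + u) ^ (p - 1)"

lemma kappa_measurable [measurable]: "kappa p \<in> borel_measurable borel"
  unfolding kappa_def by measurable

lemma kappa_nonneg: "u \<ge> 0 \<Longrightarrow> 0 \<le> kappa p u"
  by (simp add: kappa_def)

lemma kappa_le_1_plus_power: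
  assumes "u \<ge> 0" shows "kappa p u \<le> 2 ^ p * (1 + u ^ (p - 1))"
proof -
  have "kappa p u \<le> 1 ^ (p + 1) * (1 + u) ^ (p - 1)"
    unfolding kappa_def using assms by (intro mult_right_mono power_mono) (auto simp: divide_le_eq)
  also have "1 ^ (p + 1) * (1 + u) ^ (p - 1) = (1 + u) ^ (p - 1)" by simp
  also have "(1 + u) ^ (p - 1) \<le> (2 * max 1 u) ^ (p - 1)"
    using assms by (intro power_mono) (auto simp: mult_1_left intro: order_trans)
  also have "\<dots> \<le> 2 ^ (p - 1) * (1 + u ^ (p - 1))"
    using assms by (auto simp: power_mult_distrib max_def)
  also have "\<dots> \<le> 2 ^ p * (1 + u ^ (p - 1))"
    using assms by (intro mult_right_mono power_increasing) auto
  finally show ?thesis .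
qed

lemma kappa_le:
  assumes "u \<ge> 0"
  shows "kappa p u \<le> 2 ^ p * (min u 1 ^ (p + 1) + u powr real (p - 1) * indicator {1<..} u)"
proof (cases "u \<le> 1")
  case True
  have "kappa p u \<le> u ^ (p + 1) * 2 ^ (p - 1)"
    unfolding kappa_def using assms True
    by (intro mult_mono power_mono) (auto simp: divide_le_eq mult_le_cancel_left1)
  also have "\<dots> \<le> u ^ (p + 1) * 2 ^ p"
    using assms by (intro mult_left_mono power_increasing) auto
  finally show ?thesis using True by (simp add: mult.commute min_def)
next
  case False
  have "kappa p u \<le> 1 ^ (p + 1) * (2 * u) ^ (p - 1)"
    unfolding kappa_def using assms False by (intro mult_mono power_mono) (auto simp: divide_le_eq)
  also have "\<dots> \<le> 2 ^ p * u ^ (p - 1)"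
    using assms by (auto simp: power_mult_distrib intro!: mult_right_mono power_increasing)
  also have "\<dots> \<le> 2 ^ p * (min u 1 ^ (p + 1) + u ^ (p - 1))"
    using assms by (intro mult_left_mono) auto
  finally show ?thesis using False by (simp add: powr_realpow)
qed

lemma (in nonneg_distribution) integrable_kappa:
  assumes "integrable M (\<lambda>t. t ^ (p - 1))" "x > 0"
  shows "integrable M (\<lambda>t. kappa p (t / x))"
proof (rule Bochner_Integration.integrable_bound)
  show "integrable M (\<lambda>t. 2 ^ p * (1 + (t / x) ^ (p - 1)))"
    using assms by (auto simp: power_divide)
  show "AE t in M. norm (kappa p (t / x)) \<le> norm (2 ^ p * (1 + (t / x) ^ (p - 1)))"
    using AE_nonneg
  proof eventually_elim
    case (elim t)
    then have "0 \<le> t / x" using assms by simp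
    with kappa_nonneg[OF this, of p] kappa_le_1_plus_power[OF this, of p] show ?case by simp
  qed
qed auto

lemma abs_powr_eq_recip_powr: "w < 0 \<Longrightarrow> \<bar>w\<bar> powr s = (-1 / w) powr (-s)" for w :: real
  using inverse_powr[of "-w" s] by (simp add: powr_minus inverse_eq_divide)

text \<open>
  A tail that is regularly varying with index \<open>-\<alpha>\<close>. The limits are pointwise in \<open>c\<close>; monotonicity of the tail
  turns them into the uniform bounds below.
\<close>
locale rv_tail = nonneg_distribution +
  fixes \<alpha> :: real
  assumes alpha_nonneg: "\<alpha> \<ge> 0"
    and tail_pos: "measure M {x<..} > 0"
    and tail_ratio: "c > 0 \<Longrightarrow> ((\<lambda>x. measure M {c * x<..} / measure M {x<..}) \<longlongrightarrow> c powr (-\<alpha>)) at_top"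
begin

abbreviation b :: "real \<Rightarrow> real" where "b x \<equiv> measure M {x<..}"

lemma b_antimono: "x \<le> y \<Longrightarrow> b y \<le> b x"
  by (intro finite_measure_mono) auto

lemma b_bigo: "c > 0 \<Longrightarrow> (\<lambda>x. b (c * x)) \<in> O[at_top](b)"
  using tail_ratio[of c] tail_pos by (intro bigoI_tendsto[where c = "c powr (-\<alpha>)"]) (auto simp: less_imp_neq[symmetric])

lemma b_tendsto_0: "(b \<longlongrightarrow> 0) at_top"
proof -
  have "b x = 1 - cdf M x" for x
    unfolding cdf_def using prob_compl[of "{..x}"] by (simp add: Compl_eq_Diff_UNIV[symmetric])
  moreover have "((\<lambda>x. 1 - cdf M x) \<longlongrightarrow> 1 - 1) at_top"
    by (intro tendsto_intros cdf_lim_at_top_prob)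
  ultimately show ?thesis by simp
qed

text \<open>
  A Potter bound along powers of \<open>2\<close>, obtained by iterating the ratio of the tails at \<open>x/2\<close> and \<open>x\<close>. The constant accounts
  for small arguments, where the ratio is not controlled and the trivial bound by \<open>1\<close> is used.
\<close>
lemma potter_below:
  assumes "r > 2 powr \<alpha>"
  obtains C x0 where "C > 0" "x0 > 0" "\<And>x k. x \<ge> x0 \<Longrightarrow> b (x / 2 ^ k) \<le> C * r ^ k * b x"
proof -
  have "((\<lambda>x. b (1 / 2 * x) / b x) \<longlongrightarrow> 2 powr \<alpha>) at_top"
    using tail_ratio[of "1/2"] by (simp add: powr_divide powr_minus inverse_eq_divide)
  from order_tendstoD(2)[OF this assms]
  obtain x1 where x1: "\<And>x. x \<ge> x1 \<Longrightarrow> b (x / 2) / b x < r"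
    unfolding eventually_at_top_linorder by auto
  define x0 where "x0 = max x1 1"
  have x0: "b (x / 2) \<le> r * b x" if "x \<ge> x0" for x
    using x1[of x] that tail_pos[of x] by (simp add: x0_def field_simps less_imp_le)
  have "1 \<le> 2 powr \<alpha>" using alpha_nonneg by (simp add: ge_one_powr_ge_zero)
  with assms have r: "r \<ge> 1" by simp
  \<comment> \<open>capping the tail at \<open>b x0\<close> lets the induction continue once \<open>x / 2 ^ k\<close> has dropped below \<open>x0\<close>\<close>
  have *: "min (b (x / 2 ^ k)) (b x0) \<le> r ^ k * b x" if "x \<ge> x0" for x k
  proof (induction k)
    case (Suc k)
    have le: "r ^ k * b x \<le> r ^ Suc k * b x"
      using r by (intro mult_right_mono power_increasing) auto
    show ?case
    proof (cases "x / 2 ^ k \<ge> x0")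
      case True
      have "b (x / 2 ^ k) \<le> r ^ k * b x"
        using Suc b_antimono[OF True] by simp
      then have "r * b (x / 2 ^ k) \<le> r * (r ^ k * b x)"
        using r by (intro mult_left_mono) auto
      with x0[OF True] show ?thesis by (simp add: mult_ac min.coboundedI1)
    next
      case False
      then have "b x0 \<le> b (x / 2 ^ k)" by (intro b_antimono) simp
      with Suc le show ?thesis by simp
    qed
  qed auto
  show ?thesis
  proof (rule that[of "1 / b x0" x0])
    fix x k assume x: "x \<ge> x0"
    have "b (x / 2 ^ k) * b x0 \<le> min (b (x / 2 ^ k)) (b x0)"
      using mult_left_mono[OF prob_le_1[of "{x0<..}"], of "b (x / 2 ^ k)"]
        mult_right_mono[OF prob_le_1[of "{x / 2 ^ k<..}"], of "b x0"] by simp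
    also note *[OF x]
    finally show "b (x / 2 ^ k) \<le> 1 / b x0 * r ^ k * b x"
      using tail_pos[of x0] by (simp add: field_simps)
  qed (use tail_pos[of x0] in \<open>auto simp: x0_def\<close>)
qed

lemma potter_above:
  assumes "r > 2 powr (-\<alpha>)"
  obtains x0 where "x0 > 0" "\<And>x k. x \<ge> x0 \<Longrightarrow> b (2 ^ k * x) \<le> r ^ k * b x"
proof -
  from order_tendstoD(2)[OF tail_ratio[of 2] assms]
  obtain x1 where x1: "\<And>x. x \<ge> x1 \<Longrightarrow> b (2 * x) / b x < r"
    unfolding eventually_at_top_linorder by auto
  define x0 where "x0 = max x1 1"
  have x0: "b (2 * x) \<le> r * b x" if "x \<ge> x0" for x
    using x1[of x] that tail_pos[of x] by (simp add: x0_def field_simps less_imp_le)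
  have r: "r \<ge> 0" using assms powr_ge_zero[of 2 "-\<alpha>"] by linarith
  show ?thesis
  proof (rule that[of x0])
    fix x k assume x: "x \<ge> x0"
    show "b (2 ^ k * x) \<le> r ^ k * b x"
    proof (induction k)
      case (Suc k)
      have "x \<le> 2 ^ k * x" using x by (auto simp: x0_def mult_le_cancel_right1)
      then have "b (2 * (2 ^ k * x)) \<le> r * b (2 ^ k * x)" using x by (intro x0) auto
      also have "\<dots> \<le> r * (r ^ k * b x)" using Suc r by (intro mult_left_mono)
      finally show ?case by (simp add: mult_ac)
    qed auto
  qed (auto simp: x0_def)
qed

text \<open>
  The contribution of \<open>t\<close> below \<open>x\<close>: cut \<open>(0, x]\<close> into the dyadic pieces \<open>(x / 2\<^sup>k\<^sup>+\<^sup>1, x / 2\<^sup>k]\<close>. The Potter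
  bound with a rate \<open>r\<close> between \<open>2\<^sup>\<alpha>\<close> and \<open>2\<^sup>a\<close> turns the sum into a geometric series.
\<close>
lemma nn_integral_min_power_le:
  assumes "\<alpha> < real a"
  obtains C x0 where "C > 0" "x0 > 0"
    "\<And>x. x \<ge> x0 \<Longrightarrow> (\<integral>\<^sup>+t. ennreal (min (t / x) 1 ^ a) \<partial>M) \<le> ennreal (C * b x)"
proof -
  define r where "r = 2 powr ((\<alpha> + real a) / 2)"
  have "2 powr \<alpha> < r" unfolding r_def using assms by (intro powr_less_mono) auto
  then obtain C x0 where C: "C > 0" "x0 > 0" "\<And>x k. x \<ge> x0 \<Longrightarrow> b (x / 2 ^ k) \<le> C * r ^ k * b x"
    using potter_below by blast
  have "r < 2 powr real a" unfolding r_def using assms by (intro powr_less_mono) auto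
  then have r: "0 < r" "r < 2 ^ a" by (auto simp: r_def powr_realpow)
  have a: "a > 0" using assms alpha_nonneg by (cases a) auto
  show ?thesis
  proof (rule that[of "C * r * (1 / (1 - r / 2 ^ a))" x0])
    show "C * r * (1 / (1 - r / 2 ^ a)) > 0" using C r by (simp add: field_simps)
    fix x assume x: "x \<ge> x0"
    with C have x_pos: "x > 0" by simp
    have "(\<integral>\<^sup>+t. ennreal (min (t / x) 1 ^ a) \<partial>M)
       \<le> (\<integral>\<^sup>+t. (\<Sum>k. ennreal ((1 / 2 ^ k) ^ a) * indicator {x / 2 ^ Suc k<..} t) \<partial>M)"
    proof (rule nn_integral_mono_AE)
      show "AE t in M. ennreal (min (t / x) 1 ^ a) \<le>
          (\<Sum>k. ennreal ((1 / 2 ^ k) ^ a) * indicator {x / 2 ^ Suc k<..} t)"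
        using AE_nonneg
      proof eventually_elim
        case (elim t)
        show ?case
        proof (cases "t = 0")
          case True
          then show ?thesis using a by (simp add: min_def zero_power)
        next
          case False
          with elim x_pos have "t / x > 0" by simp
          then obtain n where "(1 / 2) ^ n < t / x" using real_arch_pow_inv[of "t / x" "1/2"] by auto
          then have ex: "1 / 2 ^ n < t / x" by (simp add: power_divide)
          have "1 / 2 ^ Suc n \<le> (1 / 2 ^ n :: real)" by (simp add: field_simps)
          with ex have ex: "\<exists>n. 1 / 2 ^ Suc n < t / x" by (intro exI[of _ n]) (rule le_less_trans)
          define k where "k = (LEAST n. 1 / 2 ^ Suc n < t / x)"
          have k: "1 / 2 ^ Suc k < t / x" unfolding k_def using ex by (rule LeastI_ex)
          have "min (t / x) 1 \<le> 1 / 2 ^ k"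
          proof (cases k)
            case (Suc j)
            have "\<not> 1 / 2 ^ Suc j < t / x"
              using not_less_Least[of j "\<lambda>n. 1 / 2 ^ Suc n < t / x"] Suc unfolding k_def by auto
            then show ?thesis using Suc by auto
          qed auto
          then have "ennreal (min (t / x) 1 ^ a) \<le> ennreal ((1 / 2 ^ k) ^ a)"
            using \<open>t / x > 0\<close> by (intro ennreal_leI power_mono) auto
          also have "\<dots> = ennreal ((1 / 2 ^ k) ^ a) * indicator {x / 2 ^ Suc k<..} t"
            using k x_pos by (simp add: field_simps)
          also have "\<dots> = (\<Sum>i\<in>{k}. ennreal ((1 / 2 ^ i) ^ a) * indicator {x / 2 ^ Suc i<..} t)"
            by (simp only: sum.insert finite.emptyI empty_iff sum.empty add_0_right not_False_eq_True)
          also have "\<dots> \<le> (\<Sum>k. ennreal ((1 / 2 ^ k) ^ a) * indicator {x / 2 ^ Suc k<..} t)"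
            by (rule sum_le_suminf) auto
          finally show ?thesis .
        qed
      qed
    qed
    also have "\<dots> = (\<Sum>k. \<integral>\<^sup>+t. ennreal ((1 / 2 ^ k) ^ a) * indicator {x / 2 ^ Suc k<..} t \<partial>M)"
      by (rule nn_integral_suminf) auto
    also have "\<dots> = (\<Sum>k. ennreal ((1 / 2 ^ k) ^ a * b (x / 2 ^ Suc k)))"
      by (intro suminf_cong) (simp add: nn_integral_cmult_indicator emeasure_eq_measure ennreal_mult)
    also have "\<dots> \<le> (\<Sum>k. ennreal (C * r * b x * (r / 2 ^ a) ^ k))"
    proof (intro suminf_le ennreal_leI)
      fix k
      have "(1 / 2 ^ k) ^ a * b (x / 2 ^ Suc k) \<le> (1 / 2 ^ k) ^ a * (C * r ^ Suc k * b x)"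
        using x by (intro mult_left_mono C) auto
      also have "\<dots> = C * r * b x * (r / 2 ^ a) ^ k"
        by (simp add: power_divide power_mult[symmetric] mult_ac)
      finally show "(1 / 2 ^ k) ^ a * b (x / 2 ^ Suc k) \<le> C * r * b x * (r / 2 ^ a) ^ k" .
    qed auto
    also have "\<dots> = ennreal (\<Sum>k. C * r * b x * (r / 2 ^ a) ^ k)"
      using r C by (intro suminf_ennreal2 summable_mult summable_geometric) (auto simp: field_simps)
    also have "(\<Sum>k. C * r * b x * (r / 2 ^ a) ^ k) = C * r * b x * (1 / (1 - r / 2 ^ a))"
      using r by (subst suminf_mult) (auto simp: suminf_geometric field_simps intro!: summable_geometric)
    finally show "(\<integral>\<^sup>+t. ennreal (min (t / x) 1 ^ a) \<partial>M) \<le> ennreal (C * r * (1 / (1 - r / 2 ^ a)) * b x)"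
      by (simp add: mult_ac)
  qed fact
qed

text \<open>
  The contribution of \<open>t\<close> above \<open>x\<close>, by the same dyadic argument. The case \<open>c = 0\<close> is separate because for
  \<open>\<alpha> = 0\<close> no geometric decay is available; there the integral is the tail itself.
\<close>
lemma nn_integral_powr_above_le:
  assumes c: "c \<ge> 0" "c < \<alpha> \<or> c = 0"
  obtains C x0 where "C > 0" "x0 > 0"
    "\<And>x. x \<ge> x0 \<Longrightarrow> (\<integral>\<^sup>+t. ennreal ((t / x) powr c * indicator {1<..} (t / x)) \<partial>M) \<le> ennreal (C * b x)"
proof (cases "c < \<alpha>")
  case False
  then have [simp]: "c = 0" using c by simp
  show ?thesis
  proof (rule that[of 1 1])
    fix x :: real assume "x \<ge> 1"
    then have "(\<integral>\<^sup>+t. ennreal ((t / x) powr c * indicator {1<..} (t / x)) \<partial>M) = (\<integral>\<^sup>+t. indicator {x<..} t \<partial>M)"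
      by (intro nn_integral_cong) (auto simp: indicator_def)
    then show "(\<integral>\<^sup>+t. ennreal ((t / x) powr c * indicator {1<..} (t / x)) \<partial>M) \<le> ennreal (1 * b x)"
      by (simp add: emeasure_eq_measure)
  qed auto
next
  case True
  define r where "r = 2 powr (- ((\<alpha> + c) / 2))"
  define s where "s = 2 powr c"
  have "2 powr (-\<alpha>) < r" unfolding r_def using True by (intro powr_less_mono) auto
  then obtain x0 where x0: "x0 > 0" "\<And>x k. x \<ge> x0 \<Longrightarrow> b (2 ^ k * x) \<le> r ^ k * b x"
    using potter_above by blast
  have "s * r = 2 powr (- ((\<alpha> - c) / 2))"
    unfolding s_def r_def powr_add[symmetric] by (rule arg_cong[of _ _ "(powr) 2"]) (simp add: field_simps)
  also have "\<dots> < 2 powr 0" using True by (intro powr_less_mono) auto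
  finally have sr: "s * r < 1" "s > 0" "r > 0" by (auto simp: r_def s_def)
  show ?thesis
  proof (rule that[of "s * (1 / (1 - s * r))" x0])
    show "s * (1 / (1 - s * r)) > 0" using sr by simp
    fix x assume x: "x \<ge> x0"
    with x0 have x_pos: "x > 0" by simp
    have "(\<integral>\<^sup>+t. ennreal ((t / x) powr c * indicator {1<..} (t / x)) \<partial>M)
       \<le> (\<integral>\<^sup>+t. (\<Sum>k. ennreal (s ^ Suc k) * indicator {2 ^ k * x<..} t) \<partial>M)"
    proof (rule nn_integral_mono)
      fix t
      show "ennreal ((t / x) powr c * indicator {1<..} (t / x)) \<le> (\<Sum>k. ennreal (s ^ Suc k) * indicator {2 ^ k * x<..} t)"
      proof (cases "t / x > 1")
        case True
        obtain n where "t / x < 2 ^ n" using real_arch_pow[of 2 "t / x"] by auto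
        also have "(2::real) ^ n \<le> 2 ^ Suc n" by simp
        finally have ex: "\<exists>n. t / x \<le> 2 ^ Suc n" by (intro exI[of _ n]) simp
        define k where "k = (LEAST n. t / x \<le> 2 ^ Suc n)"
        have k: "t / x \<le> 2 ^ Suc k" unfolding k_def using ex by (rule LeastI_ex)
        have "2 ^ k < t / x"
        proof (cases k)
          case (Suc j)
          have "\<not> t / x \<le> 2 ^ Suc j"
            using not_less_Least[of j "\<lambda>n. t / x \<le> 2 ^ Suc n"] Suc unfolding k_def by auto
          then show ?thesis using Suc by auto
        qed (use True in auto)
        have "ennreal ((t / x) powr c * indicator {1<..} (t / x)) \<le> ennreal ((2 ^ Suc k) powr c)"
          using k True c by (intro ennreal_leI) (auto intro!: powr_mono2)
        also have "(2 ^ Suc k) powr c = s ^ Suc k"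
          unfolding s_def by (simp only: powr_realpow[symmetric] zero_less_numeral powr_powr powr_gt_zero mult.commute)
        also have "ennreal (s ^ Suc k) = ennreal (s ^ Suc k) * indicator {2 ^ k * x<..} t"
          using \<open>2 ^ k < t / x\<close> x_pos by (simp add: field_simps)
        also have "\<dots> = (\<Sum>i\<in>{k}. ennreal (s ^ Suc i) * indicator {2 ^ i * x<..} t)"
          by (simp only: sum.insert finite.emptyI empty_iff sum.empty add_0_right not_False_eq_True)
        also have "\<dots> \<le> (\<Sum>k. ennreal (s ^ Suc k) * indicator {2 ^ k * x<..} t)"
          by (rule sum_le_suminf) auto
        finally show ?thesis .
      qed auto
    qed
    also have "\<dots> = (\<Sum>k. \<integral>\<^sup>+t. ennreal (s ^ Suc k) * indicator {2 ^ k * x<..} t \<partial>M)"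
      by (rule nn_integral_suminf) auto
    also have "\<dots> = (\<Sum>k. ennreal (s ^ Suc k * b (2 ^ k * x)))"
      using sr by (intro suminf_cong) (simp add: nn_integral_cmult_indicator emeasure_eq_measure ennreal_mult)
    also have "\<dots> \<le> (\<Sum>k. ennreal (s * b x * (s * r) ^ k))"
    proof (intro suminf_le ennreal_leI)
      fix k
      have "s ^ Suc k * b (2 ^ k * x) \<le> s ^ Suc k * (r ^ k * b x)"
        using x sr by (intro mult_left_mono x0) auto
      also have "\<dots> = s * b x * (s * r) ^ k"
        by (simp add: power_mult_distrib mult_ac)
      finally show "s ^ Suc k * b (2 ^ k * x) \<le> s * b x * (s * r) ^ k" .
    qed auto
    also have "\<dots> = ennreal (\<Sum>k. s * b x * (s * r) ^ k)"
      using sr by (intro suminf_ennreal2 summable_mult summable_geometric) auto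
    also have "(\<Sum>k. s * b x * (s * r) ^ k) = s * b x * (1 / (1 - s * r))"
      using sr by (subst suminf_mult) (auto simp: suminf_geometric intro!: summable_geometric)
    finally show "(\<integral>\<^sup>+t. ennreal ((t / x) powr c * indicator {1<..} (t / x)) \<partial>M) \<le> ennreal (s * (1 / (1 - s * r)) * b x)"
      by (simp add: mult_ac)
  qed fact
qed

lemma integrable_powr:
  assumes "0 \<le> s" "s < \<alpha>"
  shows "integrable M (\<lambda>t. t powr s)"
proof -
  obtain C x0 where C: "C > 0" "x0 > 0"
    "\<And>x. x \<ge> x0 \<Longrightarrow> (\<integral>\<^sup>+t. ennreal ((t / x) powr s * indicator {1<..} (t / x)) \<partial>M) \<le> ennreal (C * b x)"
    using nn_integral_powr_above_le[of s] assms by blast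
  have "integrable M (\<lambda>t. (t / x0) powr s * indicator {1<..} (t / x0))"
  proof (rule integrableI_nonneg)
    have "(\<integral>\<^sup>+t. ennreal ((t / x0) powr s * indicator {1<..} (t / x0)) \<partial>M) \<le> ennreal (C * b x0)"
      using C by auto
    also have "\<dots> < \<infinity>" by simp
    finally show "(\<integral>\<^sup>+t. ennreal ((t / x0) powr s * indicator {1<..} (t / x0)) \<partial>M) < \<infinity>" .
  qed auto
  then have "integrable M (\<lambda>t. x0 powr s * (1 + (t / x0) powr s * indicator {1<..} (t / x0)))"
    by auto
  then show ?thesis
  proof (rule Bochner_Integration.integrable_bound)
    show "AE t in M. norm (t powr s) \<le> norm (x0 powr s * (1 + (t / x0) powr s * indicator {1<..} (t / x0)))"
      using AE_nonneg
    proof eventually_elim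
      case (elim t)
      show ?case
      proof (cases "t > x0")
        case True
        then have "x0 powr s * (t / x0) powr s = t powr s"
          using C by (simp add: powr_mult[symmetric])
        then show ?thesis using True C by (simp add: algebra_simps)
      next
        case False
        then have "t powr s \<le> x0 powr s" using elim assms by (intro powr_mono2) auto
        then show ?thesis using False C by (simp add: indicator_def)
      qed
    qed
  qed auto
qed

lemma integrable_power:
  assumes "real j < \<alpha> \<or> j = 0"
  shows "integrable M (\<lambda>t. t ^ j)"
proof (cases "j = 0")
  case False
  then have "integrable M (\<lambda>t. t powr real j)" using assms by (intro integrable_powr) auto
  moreover have "AE t in M. t powr real j = t ^ j"
    using AE_nonneg by eventually_elim (use False in \<open>simp add: powr_realpow'\<close>)
  ultimately show ?thesis by (subst (asm) integrable_cong_AE) auto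
qed auto

lemma integral_kappa_le:
  assumes "real p \<le> \<alpha>" "\<alpha> < real p + 1"
  obtains C x0 where "C > 0" "x0 > 0"
    "\<And>x. x \<ge> x0 \<Longrightarrow> (\<integral>t. kappa p (t / x) \<partial>M) \<le> C * b x"
proof -
  obtain C1 x1 where 1: "C1 > 0" "x1 > 0"
    "\<And>x. x \<ge> x1 \<Longrightarrow> (\<integral>\<^sup>+t. ennreal (min (t / x) 1 ^ (p + 1)) \<partial>M) \<le> ennreal (C1 * b x)"
    using nn_integral_min_power_le[of "p + 1"] assms by auto
  have "real (p - 1) < \<alpha> \<or> real (p - 1) = 0" using assms by (cases p) auto
  then obtain C2 x2 where 2: "C2 > 0" "x2 > 0"
    "\<And>x. x \<ge> x2 \<Longrightarrow> (\<integral>\<^sup>+t. ennreal ((t / x) powr real (p - 1) * indicator {1<..} (t / x)) \<partial>M) \<le> ennreal (C2 * b x)"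
    using nn_integral_powr_above_le[of "real (p - 1)"] by auto
  show ?thesis
  proof (rule that[of "2 ^ p * (C1 + C2)" "max x1 x2"])
    fix x assume x: "x \<ge> max x1 x2"
    with 1 2 have x_pos: "x > 0" by simp
    have "(\<integral>\<^sup>+t. ennreal (kappa p (t / x)) \<partial>M) \<le>
      (\<integral>\<^sup>+t. ennreal (2 ^ p) * (ennreal (min (t / x) 1 ^ (p + 1)) + ennreal ((t / x) powr real (p - 1) * indicator {1<..} (t / x))) \<partial>M)"
    proof (rule nn_integral_mono_AE)
      show "AE t in M. ennreal (kappa p (t / x)) \<le>
         ennreal (2 ^ p) * (ennreal (min (t / x) 1 ^ (p + 1)) + ennreal ((t / x) powr real (p - 1) * indicator {1<..} (t / x)))"
        using AE_nonneg
      proof eventually_elim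
        case (elim t)
        then have "t / x \<ge> 0" using x_pos by simp
        from ennreal_leI[OF kappa_le[OF this, of p]] this show ?case
          by (simp add: ennreal_plus[symmetric] ennreal_mult[symmetric] del: ennreal_plus)
      qed
    qed
    also have "\<dots> = ennreal (2 ^ p) * ((\<integral>\<^sup>+t. ennreal (min (t / x) 1 ^ (p + 1)) \<partial>M) +
        (\<integral>\<^sup>+t. ennreal ((t / x) powr real (p - 1) * indicator {1<..} (t / x)) \<partial>M))"
      by (subst nn_integral_cmult, simp, subst nn_integral_add) auto
    also have "\<dots> \<le> ennreal (2 ^ p) * (ennreal (C1 * b x) + ennreal (C2 * b x))"
      using x by (intro mult_left_mono add_mono 1 2) auto
    also have "\<dots> = ennreal (2 ^ p * (C1 + C2) * b x)"
      using 1 2 by (simp add: ennreal_plus[symmetric] ennreal_mult[symmetric] algebra_simps del: ennreal_plus)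
    finally show "(\<integral>t. kappa p (t / x) \<partial>M) \<le> 2 ^ p * (C1 + C2) * b x"
      using 1 2 by (intro integral_real_bounded) auto
  qed (use 1 2 in auto)
qed

text \<open>
  A tail of index \<open>\<alpha>\<close> decays more slowly than \<open>x\<^sup>-\<^sup>r\<close> for every \<open>r > \<alpha>\<close>: going down from \<open>x\<close> to \<open>1\<close> in
  about \<open>log\<^sub>2 x\<close> halvings costs at most a power of \<open>x\<close> with exponent between \<open>\<alpha>\<close> and \<open>r\<close>.
\<close>
lemma powr_smallo_b:
  assumes "r > \<alpha>"
  shows "(\<lambda>w. \<bar>w\<bar> powr r) \<in> o[at_left 0](\<lambda>w. b (-1 / w))"
proof -
  define c where "c = (\<alpha> + r) / 2"
  have c: "\<alpha> < c" "c < r" "c > 0" using assms alpha_nonneg by (auto simp: c_def)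
  have "2 powr \<alpha> < 2 powr c" using c by simp
  then obtain C x0 where C: "C > 0" "x0 > 0" "\<And>x k. x \<ge> x0 \<Longrightarrow> b (x / 2 ^ k) \<le> C * (2 powr c) ^ k * b x"
    using potter_below by blast
  have *: "x powr (-c) \<le> C * 2 powr c / b 1 * b x" if x: "x \<ge> max 1 x0" for x
  proof -
    have ex: "\<exists>k. x \<le> 2 ^ k" using real_arch_pow[of 2 x] by (auto intro: less_imp_le)
    define k where "k = (LEAST k. x \<le> 2 ^ k)"
    have k: "x \<le> 2 ^ k" unfolding k_def using ex by (rule LeastI_ex)
    have k2: "2 ^ k \<le> 2 * x"
    proof (cases k)
      case (Suc j)
      have "\<not> x \<le> 2 ^ j" using not_less_Least[of j "\<lambda>k. x \<le> 2 ^ k"] Suc unfolding k_def by auto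
      then show ?thesis using Suc by auto
    qed (use x in auto)
    have "b 1 \<le> b (x / 2 ^ k)" using k by (intro b_antimono) auto
    also have "\<dots> \<le> C * (2 powr c) ^ k * b x" using x by (intro C) auto
    also have "(2 powr c) ^ k = (2 ^ k) powr c"
      by (simp add: powr_realpow[symmetric] powr_powr mult.commute)
    also have "C * (2 ^ k) powr c * b x \<le> C * (2 * x) powr c * b x"
      using C k2 c by (intro mult_right_mono mult_left_mono powr_mono2) auto
    also have "(2 * x) powr c = 2 powr c * x powr c" using x by (simp add: powr_mult)
    finally show ?thesis using tail_pos[of 1] x by (simp add: powr_minus field_simps)
  qed
  have "(\<lambda>w. \<bar>w\<bar> powr c) \<in> O[at_left 0](\<lambda>w. b (-1 / w))"
  proof (rule bigoI)
    show "eventually (\<lambda>w. norm (\<bar>w\<bar> powr c) \<le> C * 2 powr c / b 1 * norm (b (- 1 / w))) (at_left 0)"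
    proof (rule eventually_mono[OF eventually_at_left_0_small[of "1 / max 1 x0"]])
      have le_div: "m \<le> -1 / w" if "m > 0" "- (1 / m) < w" "w < 0" for m w :: real
        using that by (simp add: field_simps)
      fix w :: real assume w: "- (1 / max 1 x0) < w \<and> w < 0"
      have "max 1 x0 \<le> -1 / w" by (rule le_div) (use w in auto)
      from *[OF this] w abs_powr_eq_recip_powr[of w c] show "norm (\<bar>w\<bar> powr c) \<le> C * 2 powr c / b 1 * norm (b (- 1 / w))"
        by simp
    qed auto
  qed
  with powr_smallo_powr_at_left_0[OF c(2)] show ?thesis by (rule landau_o.small_big_trans)
qed

lemma b_bigo_powr:
  assumes "0 \<le> s" "s < \<alpha>"
  shows "(\<lambda>w. b (-1 / w)) \<in> O[at_left 0](\<lambda>w. \<bar>w\<bar> powr s)"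
proof (rule bigoI)
  let ?C = "\<integral>t. t powr s \<partial>M"
  show "eventually (\<lambda>w. norm (b (- 1 / w)) \<le> ?C * norm (\<bar>w\<bar> powr s)) (at_left 0)"
  proof (rule eventually_mono[OF eventually_at_left_0_small[of 1]])
    fix w :: real assume w: "- 1 < w \<and> w < 0"
    define x where "x = -1 / w"
    have x: "x > 0" "\<bar>w\<bar> powr s = x powr (-s)" using w abs_powr_eq_recip_powr[of w s] by (simp_all add: x_def)
    have "x powr s * b x = (\<integral>t. x powr s * indicator {x<..} t \<partial>M)" by simp
    also have "\<dots> \<le> ?C"
      by (intro integral_mono integrable_powr assms integrable_mult_right integrable_real_indicator)
         (use x assms in \<open>auto simp: indicator_def emeasure_eq_measure intro!: powr_mono2\<close>)
    finally show "norm (b (- 1 / w)) \<le> ?C * norm (\<bar>w\<bar> powr s)"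
      unfolding x(2) x_def[symmetric] using x(1) by (simp add: powr_minus field_simps)
  qed auto
qed

end

section \<open>Perturbing the argument of the psi-transform\<close>

lemma kappa_ge:
  assumes "u \<ge> 0" shows "u ^ (p + 1) / (1 + u) ^ 2 \<le> kappa p u"
proof (cases p)
  case 0
  have "u / (1 + u) ^ 2 \<le> u / (1 + u)"
    using assms by (intro divide_left_mono) (auto simp: power2_eq_square mult_le_cancel_left1)
  then show ?thesis by (simp add: 0 kappa_def)
next
  case (Suc k)
  then show ?thesis using assms by (simp add: kappa_def power_divide power2_eq_square)
qed

text \<open>
  This inequality is what makes the kernel \<open>kappa\<close> appear: it bounds the effect on the integrand of
  \<open>S\<^sub>p\<close> of dilating its argument.
\<close>
lemma recip_dilation_diff_le:
  fixes u h :: real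
  assumes "u \<ge> 0" "1 / 2 \<le> h"
  shows "u ^ p * \<bar>1 / (1 + h * u) - 1 / (1 + u)\<bar> \<le> 2 * \<bar>h - 1\<bar> * kappa p u"
proof -
  have hu: "0 \<le> h * u" "u / 2 \<le> h * u" using assms mult_right_mono[of "1/2" h u] by auto
  have "1 / (1 + h * u) - 1 / (1 + u) = (1 - h) * u / ((1 + h * u) * (1 + u))"
    using hu assms by (simp add: divide_simps) (simp add: algebra_simps)
  then have "u ^ p * \<bar>1 / (1 + h * u) - 1 / (1 + u)\<bar> = \<bar>h - 1\<bar> * (u ^ (p + 1) / ((1 + h * u) * (1 + u)))"
    using hu assms by (simp add: abs_mult abs_divide abs_minus_commute)
  also have "\<dots> \<le> \<bar>h - 1\<bar> * (u ^ (p + 1) / ((1 + u) / 2 * (1 + u)))"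
    using hu assms by (intro mult_left_mono divide_left_mono mult_right_mono) auto
  also have "\<dots> = 2 * \<bar>h - 1\<bar> * (u ^ (p + 1) / (1 + u) ^ 2)"
    by (simp add: power2_eq_square)
  also have "\<dots> \<le> 2 * \<bar>h - 1\<bar> * kappa p u"
    using assms by (intro mult_left_mono kappa_ge) auto
  finally show ?thesis .
qed

lemma power_Suc_div_le_powr:
  fixes u s :: real
  assumes "u \<ge> 0" "real k \<le> s" "s \<le> real k + 1"
  shows "u ^ Suc k / (1 + u) \<le> u powr s"
proof -
  consider "u = 0" | "0 < u" "u \<le> 1" | "u > 1" using assms by linarith
  then show ?thesis
  proof cases
    case 2
    have "u ^ Suc k / (1 + u) \<le> u ^ Suc k / 1" using 2 by (intro divide_left_mono) auto
    also have "\<dots> = u powr real (Suc k)" using powr_realpow[of u "Suc k"] 2 by simp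
    also have "\<dots> \<le> u powr s" using 2 assms by (intro powr_mono') auto
    finally show ?thesis .
  next
    case 3
    have "u ^ Suc k / (1 + u) \<le> u ^ Suc k / u" using 3 by (intro divide_left_mono) auto
    also have "\<dots> = u powr real k" using 3 by (simp add: powr_realpow)
    also have "\<dots> \<le> u powr s" using 3 assms by (intro powr_mono) auto
    finally show ?thesis .
  qed auto
qed

lemma filterlim_times_tendsto_1:
  assumes "(h \<longlongrightarrow> (1::real)) (at_left 0)"
  shows "filterlim (\<lambda>w. w * h w) (at_left 0) (at_left 0)"
  unfolding filterlim_at
proof
  show "((\<lambda>w. w * h w) \<longlongrightarrow> 0) (at_left 0)"
    using assms by (auto intro!: tendsto_eq_intros)
  have "eventually (\<lambda>w. h w > 0) (at_left 0)" using order_tendstoD(1)[OF assms, of 0] by simp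
  with eventually_at_left_0_small[of 1, simplified]
  show "eventually (\<lambda>w. w * h w \<in> {..<0} \<and> w * h w \<noteq> 0) (at_left 0)"
    by eventually_elim (auto simp: mult_neg_pos)
qed

lemma bigo_powr_dilate:
  assumes f: "f \<in> O[at_left 0](\<lambda>w. \<bar>w\<bar> powr s)" and h: "(h \<longlongrightarrow> (1::real)) (at_left 0)" and s: "s \<ge> 0"
  shows "(\<lambda>w. f (w * h w)) \<in> O[at_left 0](\<lambda>w. \<bar>w\<bar> powr s)"
proof -
  have "(\<lambda>w. f (w * h w)) \<in> O[at_left 0](\<lambda>w. \<bar>w * h w\<bar> powr s)"
    by (rule landau_o.big.compose[OF f filterlim_times_tendsto_1[OF h]])
  also have "(\<lambda>w. \<bar>w * h w\<bar> powr s) \<in> O[at_left 0](\<lambda>w. \<bar>w\<bar> powr s)"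
  proof (rule bigoI[of _ "2 powr s"])
    show "eventually (\<lambda>w. norm (\<bar>w * h w\<bar> powr s) \<le> 2 powr s * norm (\<bar>w\<bar> powr s)) (at_left 0)"
      using order_tendstoD(1)[OF h, of 0, simplified] order_tendstoD(2)[OF h, of 2, simplified]
    proof eventually_elim
      case (elim w)
      have "\<bar>w * h w\<bar> \<le> \<bar>w\<bar> * 2"
        using elim unfolding abs_mult by (intro mult_left_mono) auto
      then have "\<bar>w * h w\<bar> powr s \<le> (2 * \<bar>w\<bar>) powr s"
        using s by (intro powr_mono2) auto
      then show ?case by (simp add: powr_mult)
    qed
  qed
  finally show ?thesis .
qed

lemma power_minus_1_bigo:
  assumes "(\<lambda>w. h w - 1) \<in> O[F](f)" "(h \<longlongrightarrow> (1::real)) F"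
  shows "(\<lambda>w. h w ^ n - 1) \<in> O[F](f)"
proof (induction n)
  case (Suc n)
  have "h \<in> O[F](\<lambda>_. 1)" by (rule bigoI_tendsto[where c = 1]) (use assms(2) in auto)
  from landau_o.big.mult[OF this Suc] have "(\<lambda>w. h w * (h w ^ n - 1)) \<in> O[F](f)" by simp
  from sum_in_bigo(1)[OF this assms(1)] show ?case by (simp add: algebra_simps)
qed auto

text \<open>
  The constant term of the approximating polynomial is the limit, so the difference is at least linear.
\<close>
lemma poly_upto_minus_limit_bigo:
  assumes f: "poly_upto r f" and r: "1 \<le> r" and c: "(f \<longlongrightarrow> c) (at_left 0)"
  shows "(\<lambda>w. f w - c) \<in> O[at_left 0](\<lambda>w. \<bar>w\<bar> powr 1)"
proof -
  from poly_upto_mono[OF poly_upto_diff[OF f poly_upto_const[of r c]] r]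
  obtain q where q: "(\<lambda>w. f w - c - poly q w) \<in> O[at_left 0](\<lambda>w. \<bar>w\<bar> powr 1)"
    unfolding poly_upto_def by auto
  have "((\<lambda>w::real. \<bar>w\<bar> powr 1) \<longlongrightarrow> 0) (at_left 0)"
    by (auto intro!: tendsto_eq_intros)
  then have "(\<lambda>w::real. \<bar>w\<bar> powr 1) \<in> o[at_left 0](\<lambda>_. 1)" by (intro smalloI_tendsto) auto
  from smalloD_tendsto[OF landau_o.big_small_trans[OF q this]]
  have "((\<lambda>w. f w - c - poly q w) \<longlongrightarrow> 0) (at_left 0)" by simp
  moreover have "((\<lambda>w. f w - c - poly q w) \<longlongrightarrow> c - c - poly q 0) (at_left 0)"
    by (intro tendsto_intros c)
  ultimately have "poly q 0 = 0" using tendsto_unique[OF trivial_limit_at_left_real] by fastforce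
  then obtain q' where q': "q = pCons 0 q'" by (cases q) auto
  have "(\<lambda>w::real. w * poly q' w) \<in> O[at_left 0](\<lambda>w. w * 1)"
    by (intro landau_o.big.mult poly_bigo_1) auto
  then have "poly q \<in> O[at_left 0](\<lambda>w. \<bar>w\<bar> powr 1)"
    by (simp add: q' poly_pCons[abs_def])
  from sum_in_bigo(1)[OF q this] show ?thesis by simp
qed

context rv_tail
begin

text \<open>
  Interpolation between the moments of orders \<open>k\<close> and \<open>k + 1\<close>: \<open>u\<^sup>k\<^sup>+\<^sup>1 / (1 + u) \<le> u\<^sup>s\<close> and the moment of real order
  \<open>s < \<alpha>\<close> is finite.
\<close>
lemma stieltjes_bigo:
  assumes "real k \<le> s" "s \<le> real k + 1" "s < \<alpha>"
  shows "(\<lambda>w. w ^ Suc k * stieltjes M (Suc k) w) \<in> O[at_left 0](\<lambda>w. \<bar>w\<bar> powr s)"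
proof (rule bigoI)
  let ?C = "\<integral>t. t powr s \<partial>M"
  have s: "0 \<le> s" using assms by simp
  have "norm (w ^ Suc k * stieltjes M (Suc k) w) \<le> ?C * norm (\<bar>w\<bar> powr s)" if w: "-1 < w \<and> w < 0" for w
  proof -
    have "norm (w ^ Suc k * stieltjes M (Suc k) w) = (\<integral>t. \<bar>w\<bar> ^ Suc k * (t ^ Suc k / (1 - w * t)) \<partial>M)"
      using stieltjes_nonneg[of w "Suc k"] w
      by (simp add: stieltjes_def abs_mult power_abs del: power_Suc times_divide_eq_right)
    also have "\<dots> \<le> (\<integral>t. \<bar>w\<bar> powr s * t powr s \<partial>M)"
    proof (rule integral_mono_AE)
      show "integrable M (\<lambda>t. \<bar>w\<bar> ^ Suc k * (t ^ Suc k / (1 - w * t)))"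
        by (intro integrable_mult_right integrable_stieltjes integrable_power) (use w assms in auto)
      show "integrable M (\<lambda>t. \<bar>w\<bar> powr s * t powr s)"
        by (intro integrable_mult_right integrable_powr s assms)
      show "AE t in M. \<bar>w\<bar> ^ Suc k * (t ^ Suc k / (1 - w * t)) \<le> \<bar>w\<bar> powr s * t powr s"
        using AE_nonneg
      proof eventually_elim
        case (elim t)
        have "\<bar>w\<bar> ^ Suc k * (t ^ Suc k / (1 - w * t)) = (\<bar>w\<bar> * t) ^ Suc k / (1 + \<bar>w\<bar> * t)"
          unfolding power_mult_distrib using w by simp
        also have "\<dots> \<le> (\<bar>w\<bar> * t) powr s"
          by (rule power_Suc_div_le_powr) (use assms elim in auto)
        also have "\<dots> = \<bar>w\<bar> powr s * t powr s" using elim by (simp add: powr_mult)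
        finally show ?case .
      qed
    qed
    finally show ?thesis by (simp add: mult.commute)
  qed
  then show "eventually (\<lambda>w. norm (w ^ Suc k * stieltjes M (Suc k) w) \<le> ?C * norm (\<bar>w\<bar> powr s)) (at_left 0)"
    by (rule eventually_mono[OF eventually_at_left_0_small[of 1, simplified]])
qed

lemma stieltjes_dilate_smallo:
  assumes p: "real p \<le> \<alpha>" "\<alpha> < real p + 1" and h: "(h \<longlongrightarrow> 1) (at_left 0)"
  shows "(\<lambda>w. w ^ p * (stieltjes M p (w * h w) - stieltjes M p w)) \<in> o[at_left 0](\<lambda>w. b (-1 / w))"
proof -
  have mom: "integrable M (\<lambda>t. t ^ j)" if "j < p \<or> j = 0" for j
    using that p by (intro integrable_power) auto
  obtain C x0 where C: "C > 0" "x0 > 0" "\<And>x. x \<ge> x0 \<Longrightarrow> (\<integral>t. kappa p (t / x) \<partial>M) \<le> C * b x"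
    using integral_kappa_le[OF p] by blast
  have "(\<lambda>w. w ^ p * (stieltjes M p (w * h w) - stieltjes M p w)) \<in> O[at_left 0](\<lambda>w. (h w - 1) * b (-1 / w))"
  proof (rule bigoI[of _ "2 * C"])
    show "eventually (\<lambda>w. norm (w ^ p * (stieltjes M p (w * h w) - stieltjes M p w))
        \<le> 2 * C * norm ((h w - 1) * b (-1 / w))) (at_left 0)"
      using eventually_at_left_0_small[of "1 / x0", simplified, OF C(2)] order_tendstoD(1)[OF h, of "1/2", simplified]
    proof eventually_elim
      case (elim w)
      define x where "x = - 1 / w"
      have x: "x \<ge> x0" "x > 0" "w * h w < 0" using elim C by (auto simp: x_def field_simps mult_neg_pos)
      have "norm (w ^ p * (stieltjes M p (w * h w) - stieltjes M p w))
          = \<bar>\<integral>t. w ^ p * (t ^ p / (1 - (w * h w) * t) - t ^ p / (1 - w * t)) \<partial>M\<bar>"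
        unfolding stieltjes_def using elim x
        by (subst Bochner_Integration.integral_diff[symmetric])
           (auto intro!: integrable_stieltjes mom simp del: times_divide_eq_right)
      also have "\<dots> \<le> (\<integral>t. 2 * \<bar>h w - 1\<bar> * kappa p (t / x) \<partial>M)"
      proof (rule order_trans[OF integral_abs_bound integral_mono_AE])
        show "integrable M (\<lambda>t. \<bar>w ^ p * (t ^ p / (1 - w * h w * t) - t ^ p / (1 - w * t))\<bar>)"
          using x elim by (intro integrable_abs integrable_mult_right Bochner_Integration.integrable_diff
              integrable_stieltjes mom) auto
        show "integrable M (\<lambda>t. 2 * \<bar>h w - 1\<bar> * kappa p (t / x))"
          using x by (intro integrable_mult_right integrable_kappa mom) auto
        show "AE t in M. \<bar>w ^ p * (t ^ p / (1 - w * h w * t) - t ^ p / (1 - w * t))\<bar> \<le> 2 * \<bar>h w - 1\<bar> * kappa p (t / x)"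
          using AE_nonneg
        proof eventually_elim
          case t: (elim t)
          define u where "u = t / x"
          have u: "u \<ge> 0" "w * t = - u" using t x(2) elim by (simp add: u_def, simp add: u_def x_def)
          have "w ^ p * (t ^ p / (1 - w * h w * t) - t ^ p / (1 - w * t)) =
              (w * t) ^ p * (1 / (1 - h w * (w * t)) - 1 / (1 - w * t))"
            by (simp add: power_mult_distrib right_diff_distrib mult_ac)
          also have "\<bar>\<dots>\<bar> = u ^ p * \<bar>1 / (1 + h w * u) - 1 / (1 + u)\<bar>"
            using u by (simp add: abs_mult power_abs)
          also have "\<dots> \<le> 2 * \<bar>h w - 1\<bar> * kappa p u"
            by (rule recip_dilation_diff_le) (use u elim in auto)
          finally show ?case unfolding u_def .
        qed
      qed
      also have "\<dots> = 2 * \<bar>h w - 1\<bar> * (\<integral>t. kappa p (t / x) \<partial>M)" by simp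
      also have "\<dots> \<le> 2 * \<bar>h w - 1\<bar> * (C * b x)"
        using x by (intro mult_left_mono C) auto
      finally show ?case by (simp add: x_def abs_mult mult_ac)
    qed
  qed
  also have "(\<lambda>w. (h w - 1) * b (-1 / w)) \<in> o[at_left 0](\<lambda>w. 1 * b (-1 / w))"
  proof (rule landau_o.small.mult_right)
    have "((\<lambda>w. h w - 1) \<longlongrightarrow> 1 - 1) (at_left 0)" by (intro tendsto_intros h)
    then show "(\<lambda>w. h w - 1) \<in> o[at_left 0](\<lambda>_. 1)" by (intro smalloI_tendsto) auto
  qed
  finally show ?thesis by simp
qed

lemma poly_upto_stieltjes_0:
  assumes p: "real (Suc k) \<le> \<alpha>" and s: "real k \<le> s" "s \<le> real k + 1" "s < \<alpha>"
  shows "poly_upto s (stieltjes M 0)"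
proof -
  have mom: "integrable M (\<lambda>t. t ^ j)" if "j \<le> k" for j
    using that p by (intro integrable_power) auto
  have "poly_upto s (\<lambda>w. (\<Sum>j<Suc k. (\<integral>t. t ^ (0 + j) \<partial>M) * w ^ j) + w ^ Suc k * stieltjes M (0 + Suc k) w)"
    using s stieltjes_bigo[OF s]
    by (intro poly_upto_add poly_upto_sum poly_upto_cmult poly_upto_power poly_upto_id poly_upto_bigo) auto
  then show ?thesis
    by (subst poly_upto_cong[OF eventually_mono[OF eventually_at_left_0_small[of 1] stieltjes_expansion[of 0 "Suc k"]]])
       (use mom in auto)
qed

text \<open>
  With \<open>h(w) = g(F(w))\<close> the difference is
  \<open>\<Sum>\<^sub>j\<^sub><\<^sub>p m\<^sub>j ((w h)\<^sup>j - w\<^sup>j) + (h\<^sup>p - 1) w\<^sup>p S\<^sub>p(w h) + w\<^sup>p (S\<^sub>p(w h) - S\<^sub>p(w))\<close>, called \<open>A + B + D\<close> in the proof. The last term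
  is \<open>o(b)\<close> by dilation. The middle one is small because both factors are, their orders adding up to almost
  \<open>p + 1 > \<alpha>\<close>. For the sum it suffices to expand \<open>w h\<close> beyond order \<open>\<alpha>\<close>. This is
  a bootstrap: if \<open>F\<close> is known to order \<open>r\<close>, so is \<open>h\<close>, hence \<open>w h\<close> to order \<open>r + 1\<close>, and then
  \<open>F = \<psi>\<^sub>M(w h)\<close> to order \<open>r + 1\<close> as well, until the precision \<open>p - \<eta>\<close> of \<open>\<psi>\<^sub>M\<close> is reached. For \<open>p = 0\<close> only the
  last term is present.
\<close>
lemma composition_difference:
  assumes p: "real p \<le> \<alpha>" "\<alpha> < real p + 1"
    and F0: "filterlim F (at_left 0) (at_left 0)"
    and g1: "(g \<longlongrightarrow> 1) (at_left 0)" and gp: "poly_upto (real p) g"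
    and F: "eventually (\<lambda>w. F w = stieltjes M 0 (w * g (F w)) - 1) (at_left 0)"
  obtains q where "(\<lambda>w. F w + 1 - stieltjes M 0 w - poly q w) \<in> o[at_left 0](\<lambda>w. b (-1 / w))"
proof -
  define h where "h = (\<lambda>w. g (F w))"
  have h1: "(h \<longlongrightarrow> 1) (at_left 0)" unfolding h_def by (rule filterlim_compose[OF g1 F0])
  note wh0 = filterlim_times_tendsto_1[OF h1]
  have wh_neg: "eventually (\<lambda>w. w < 0 \<and> w * h w < 0) (at_left 0)"
    using eventually_compose_filterlim[OF eventually_at_left_0_small[OF zero_less_one] wh0] eventually_at_left_0_small[of 1, simplified]
    by eventually_elim auto
  note [simp del] = power_Suc
  show ?thesis
  proof (cases p)
    case 0
    have "(\<lambda>w. w ^ p * (stieltjes M p (w * h w) - stieltjes M p w)) \<in> o[at_left 0](\<lambda>w. b (-1 / w))"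
      by (rule stieltjes_dilate_smallo[OF p h1])
    also have "?this \<longleftrightarrow> (\<lambda>w. F w + 1 - stieltjes M 0 w - poly 0 w) \<in> o[at_left 0](\<lambda>w. b (-1 / w))"
      by (rule landau_o.small.in_cong) (use F in eventually_elim, simp add: 0 h_def)
    finally show ?thesis by (rule that)
  next
    case (Suc k)
    \<comment> \<open>\<open>\<psi>\<^sub>M\<close> is known to order \<open>p - \<eta>\<close>; the final errors have order at least \<open>p + 1 - 2 \<eta>\<close>, which exceeds \<open>\<alpha>\<close>\<close>
    define \<eta> where "\<eta> = (real p + 1 - \<alpha>) / 4"
    \<comment> \<open>loss in \<open>F = O(|w|\<^sup>1\<^sup>-\<^sup>\<eta>\<^sup>0)\<close>, chosen so that the error \<open>|F|\<^sup>p\<close> of \<open>g \<circ> F\<close> has order \<open>p - \<eta>\<close>\<close>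
    define \<eta>0 where "\<eta>0 = \<eta> / real p"
    have p1: "real p \<ge> 1" using Suc by simp
    have \<eta>: "0 < \<eta>" "\<eta> \<le> 1 / 4" using p by (auto simp: \<eta>_def)
    have \<eta>0: "0 < \<eta>0" "\<eta>0 \<le> \<eta>" "real p * (1 - \<eta>0) = real p - \<eta>"
      using \<eta> p1 by (auto simp: \<eta>0_def field_simps mult_le_cancel_left1)
    have mom: "integrable M (\<lambda>t. t ^ j)" if "j < p" for j
      using that p by (intro integrable_power) auto
    have bnd1: "(\<lambda>w. w ^ Suc 0 * stieltjes M (Suc 0) w) \<in> O[at_left 0](\<lambda>w. \<bar>w\<bar> powr (1 - \<eta>0))"
      by (rule stieltjes_bigo) (use p p1 \<eta> \<eta>0 in auto)
    have FO: "F \<in> O[at_left 0](\<lambda>w. \<bar>w\<bar> powr (1 - \<eta>0))"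
    proof -
      have "(\<lambda>w. (w * h w) ^ Suc 0 * stieltjes M (Suc 0) (w * h w)) \<in> O[at_left 0](\<lambda>w. \<bar>w\<bar> powr (1 - \<eta>0))"
        using bigo_powr_dilate[OF bnd1 h1] \<eta> \<eta>0 by simp
      also have "?this \<longleftrightarrow> ?thesis"
      proof (rule landau_o.big.in_cong)
        show "eventually (\<lambda>w. (w * h w) ^ Suc 0 * stieltjes M (Suc 0) (w * h w) = F w) (at_left 0)"
          using F wh_neg
        proof eventually_elim
          case (elim w)
          have "stieltjes M 0 (w * h w) = 1 + w * h w * stieltjes M (Suc 0) (w * h w)"
            using elim by (subst stieltjes_Suc) auto
          with elim(1) show ?case by (simp add: h_def)
        qed
      qed
      finally show ?thesis .
    qed
    have Psi: "poly_upto (real p - \<eta>) (stieltjes M 0)"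
      by (rule poly_upto_stieltjes_0[of k]) (use Suc p \<eta> in auto)
    have h_poly: "poly_upto r h" if "poly_upto r F" "0 \<le> r" "r \<le> real p - \<eta>" for r
      unfolding h_def by (rule poly_upto_compose[OF gp F0 FO that(1,2)]) (use that \<eta>0 in auto)
    have wh_poly: "poly_upto (r + 1) (\<lambda>w. w * h w)" if "poly_upto r F" "0 \<le> r" "r \<le> real p - \<eta>" for r
      by (intro poly_upto_times_id h_poly that)
    have wh_O: "(\<lambda>w. w * h w) \<in> O[at_left 0](\<lambda>w. \<bar>w\<bar> powr 1)"
      by (rule bigo_powr_dilate[OF _ h1]) (auto intro!: bigoI[of _ 1])
    have F_poly: "poly_upto (min (real n) (real p - \<eta>)) F" for n
    proof (induction n)
      case 0
      have "min (real 0) (real p - \<eta>) \<le> 1 - \<eta>0" using \<eta> \<eta>0 by simp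
      with poly_upto_bigo[OF FO] show ?case by (rule poly_upto_mono)
    next
      case (Suc n)
      define r where "r = min (real n) (real p - \<eta>)"
      have r: "0 \<le> r" "r \<le> real p - \<eta>" using \<eta> p1 by (auto simp: r_def)
      have "poly_upto (r + 1) (\<lambda>w. w * h w)"
        by (rule wh_poly) (use Suc r in \<open>auto simp: r_def\<close>)
      then have "poly_upto (min (r + 1) (real p - \<eta>)) (\<lambda>w. w * h w)"
        by (rule poly_upto_mono) simp
      then have "poly_upto (min (r + 1) (real p - \<eta>)) (\<lambda>w. stieltjes M 0 (w * h w))"
        using r \<eta> p1 by (intro poly_upto_compose[OF Psi wh0 wh_O]) auto
      then have "poly_upto (min (r + 1) (real p - \<eta>)) (\<lambda>w. stieltjes M 0 (w * h w) - 1)"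
        by (intro poly_upto_diff poly_upto_const)
      also have "?this \<longleftrightarrow> poly_upto (min (r + 1) (real p - \<eta>)) F"
        by (rule poly_upto_cong) (use F in eventually_elim, simp add: h_def)
      finally show ?case by (rule poly_upto_mono) (auto simp: r_def)
    qed
    have F_poly': "poly_upto (real p - \<eta>) F" using F_poly[of p] \<eta> by (simp add: min_def)
    have wh: "poly_upto (real p + 1 - \<eta>) (\<lambda>w. w * h w)"
      using wh_poly[OF F_poly'] \<eta> p1 by (simp add: algebra_simps)
    define A where "A = (\<lambda>w. \<Sum>j<p. (\<integral>t. t ^ (0 + j) \<partial>M) * ((w * h w) ^ j - w ^ j))"
    have "poly_upto (real p + 1 - \<eta>) A"
      unfolding A_def using \<eta> p1
      by (intro poly_upto_sum poly_upto_cmult poly_upto_diff poly_upto_power wh poly_upto_id) auto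
    then obtain q where q: "(\<lambda>w. A w - poly q w) \<in> O[at_left 0](\<lambda>w. \<bar>w\<bar> powr (real p + 1 - \<eta>))"
      unfolding poly_upto_def by auto
    have q: "(\<lambda>w. A w - poly q w) \<in> o[at_left 0](\<lambda>w. b (-1 / w))"
      by (rule landau_o.big_small_trans[OF q powr_smallo_b]) (use p in \<open>simp add: \<eta>_def field_simps\<close>)
    define B where "B = (\<lambda>w. (h w ^ p - 1) * (w ^ p * stieltjes M p (w * h w)))"
    have "(\<lambda>z. g z - 1) \<in> O[at_left 0](\<lambda>z. \<bar>z\<bar> powr 1)"
      by (rule poly_upto_minus_limit_bigo[OF gp p1 g1])
    from landau_o.big.compose[OF this F0] have "(\<lambda>w. h w - 1) \<in> O[at_left 0](F)"
      unfolding h_def by simp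
    then have "(\<lambda>w. h w - 1) \<in> O[at_left 0](\<lambda>w. \<bar>w\<bar> powr (1 - \<eta>0))"
      by (rule landau_o.big_trans[OF _ FO])
    then have B1: "(\<lambda>w. h w ^ p - 1) \<in> O[at_left 0](\<lambda>w. \<bar>w\<bar> powr (1 - \<eta>0))"
      by (rule power_minus_1_bigo[OF _ h1])
    have "(\<lambda>w. w ^ Suc k * stieltjes M (Suc k) w) \<in> O[at_left 0](\<lambda>w. \<bar>w\<bar> powr (real p - \<eta>))"
      by (rule stieltjes_bigo) (use p Suc \<eta> in auto)
    then have "(\<lambda>w. w ^ p * stieltjes M p w) \<in> O[at_left 0](\<lambda>w. \<bar>w\<bar> powr (real p - \<eta>))"
      unfolding Suc .
    from bigo_powr_dilate[OF this h1] have B2: "(\<lambda>w. (w * h w) ^ p * stieltjes M p (w * h w)) \<in> O[at_left 0](\<lambda>w. \<bar>w\<bar> powr (real p - \<eta>))"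
      using \<eta> p1 by simp
    have "(\<lambda>w. w ^ p * stieltjes M p (w * h w)) \<in> O[at_left 0](\<lambda>w. (w * h w) ^ p * stieltjes M p (w * h w))"
    proof (rule bigoI[of _ "2 ^ p"])
      show "eventually (\<lambda>w. norm (w ^ p * stieltjes M p (w * h w)) \<le>
          2 ^ p * norm ((w * h w) ^ p * stieltjes M p (w * h w))) (at_left 0)"
        using order_tendstoD(1)[OF h1, of "1/2", simplified]
      proof eventually_elim
        case (elim w)
        have "\<bar>w\<bar> ^ p \<le> (2 * \<bar>w * h w\<bar>) ^ p"
          using elim mult_left_mono[of 1 "2 * h w" "\<bar>w\<bar>"] by (intro power_mono) (auto simp: abs_mult)
        then have "\<bar>w\<bar> ^ p * \<bar>stieltjes M p (w * h w)\<bar> \<le> (2 * \<bar>w * h w\<bar>) ^ p * \<bar>stieltjes M p (w * h w)\<bar>"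
          by (intro mult_right_mono) auto
        then show ?case by (simp add: abs_mult power_abs power_mult_distrib mult_ac)
      qed
    qed
    from landau_o.big.mult[OF B1 landau_o.big_trans[OF this B2]]
    have "B \<in> O[at_left 0](\<lambda>w. \<bar>w\<bar> powr (real p + 1 - \<eta> - \<eta>0))"
      unfolding B_def by (simp add: powr_add[symmetric] algebra_simps)
    then have B: "B \<in> o[at_left 0](\<lambda>w. b (-1 / w))"
      by (rule landau_o.big_small_trans[OF _ powr_smallo_b]) (use p \<eta>0(2) in \<open>simp add: \<eta>_def field_simps\<close>)
    define D where "D = (\<lambda>w. w ^ p * (stieltjes M p (w * h w) - stieltjes M p w))"
    have D: "D \<in> o[at_left 0](\<lambda>w. b (-1 / w))"
      unfolding D_def by (rule stieltjes_dilate_smallo[OF p h1])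
    have "(\<lambda>w. (A w - poly q w) + (B w + D w)) \<in> o[at_left 0](\<lambda>w. b (-1 / w))"
      by (intro sum_in_smallo q B D)
    also have "?this \<longleftrightarrow> (\<lambda>w. F w + 1 - stieltjes M 0 w - poly q w) \<in> o[at_left 0](\<lambda>w. b (-1 / w))"
    proof (rule landau_o.small.in_cong)
      show "eventually (\<lambda>w. (A w - poly q w) + (B w + D w) = F w + 1 - stieltjes M 0 w - poly q w) (at_left 0)"
        using F wh_neg
      proof eventually_elim
        case (elim w)
        have "F w + 1 = stieltjes M 0 (w * h w)" using elim(1) by (simp add: h_def)
        also have "\<dots> = (\<Sum>j<p. (\<integral>t. t ^ (0 + j) \<partial>M) * (w * h w) ^ j) + (w * h w) ^ p * stieltjes M (0 + p) (w * h w)"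
          by (rule stieltjes_expansion) (use elim mom in auto)
        finally have 1: "F w + 1 = \<dots>" .
        have 2: "stieltjes M 0 w = (\<Sum>j<p. (\<integral>t. t ^ (0 + j) \<partial>M) * w ^ j) + w ^ p * stieltjes M (0 + p) w"
          by (rule stieltjes_expansion) (use elim mom in auto)
        show ?case unfolding 1 2 A_def B_def D_def
          by (simp add: right_diff_distrib sum_subtractf power_mult_distrib algebra_simps)
      qed
    qed
    finally show ?thesis by (rule that)
  qed
qed

end

section \<open>Remainders beyond the finite moments\<close>

lemma coeff_0_imp_poly_eq:
  fixes q :: "real poly"
  assumes "\<And>j. j < k \<Longrightarrow> coeff q j = 0"
  obtains q' where "\<And>w. poly q w = w ^ k * poly q' w"
proof -
  have "monom 1 k dvd q" using assms by (simp add: monom_1_dvd_iff')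
  then obtain q' where "q = monom 1 k * q'" by (elim dvdE)
  then have "poly q w = w ^ k * poly q' w" for w by (simp add: poly_monom)
  then show ?thesis by (rule that)
qed

lemma power_smallo_of_smallo_Suc:
  assumes "((\<lambda>w. w * f w) \<longlongrightarrow> 0) (at_left (0::real))"
  shows "(\<lambda>w. w ^ Suc k * f w) \<in> o[at_left 0](\<lambda>w. w ^ k :: real)"
proof -
  have "(\<lambda>w. w ^ k * (w * f w)) \<in> o[at_left 0](\<lambda>w. w ^ k * 1)"
    by (rule landau_o.small.mult_left) (use assms in \<open>auto intro!: smalloI_tendsto\<close>)
  then show ?thesis by (simp add: mult_ac)
qed

lemma powr_smallo_power:
  assumes "real k < s" shows "(\<lambda>w. \<bar>w\<bar> powr s) \<in> o[at_left 0](\<lambda>w. w ^ k :: real)"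
proof -
  have "(\<lambda>w::real. \<bar>w\<bar> powr real k) \<in> O[at_left 0](\<lambda>w. w ^ k)"
    by (rule bigoI[of _ 1], use power_eq_powr_at_left_0[of k] in eventually_elim) (simp add: power_abs)
  with powr_smallo_powr_at_left_0[OF assms] show ?thesis by (rule landau_o.small_big_trans)
qed

text \<open>
  A polynomial expansion of the transform forces finite moments. If the moments of order below \<open>k\<close> are finite,
  \<open>w\<^sup>k S\<^sub>k(w)\<close> has a polynomial expansion and is \<open>o(|w|\<^sup>k\<^sup>-\<^sup>1)\<close>; so the polynomial starts in degree \<open>k\<close>,
  \<open>S\<^sub>k\<close> is bounded, and the moment of order \<open>k\<close> is finite by Fatou's lemma.
\<close>
lemma (in nonneg_distribution) integrable_power_if_poly_upto:
  assumes s: "poly_upto s (stieltjes M 0)" and k: "real k \<le> s" and j: "j \<le> k"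
  shows "integrable M (\<lambda>t. t ^ j)"
  using k j
proof (induction k arbitrary: j)
  case (Suc k)
  have mom: "integrable M (\<lambda>t. t ^ i)" if "i < Suc k" for i
    using Suc.IH[of i] Suc.prems that by auto
  define f where "f = (\<lambda>w. w ^ Suc k * stieltjes M (Suc k) w)"
  have "poly_upto s (\<lambda>w. stieltjes M 0 w - (\<Sum>j<Suc k. (\<integral>t. t ^ (0 + j) \<partial>M) * w ^ j))"
    using Suc.prems by (intro poly_upto_diff s poly_upto_sum poly_upto_cmult poly_upto_power poly_upto_id) auto
  also have "?this \<longleftrightarrow> poly_upto s f"
    by (rule poly_upto_cong, rule eventually_mono[OF eventually_at_left_0_small[of 1]])
       (use stieltjes_expansion[of 0 "Suc k"] mom in \<open>auto simp: f_def\<close>)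
  finally obtain q where q: "(\<lambda>w. f w - poly q w) \<in> O[at_left 0](\<lambda>w. \<bar>w\<bar> powr s)"
    unfolding poly_upto_def by auto
  have fo: "f \<in> o[at_left 0](\<lambda>w. w ^ k)"
    unfolding f_def by (rule power_smallo_of_smallo_Suc[OF id_times_stieltjes_tendsto_0]) (use mom in auto)
  have "(\<lambda>w. f w - poly q w) \<in> o[at_left 0](\<lambda>w. w ^ k)"
    by (rule landau_o.big_small_trans[OF q powr_smallo_power]) (use Suc.prems in auto)
  from sum_in_smallo(2)[OF fo this] have "poly q \<in> o[at_left 0](\<lambda>w. w ^ k)" by simp
  then have "coeff q i = 0" if "i < Suc k" for i using poly_smallo_coeff that by auto
  then obtain q' where q': "\<And>w. poly q w = w ^ Suc k * poly q' w" using coeff_0_imp_poly_eq by blast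
  have "(\<lambda>w. w ^ Suc k * poly q' w) \<in> O[at_left 0](\<lambda>w. w ^ Suc k * 1)"
    by (intro landau_o.big.mult poly_bigo_1) auto
  moreover have "(\<lambda>w. \<bar>w\<bar> powr s) \<in> O[at_left 0](\<lambda>w. w ^ Suc k * 1)"
  proof -
    have "(\<lambda>w::real. \<bar>w\<bar> powr real (Suc k)) \<in> O[at_left 0](\<lambda>w. w ^ Suc k * 1)"
      by (rule bigoI[of _ 1], use power_eq_powr_at_left_0[of "Suc k"] in eventually_elim)
         (simp add: power_abs abs_mult)
    with powr_bigo_powr_at_left_0[OF Suc.prems(1)] show ?thesis by (rule landau_o.big_trans)
  qed
  ultimately have "(\<lambda>w. (f w - poly q w) + poly q w) \<in> O[at_left 0](\<lambda>w. w ^ Suc k * 1)"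
    by (intro sum_in_bigo landau_o.big_trans[OF q]) (auto simp: q')
  then have "(\<lambda>w. w ^ Suc k * stieltjes M (Suc k) w) \<in> O[at_left 0](\<lambda>w. w ^ Suc k * 1)"
    by (simp add: f_def)
  then have "stieltjes M (Suc k) \<in> O[at_left 0](\<lambda>_. 1)"
    by (subst (asm) landau_o.big.mult_cancel_left)
       (auto intro: eventually_mono[OF eventually_at_left_0_small[of 1]])
  with mom have "integrable M (\<lambda>t. t ^ Suc k)"
    by (rule integrable_power_if_stieltjes_bounded)
  with mom Suc.prems show ?case by (cases "j = Suc k") auto
qed auto

context rv_tail
begin

text \<open>
  The coefficients of degree below \<open>p\<close> in the polynomial must match the moments, because \<open>w S\<^sub>p(w) \<rightarrow> 0\<close> for both
  measures and \<open>b\<close> is smaller than \<open>|w|\<^sup>p\<^sup>-\<^sup>1\<close>. Terms of degree above \<open>p\<close> are \<open>o(b)\<close> since \<open>p + 1 > \<alpha>\<close>. What is left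
  is the coefficient \<open>c\<close> of degree \<open>p\<close>, which for \<open>p = 0\<close> vanishes because both transforms tend to the total mass.
\<close>
lemma remainder_difference:
  assumes R: "nonneg_distribution R"
    and p: "real p \<le> \<alpha>" "\<alpha> < real p + 1"
    and q: "(\<lambda>w. stieltjes R 0 w - stieltjes M 0 w - poly q w) \<in> o[at_left 0](\<lambda>w. b (-1 / w))"
  obtains c where "\<And>j. j < p \<Longrightarrow> integrable R (\<lambda>t. t ^ j)" "p = 0 \<Longrightarrow> c = 0"
    "(\<lambda>w. w ^ p * (stieltjes R p w - stieltjes M p w - c)) \<in> o[at_left 0](\<lambda>w. b (-1 / w))"
proof -
  interpret R: nonneg_distribution R by fact
  have Mmom: "integrable M (\<lambda>t. t ^ j)" if "j < p" for j
    using that p by (intro integrable_power) auto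
  have b_small: "(\<lambda>w. b (-1 / w)) \<in> o[at_left 0](\<lambda>w. w ^ k)" if "p = Suc k" for k
    by (rule landau_o.big_small_trans[OF b_bigo_powr[of "real k + 1/2"] powr_smallo_power]) (use p that in auto)
  have Rmom: "integrable R (\<lambda>t. t ^ j)" if "j < p" for j
  proof -
    obtain k where k: "p = Suc k" using \<open>j < p\<close> by (cases p) auto
    define s where "s = real k + 1/2"
    have "(\<lambda>w. stieltjes R 0 w - stieltjes M 0 w - poly q w) \<in> O[at_left 0](\<lambda>w. \<bar>w\<bar> powr s)"
      by (rule landau_o.small_imp_big[OF landau_o.small_big_trans[OF q b_bigo_powr]])
         (use p k in \<open>auto simp: s_def\<close>)
    then have "poly_upto s (\<lambda>w. stieltjes R 0 w - stieltjes M 0 w - poly q w)" by (rule poly_upto_bigo)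
    moreover have "poly_upto s (\<lambda>w. stieltjes M 0 w + poly q w)"
      by (intro poly_upto_add poly_upto_poly poly_upto_stieltjes_0[of k]) (use p k in \<open>auto simp: s_def\<close>)
    ultimately have "poly_upto s (\<lambda>w. (stieltjes R 0 w - stieltjes M 0 w - poly q w) + (stieltjes M 0 w + poly q w))"
      by (rule poly_upto_add)
    then have "poly_upto s (stieltjes R 0)" by simp
    from R.integrable_power_if_poly_upto[OF this, of k j] show ?thesis
      using k \<open>j < p\<close> by (auto simp: s_def)
  qed
  define \<Delta> where "\<Delta> = (\<lambda>w. stieltjes R p w - stieltjes M p w)"
  define Q where "Q = q + (\<Sum>j<p. monom ((\<integral>t. t ^ j \<partial>M) - (\<integral>t. t ^ j \<partial>R)) j)"
  note q
  also have "(\<lambda>w. stieltjes R 0 w - stieltjes M 0 w - poly q w) \<in> o[at_left 0](\<lambda>w. b (-1 / w)) \<longleftrightarrow>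
      (\<lambda>w. w ^ p * \<Delta> w - poly Q w) \<in> o[at_left 0](\<lambda>w. b (-1 / w))"
  proof (rule landau_o.small.in_cong[OF eventually_mono[OF eventually_at_left_0_small[of 1]]])
    fix w :: real assume w: "- 1 < w \<and> w < 0"
    have 1: "stieltjes M 0 w = (\<Sum>j<p. (\<integral>t. t ^ (0 + j) \<partial>M) * w ^ j) + w ^ p * stieltjes M (0 + p) w"
      by (rule stieltjes_expansion) (use w Mmom in auto)
    have 2: "stieltjes R 0 w = (\<Sum>j<p. (\<integral>t. t ^ (0 + j) \<partial>R) * w ^ j) + w ^ p * stieltjes R (0 + p) w"
      by (rule R.stieltjes_expansion) (use w Rmom in auto)
    show "stieltjes R 0 w - stieltjes M 0 w - poly q w = w ^ p * \<Delta> w - poly Q w"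
      unfolding 1 2 Q_def \<Delta>_def
      by (simp add: poly_sum poly_monom left_diff_distrib right_diff_distrib sum_subtractf)
  qed auto
  finally have Q: "(\<lambda>w. w ^ p * \<Delta> w - poly Q w) \<in> o[at_left 0](\<lambda>w. b (-1 / w))" .
  have "coeff Q j = 0" if "j < p" for j
  proof -
    obtain k where k: "p = Suc k" using \<open>j < p\<close> by (cases p) auto
    have "((\<lambda>w. w * stieltjes R (Suc k) w - w * stieltjes M (Suc k) w) \<longlongrightarrow> 0 - 0) (at_left 0)"
      by (intro tendsto_diff id_times_stieltjes_tendsto_0 R.id_times_stieltjes_tendsto_0 Rmom Mmom) (use k in auto)
    then have "((\<lambda>w. w * \<Delta> w) \<longlongrightarrow> 0) (at_left 0)" by (simp add: \<Delta>_def k algebra_simps)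
    from power_smallo_of_smallo_Suc[OF this, of k]
    have "(\<lambda>w. w ^ p * \<Delta> w) \<in> o[at_left 0](\<lambda>w. w ^ k)" by (simp add: k)
    from sum_in_smallo(2)[OF this landau_o.small_trans[OF Q b_small[OF k]]]
    have "poly Q \<in> o[at_left 0](\<lambda>w. w ^ k)" by simp
    then show ?thesis using poly_smallo_coeff k \<open>j < p\<close> by auto
  qed
  then obtain Q' where Q': "\<And>w. poly Q w = w ^ p * poly Q' w" using coeff_0_imp_poly_eq by blast
  obtain c Q'' where c: "Q' = pCons c Q''" by (cases Q') auto
  have "(\<lambda>w. w ^ Suc p * poly Q'' w) \<in> O[at_left 0](\<lambda>w. w ^ Suc p * 1)"
    by (intro landau_o.big.mult poly_bigo_1) auto
  also have "(\<lambda>w::real. w ^ Suc p * 1) \<in> O[at_left 0](\<lambda>w. \<bar>w\<bar> powr real (Suc p))"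
    by (rule bigoI[of _ 1], use power_eq_powr_at_left_0[of "Suc p"] in eventually_elim)
       (simp add: power_abs abs_mult)
  also have "(\<lambda>w::real. \<bar>w\<bar> powr real (Suc p)) \<in> o[at_left 0](\<lambda>w. b (-1 / w))"
    by (rule powr_smallo_b) (use p in auto)
  finally have "(\<lambda>w. (w ^ p * \<Delta> w - poly Q w) + w ^ Suc p * poly Q'' w) \<in> o[at_left 0](\<lambda>w. b (-1 / w))"
    by (rule sum_in_smallo(1)[OF Q])
  then have \<Delta>: "(\<lambda>w. w ^ p * (\<Delta> w - c)) \<in> o[at_left 0](\<lambda>w. b (-1 / w))"
    by (simp add: Q' c algebra_simps)
  have "c = 0" if [simp]: "p = 0"
  proof -
    have "filterlim (\<lambda>w::real. -1 / w) at_top (at_left 0)"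
      by real_asymp
    from filterlim_compose[OF b_tendsto_0 this] have "(\<lambda>w. b (-1 / w)) \<in> o[at_left 0](\<lambda>_. 1)"
      by (intro smalloI_tendsto) auto
    from smalloD_tendsto[OF landau_o.small_trans[OF \<Delta> this]]
    have "((\<lambda>w. \<Delta> w - c) \<longlongrightarrow> 0) (at_left 0)" by simp
    moreover have "((\<lambda>w. \<Delta> w - c) \<longlongrightarrow> ((\<integral>t. t ^ p \<partial>R) - (\<integral>t. t ^ p \<partial>M)) - c) (at_left 0)"
      unfolding \<Delta>_def by (intro tendsto_intros stieltjes_tendsto_moment R.stieltjes_tendsto_moment) auto
    ultimately show "c = 0"
      using tendsto_unique[OF trivial_limit_at_left_real] by fastforce
  qed
  with Rmom \<Delta> show ?thesis unfolding \<Delta>_def by (intro that) auto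
qed

end

text \<open>
  The substitution \<open>y = 1 / (1 + u)\<close>, \<open>\<theta> = 1 - 1/l\<close> turns the Stieltjes kernel \<open>1 / (1 + l u)\<close> with a free scale
  \<open>l > 1\<close> into the resolvent \<open>1 / (1 - \<theta> y)\<close> on \<open>[0,1]\<close>.
\<close>
lemma resolvent_eq:
  fixes u l \<theta> :: real
  assumes "u \<ge> 0" "l > 1" "\<theta> = 1 - 1 / l"
  shows "1 - \<theta> * (1 / (1 + u)) = (1 + l * u) / (l * (1 + u))"
proof -
  have "1 - \<theta> * (1 / (1 + u)) = (1 + u - \<theta>) / (1 + u)"
    using assms(1) by (simp add: field_simps)
  also have "1 + u - \<theta> = (1 + l * u) / l"
    using assms(2) unfolding assms(3) by (simp add: field_simps)
  finally show ?thesis by simp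
qed

lemma (in nonneg_distribution) integral_kappa_resolvent_0:
  assumes x: "x > 0" and \<theta>: "0 < \<theta>" "\<theta> < 1" "l = 1 / (1 - \<theta>)"
  shows "(\<integral>t. kappa 0 (t / x) * (1 / (1 - \<theta> * (1 / (1 + t / x)))) \<partial>M) = 1 - stieltjes M 0 (- l / x)"
proof -
  have l: "l > 1" "\<theta> = 1 - 1 / l" using \<theta>(1,2) unfolding \<theta>(3) by (auto simp: field_simps)
  have "(\<integral>t. kappa 0 (t / x) * (1 / (1 - \<theta> * (1 / (1 + t / x)))) \<partial>M) = (\<integral>t. 1 - t ^ 0 / (1 - (- l / x) * t) \<partial>M)"
  proof (rule integral_cong_AE)
    show "AE t in M. kappa 0 (t / x) * (1 / (1 - \<theta> * (1 / (1 + t / x)))) = 1 - t ^ 0 / (1 - (- l / x) * t)"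
      using AE_nonneg
    proof eventually_elim
      case (elim t)
      define u where "u = t / x"
      have u: "u \<ge> 0" using elim x by (simp add: u_def)
      have pos: "1 + l * u > 0" "1 + u > 0" using u l by (auto intro!: add_pos_nonneg)
      have "kappa 0 u * (1 / (1 - \<theta> * (1 / (1 + u)))) = 1 - 1 / (1 + l * u)"
        unfolding resolvent_eq[OF u l] using pos l(1) by (simp add: kappa_def) (simp add: field_simps)
      then show ?case using x by (simp add: u_def)
    qed
  qed auto
  also have "\<dots> = 1 - stieltjes M 0 (- l / x)"
    unfolding stieltjes_def using integrable_stieltjes[of 0 "-l / x"] l x
    by (subst Bochner_Integration.integral_diff) auto
  finally show ?thesis .
qed

text \<open>
  Here a partial fraction decomposition yields an increment of \<open>S\<^sub>p\<close>, so that an additive constant in \<open>S\<^sub>p\<close> is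
  invisible. For \<open>p = 0\<close> the formula above involves the value of \<open>S\<^sub>0\<close> itself.
\<close>
lemma (in nonneg_distribution) integral_kappa_resolvent_Suc:
  assumes x: "x > 0" and \<theta>: "0 < \<theta>" "\<theta> < 1" "l = 1 / (1 - \<theta>)"
    and mom: "\<And>j. j < Suc k \<Longrightarrow> integrable M (\<lambda>t. t ^ j)"
  shows "(\<integral>t. kappa (Suc k) (t / x) * (1 / (1 - \<theta> * (1 / (1 + t / x)))) \<partial>M) =
    l / (l - 1) * (1 / x ^ Suc k) * (stieltjes M (Suc k) (- 1 / x) - stieltjes M (Suc k) (- l / x))"
proof -
  have l: "l > 1" "\<theta> = 1 - 1 / l" using \<theta>(1,2) unfolding \<theta>(3) by (auto simp: field_simps)
  have "(\<integral>t. kappa (Suc k) (t / x) * (1 / (1 - \<theta> * (1 / (1 + t / x)))) \<partial>M) =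
      (\<integral>t. l / (l - 1) * (1 / x ^ Suc k) * (t ^ Suc k / (1 - (- 1 / x) * t) - t ^ Suc k / (1 - (- l / x) * t)) \<partial>M)"
  proof (rule integral_cong_AE)
    show "AE t in M. kappa (Suc k) (t / x) * (1 / (1 - \<theta> * (1 / (1 + t / x)))) =
        l / (l - 1) * (1 / x ^ Suc k) * (t ^ Suc k / (1 - (- 1 / x) * t) - t ^ Suc k / (1 - (- l / x) * t))"
      using AE_nonneg
    proof eventually_elim
      case (elim t)
      define u where "u = t / x"
      have u: "u \<ge> 0" using elim x by (simp add: u_def)
      have pos: "1 + l * u > 0" "1 + u > 0" using u l by (auto intro!: add_pos_nonneg)
      have "1 - \<theta> * (1 / (1 + u)) = (1 + l * u) / (l * (1 + u))"
        using u l by (rule resolvent_eq)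
      then have "kappa (Suc k) u * (1 / (1 - \<theta> * (1 / (1 + u)))) = u ^ Suc k * (l * u / ((1 + u) * (1 + l * u)))"
        using pos by (simp add: kappa_def power_divide)
      also have "l * u / ((1 + u) * (1 + l * u)) = l / (l - 1) * (1 / (1 + u) - 1 / (1 + l * u))"
        using pos l by (simp add: divide_simps) (simp add: algebra_simps)
      finally show ?case using x by (simp add: u_def power_divide field_simps)
    qed
  qed (auto simp del: power_Suc)
  also have "\<dots> = l / (l - 1) * (1 / x ^ Suc k) * (stieltjes M (Suc k) (- 1 / x) - stieltjes M (Suc k) (- l / x))"
    unfolding stieltjes_def
    using integrable_stieltjes[of "Suc k" "-1 / x"] integrable_stieltjes[of "Suc k" "-l / x"] l x mom
    by (subst integral_mult_right_zero, subst Bochner_Integration.integral_diff) auto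
  finally show ?thesis .
qed

context rv_tail
begin

lemma resolvent_test:
  assumes R: "nonneg_distribution R"
    and p: "real p \<le> \<alpha>" "\<alpha> < real p + 1"
    and Rmom: "\<And>j. j < p \<Longrightarrow> integrable R (\<lambda>t. t ^ j)" and c0: "p = 0 \<Longrightarrow> c = 0"
    and c: "(\<lambda>w. w ^ p * (stieltjes R p w - stieltjes M p w - c)) \<in> o[at_left 0](\<lambda>w. b (-1 / w))"
    and \<theta>: "0 < \<theta>" "\<theta> < 1"
  shows "(\<lambda>x. (\<integral>t. kappa p (t / x) * (1 / (1 - \<theta> * (1 / (1 + t / x)))) \<partial>R)
            - (\<integral>t. kappa p (t / x) * (1 / (1 - \<theta> * (1 / (1 + t / x)))) \<partial>M)) \<in> o[at_top](b)"
proof -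
  interpret R: nonneg_distribution R by fact
  have Mmom: "integrable M (\<lambda>t. t ^ j)" if "j < p" for j
    using that p by (intro integrable_power) auto
  define \<Delta> where "\<Delta> = (\<lambda>w. stieltjes R p w - stieltjes M p w - c)"
  have \<Delta>: "(\<lambda>x. (1 / x) ^ p * \<Delta> (- l / x)) \<in> o[at_top](b)" if "l > 0" for l
  proof -
    have "filterlim (\<lambda>x::real. - l / x) (at_left 0) at_top"
      using \<open>l > 0\<close> by real_asymp
    from landau_o.small.compose[OF c this]
    have "(\<lambda>x. (- l / x) ^ p * \<Delta> (- l / x)) \<in> o[at_top](\<lambda>x. b (1 / l * x))"
      using \<open>l > 0\<close> by (simp add: \<Delta>_def)
    from landau_o.small_big_trans[OF this b_bigo] \<open>l > 0\<close>
    have "(\<lambda>x. (- l / x) ^ p * \<Delta> (- l / x)) \<in> o[at_top](b)" by simp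
    moreover have "(- l / x) ^ p = (- l) ^ p * (1 / x) ^ p" for x
      by (simp flip: power_mult_distrib)
    ultimately have "(\<lambda>x. (- l) ^ p * ((1 / x) ^ p * \<Delta> (- l / x))) \<in> o[at_top](b)"
      by (simp only: mult.assoc)
    then show ?thesis using \<open>l > 0\<close> by (subst (asm) landau_o.small.cmult_in_iff) auto
  qed
  define l where "l = 1 / (1 - \<theta>)"
  have l: "l > 1" using \<theta> by (simp add: l_def field_simps)
  show ?thesis
  proof (cases p)
    case 0
    have "(\<lambda>x. - ((1 / x) ^ p * \<Delta> (- l / x))) \<in> o[at_top](b)"
      using \<Delta>[of l] l by simp
    also have "?this \<longleftrightarrow> ?thesis"
    proof (rule landau_o.small.in_cong, rule eventually_mono[OF eventually_gt_at_top[of 0]])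
      fix x :: real assume x: "x > 0"
      show "- ((1 / x) ^ p * \<Delta> (- l / x)) =
        (\<integral>t. kappa p (t / x) * (1 / (1 - \<theta> * (1 / (1 + t / x)))) \<partial>R)
            - (\<integral>t. kappa p (t / x) * (1 / (1 - \<theta> * (1 / (1 + t / x)))) \<partial>M)"
        unfolding 0 integral_kappa_resolvent_0[OF x \<theta> l_def] R.integral_kappa_resolvent_0[OF x \<theta> l_def]
        by (simp add: \<Delta>_def c0 0)
    qed
    finally show ?thesis .
  next
    case (Suc k)
    have "(\<lambda>x. l / (l - 1) * ((1 / x) ^ p * \<Delta> (- 1 / x) - (1 / x) ^ p * \<Delta> (- l / x))) \<in> o[at_top](b)"
      using sum_in_smallo(2)[OF \<Delta>[of 1] \<Delta>[of l]] l by (subst landau_o.small.cmult_in_iff) auto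
    also have "?this \<longleftrightarrow> ?thesis"
    proof (rule landau_o.small.in_cong, rule eventually_mono[OF eventually_gt_at_top[of 0]])
      fix x :: real assume x: "x > 0"
      show "l / (l - 1) * ((1 / x) ^ p * \<Delta> (- 1 / x) - (1 / x) ^ p * \<Delta> (- l / x)) =
        (\<integral>t. kappa p (t / x) * (1 / (1 - \<theta> * (1 / (1 + t / x)))) \<partial>R)
            - (\<integral>t. kappa p (t / x) * (1 / (1 - \<theta> * (1 / (1 + t / x)))) \<partial>M)"
        unfolding Suc
        by (subst integral_kappa_resolvent_Suc[OF x \<theta> l_def], use Mmom Suc in simp,
            subst R.integral_kappa_resolvent_Suc[OF x \<theta> l_def], use Rmom Suc in simp)
           (simp add: \<Delta>_def Suc power_divide algebra_simps del: power_Suc)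
    qed
    finally show ?thesis .
  qed
qed

end

section \<open>From resolvents to tails\<close>

text \<open>
  Think of \<open>\<Lambda> f x\<close> as the difference at scale \<open>x\<close> of the integrals of \<open>f\<close> against two measures on \<open>[0,1]\<close> of mass \<open>O(b x)\<close>.
  The functions with \<open>\<Lambda> f = o(b)\<close> form a subspace that is closed under uniform limits. It contains each
  power \<open>y\<^sup>k\<close>: in \<open>1 / (1 - \<theta> y) = \<Sum>\<^sub>j \<theta>\<^sup>j y\<^sup>j\<close> subtract the terms below \<open>k\<close>, divide by \<open>\<theta>\<^sup>k\<close> and let
  \<open>\<theta> \<rightarrow> 0\<close>. The Weierstrass theorem gives the rest.
\<close>
lemma resolvents_total:
  fixes \<Lambda> :: "(real \<Rightarrow> real) \<Rightarrow> real \<Rightarrow> real" and b :: "real \<Rightarrow> real"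
  assumes lin: "eventually (\<lambda>x. \<forall>f g c. continuous_on {0..1} f \<longrightarrow> continuous_on {0..1} g \<longrightarrow>
      \<Lambda> (\<lambda>y. f y + c * g y) x = \<Lambda> f x + c * \<Lambda> g x) F"
    and bound: "eventually (\<lambda>x. \<forall>f B. continuous_on {0..1} f \<longrightarrow> (\<forall>y\<in>{0..1}. \<bar>f y\<bar> \<le> B) \<longrightarrow>
      \<bar>\<Lambda> f x\<bar> \<le> C * B * \<bar>b x\<bar>) F"
    and C: "C > 0"
    and test: "\<And>\<theta>. 0 < \<theta> \<Longrightarrow> \<theta> < 1 \<Longrightarrow> \<Lambda> (\<lambda>y. 1 / (1 - \<theta> * y)) \<in> o[F](b)"
    and f: "continuous_on {0..1} f"
  shows "\<Lambda> f \<in> o[F](b)"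
proof -
  define V where "V f \<longleftrightarrow> continuous_on {0..1} f \<and> \<Lambda> f \<in> o[F](b)" for f
  have V_add_cmult: "V (\<lambda>y. f y + c * g y)" if "V f" "V g" for f g c
  proof -
    from that have fg: "continuous_on {0..1} f" "continuous_on {0..1} g"
      "\<Lambda> f \<in> o[F](b)" "\<Lambda> g \<in> o[F](b)" by (auto simp: V_def)
    have "(\<lambda>x. \<Lambda> f x + c * \<Lambda> g x) \<in> o[F](b)"
      by (intro sum_in_smallo fg) (use fg(4) in \<open>cases "c = 0"; simp\<close>)
    also have "?this \<longleftrightarrow> \<Lambda> (\<lambda>y. f y + c * g y) \<in> o[F](b)"
      by (rule landau_o.small.in_cong) (use lin in eventually_elim, use fg in auto)
    finally show ?thesis using fg by (auto simp: V_def intro!: continuous_intros)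
  qed
  have V_closed: "V f" if f: "continuous_on {0..1} f"
    and approx: "\<And>e. e > 0 \<Longrightarrow> \<exists>g. V g \<and> (\<forall>y\<in>{0..1}. \<bar>f y - g y\<bar> \<le> e)" for f
    unfolding V_def
  proof (intro conjI f landau_o.smallI)
    fix c :: real assume "c > 0"
    then obtain g where g: "V g" "\<forall>y\<in>{0..1}. \<bar>f y - g y\<bar> \<le> c / (2 * C)"
      using approx[of "c / (2 * C)"] C by auto
    have gc: "continuous_on {0..1} g" "\<Lambda> g \<in> o[F](b)" using g by (auto simp: V_def)
    have dc: "continuous_on {0..1} (\<lambda>y. f y - g y)" by (intro continuous_intros f gc)
    have "eventually (\<lambda>x. norm (\<Lambda> g x) \<le> c / 2 * norm (b x)) F"
      using landau_o.smallD[OF gc(2), of "c / 2"] \<open>c > 0\<close> by simp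
    with lin bound show "eventually (\<lambda>x. norm (\<Lambda> f x) \<le> c * norm (b x)) F"
    proof eventually_elim
      case (elim x)
      have "\<Lambda> f x = \<Lambda> (\<lambda>y. g y + 1 * (f y - g y)) x" by simp
      also have "\<dots> = \<Lambda> g x + 1 * \<Lambda> (\<lambda>y. f y - g y) x" using elim(1) gc(1) dc by blast
      finally have "\<bar>\<Lambda> f x\<bar> \<le> \<bar>\<Lambda> g x\<bar> + \<bar>\<Lambda> (\<lambda>y. f y - g y) x\<bar>" by simp
      also have "\<bar>\<Lambda> (\<lambda>y. f y - g y) x\<bar> \<le> C * (c / (2 * C)) * \<bar>b x\<bar>"
        using elim(2) dc g(2) by blast
      also have "C * (c / (2 * C)) * \<bar>b x\<bar> = c / 2 * \<bar>b x\<bar>" using C by simp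
      finally show ?case using elim(3) by simp
    qed
  qed
  have V_resolvent: "V (\<lambda>y. 1 / (1 - \<theta> * y))" if "0 < \<theta>" "\<theta> < 1" for \<theta>
  proof -
    have "1 - \<theta> * y \<noteq> 0" if "y \<in> {0..1}" for y
    proof -
      have "\<theta> * y \<le> \<theta> * 1" using that \<open>0 < \<theta>\<close> by (intro mult_left_mono) auto
      then show ?thesis using \<open>\<theta> < 1\<close> by linarith
    qed
    then show ?thesis using test[OF that] by (auto simp: V_def intro!: continuous_intros)
  qed
  have V_zero: "V (\<lambda>y. 0)"
    using V_add_cmult[OF V_resolvent[of "1/2"] V_resolvent[of "1/2"], of "-1"] by simp
  have V_sum: "V (\<lambda>y. g y + (\<Sum>i\<in>A. c i * h i y))" if "finite A" "V g" "\<And>i. i \<in> A \<Longrightarrow> V (h i)"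
    for A :: "nat set" and c h g
    using that
  proof (induction A)
    case (insert i A)
    have "V (\<lambda>y. (g y + (\<Sum>i\<in>A. c i * h i y)) + c i * h i y)"
      by (rule V_add_cmult) (use insert in auto)
    then show ?case using insert by (simp add: algebra_simps)
  qed auto
  have V_power: "V (\<lambda>y. y ^ k)" for k
  proof (induction k rule: less_induct)
    case (less k)
    show ?case
    proof (rule V_closed)
      fix e :: real assume e: "e > 0"
      \<comment> \<open>the distance from \<open>y ^ k\<close> is at most \<open>\<theta> / (1 - \<theta>)\<close>, which this choice makes \<open>e\<close>\<close>
      define \<theta> where "\<theta> = e / (1 + e)"
      have \<theta>: "0 < \<theta>" "\<theta> < 1" "\<theta> / (1 - \<theta>) = e" using e by (auto simp: \<theta>_def field_simps)
      define g where "g = (\<lambda>y. 1 / (1 - \<theta> * y) + (\<Sum>j<k. - (\<theta> ^ j) * y ^ j))"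
      have "V g" unfolding g_def by (intro V_sum V_resolvent less.IH \<theta>) auto
      then have "V (\<lambda>y. 0 + (1 / \<theta> ^ k) * g y)" by (intro V_add_cmult V_zero)
      moreover have "\<bar>y ^ k - (0 + (1 / \<theta> ^ k) * g y)\<bar> \<le> e" if y: "y \<in> {0..1}" for y
      proof -
        have \<theta>y: "\<theta> * y \<le> \<theta>" using y \<theta> by (auto intro!: mult_left_le)
        then have nz: "1 - \<theta> * y > 0" using \<theta> by linarith
        then have "\<theta> * y \<noteq> 1" by linarith
        have "(\<Sum>j<k. - (\<theta> ^ j) * y ^ j) = - (\<Sum>j<k. (\<theta> * y) ^ j)"
          by (simp add: sum_negf power_mult_distrib)
        also have "(\<Sum>j<k. (\<theta> * y) ^ j) = ((\<theta> * y) ^ k - 1) / (\<theta> * y - 1)"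
          by (rule geometric_sum) fact
        finally have "g y = (\<theta> * y) ^ k / (1 - \<theta> * y)"
          unfolding g_def using nz \<open>\<theta> * y \<noteq> 1\<close> by (simp add: divide_simps) (simp add: algebra_simps)
        then have "y ^ k - (0 + (1 / \<theta> ^ k) * g y) = - (y ^ k * (\<theta> * y) / (1 - \<theta> * y))"
          using nz \<open>\<theta> * y \<noteq> 1\<close> \<theta>(1) by (simp add: power_mult_distrib divide_simps) (simp add: algebra_simps)
        also have "\<bar>\<dots>\<bar> = y ^ k * (\<theta> * y) / (1 - \<theta> * y)"
          using nz \<theta>(1) y by simp
        also have "\<dots> \<le> 1 * \<theta> / (1 - \<theta>)"
          using \<theta>y \<theta> y by (intro frac_le mult_mono power_le_one) auto
        finally show ?thesis using \<theta> by simp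
      qed
      ultimately show "\<exists>g. V g \<and> (\<forall>y\<in>{0..1}. \<bar>y ^ k - g y\<bar> \<le> e)" by blast
    qed (intro continuous_intros)
  qed
  have "V f"
  proof (rule V_closed[OF f])
    fix e :: real assume "e > 0"
    then obtain g where g: "real_polynomial_function g" "\<And>y. y \<in> {0..1} \<Longrightarrow> \<bar>f y - g y\<bar> < e"
      using Stone_Weierstrass_real_polynomial_function[OF compact_Icc f] by blast
    from g(1) obtain a n where "g = (\<lambda>y. \<Sum>i\<le>n. a i * y ^ i)"
      unfolding real_polynomial_function_iff_sum by auto
    moreover have "V (\<lambda>y. 0 + (\<Sum>i\<le>n. a i * y ^ i))" by (intro V_sum V_zero V_power) auto
    ultimately show "\<exists>g. V g \<and> (\<forall>y\<in>{0..1}. \<bar>f y - g y\<bar> \<le> e)"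
      using g(2) by (intro exI[of _ g]) (auto intro: less_imp_le)
  qed
  then show ?thesis by (simp add: V_def)
qed

lemma clamp_recip: "u \<ge> 0 \<Longrightarrow> max 0 (min 1 (1 / (1 + u))) = 1 / (1 + u)" for u :: real
  by (subst min_absorb2) (auto simp: max_absorb2)

text \<open>
  The integral of \<open>f(y)\<close>, \<open>y = 1 / (1 + t/x)\<close>, with weight \<open>kappa\<close>. The clamp leaves \<open>y\<close> unchanged for \<open>t \<ge> 0\<close>; it makes
  the integrand measurable on the whole line for \<open>f\<close> continuous on \<open>[0,1]\<close>.
\<close>
definition kappa_integral :: "real measure \<Rightarrow> nat \<Rightarrow> (real \<Rightarrow> real) \<Rightarrow> real \<Rightarrow> real" where
  "kappa_integral M p f x = (\<integral>t. kappa p (t / x) * f (max 0 (min 1 (1 / (1 + t / x)))) \<partial>M)"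

context nonneg_distribution
begin

lemma
  assumes mom: "integrable M (\<lambda>t. t ^ (p - 1))" and x: "x > 0" and f: "continuous_on {0..1} f"
  shows integrable_kappa_mult: "integrable M (\<lambda>t. kappa p (t / x) * f (max 0 (min 1 (1 / (1 + t / x)))))"
    and abs_kappa_integral_le: "(\<And>y. y \<in> {0..1} \<Longrightarrow> \<bar>f y\<bar> \<le> B) \<Longrightarrow> \<bar>kappa_integral M p f x\<bar> \<le> B * (\<integral>t. kappa p (t / x) \<partial>M)"
proof -
  have "continuous_on UNIV (\<lambda>y. f (max 0 (min 1 y)))"
    by (rule continuous_on_compose2[OF f]) (auto intro!: continuous_intros)
  then have [measurable]: "(\<lambda>y. f (max 0 (min 1 y))) \<in> borel_measurable borel"
    by (rule borel_measurable_continuous_onI)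
  note ik = integrable_kappa[OF mom x]
  have *: "AE t in M. norm (kappa p (t / x) * f (max 0 (min 1 (1 / (1 + t / x))))) \<le> B * kappa p (t / x)"
    if "\<And>y. y \<in> {0..1} \<Longrightarrow> \<bar>f y\<bar> \<le> B" for B
    using AE_nonneg
  proof eventually_elim
    case (elim t)
    have "kappa p (t / x) \<ge> 0" using elim x by (intro kappa_nonneg) auto
    moreover have "\<bar>f (max 0 (min 1 (1 / (1 + t / x))))\<bar> \<le> B" by (rule that) auto
    ultimately show ?case by (simp add: abs_mult mult.commute[of B] mult_left_mono)
  qed
  have "bounded (f ` {0..1})" by (intro compact_imp_bounded compact_continuous_image f) auto
  then obtain B where "\<forall>y\<in>{0..1}. \<bar>f y\<bar> \<le> B"
    unfolding bounded_iff by auto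
  then have B: "\<And>y. y \<in> {0..1} \<Longrightarrow> \<bar>f y\<bar> \<le> B" by blast
  show i: "integrable M (\<lambda>t. kappa p (t / x) * f (max 0 (min 1 (1 / (1 + t / x)))))"
  proof (rule Bochner_Integration.integrable_bound)
    show "integrable M (\<lambda>t. B * kappa p (t / x))" using ik by simp
    show "(\<lambda>t. kappa p (t / x) * f (max 0 (min 1 (1 / (1 + t / x))))) \<in> borel_measurable M"
      by measurable
    show "AE t in M. norm (kappa p (t / x) * f (max 0 (min 1 (1 / (1 + t / x))))) \<le> norm (B * kappa p (t / x))"
    proof -
      have "AE t in M. norm (kappa p (t / x) * f (max 0 (min 1 (1 / (1 + t / x))))) \<le> B * kappa p (t / x)"
        by (rule *) (rule B)
      then show ?thesis by eventually_elim simp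
    qed
  qed
  show "\<bar>kappa_integral M p f x\<bar> \<le> B * (\<integral>t. kappa p (t / x) \<partial>M)" if "\<And>y. y \<in> {0..1} \<Longrightarrow> \<bar>f y\<bar> \<le> B" for B
  proof -
    have "\<bar>kappa_integral M p f x\<bar> \<le> (\<integral>t. B * kappa p (t / x) \<partial>M)"
      unfolding kappa_integral_def
      by (rule order_trans[OF integral_abs_bound integral_mono_AE])
         (use i ik *[OF that] in \<open>auto simp del: abs_mult\<close>)
    then show ?thesis by simp
  qed
qed

lemma kappa_integral_add_cmult:
  assumes "integrable M (\<lambda>t. t ^ (p - 1))" "x > 0" "continuous_on {0..1} f" "continuous_on {0..1} g"
  shows "kappa_integral M p (\<lambda>y. f y + c * g y) x = kappa_integral M p f x + c * kappa_integral M p g x"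
  unfolding kappa_integral_def using integrable_kappa_mult[OF assms(1,2,3)] integrable_kappa_mult[OF assms(1,2,4)]
  by (simp add: distrib_left mult.left_commute)

lemma kappa_integral_resolvent:
  assumes "x > 0" shows "kappa_integral M p (\<lambda>y. 1 / (1 - \<theta> * y)) x = (\<integral>t. kappa p (t / x) * (1 / (1 - \<theta> * (1 / (1 + t / x)))) \<partial>M)"
  unfolding kappa_integral_def
proof (rule integral_cong_AE)
  show "AE t in M. kappa p (t / x) * (1 / (1 - \<theta> * max 0 (min 1 (1 / (1 + t / x))))) =
      kappa p (t / x) * (1 / (1 - \<theta> * (1 / (1 + t / x))))"
    using AE_nonneg
  proof eventually_elim
    case (elim t)
    then have "max 0 (min 1 (1 / (1 + t / x))) = 1 / (1 + t / x)"
      using assms by (intro clamp_recip) auto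
    then show ?case by (simp only:)
  qed
qed auto

end

context rv_tail
begin

text \<open>
  The mass of \<open>kappa\<close> under \<open>R\<close> has to be bounded first. It is not itself among the tested integrals, but the
  resolvent with \<open>\<theta> = 1/2\<close> takes values between \<open>1\<close> and \<open>2\<close>.
\<close>
lemma kappa_integral_difference_smallo:
  assumes R: "nonneg_distribution R"
    and p: "real p \<le> \<alpha>" "\<alpha> < real p + 1"
    and Rmom: "integrable R (\<lambda>t. t ^ (p - 1))"
    and test: "\<And>\<theta>. 0 < \<theta> \<Longrightarrow> \<theta> < 1 \<Longrightarrow>
      (\<lambda>x. kappa_integral R p (\<lambda>y. 1 / (1 - \<theta> * y)) x - kappa_integral M p (\<lambda>y. 1 / (1 - \<theta> * y)) x) \<in> o[at_top](b)"
    and f: "continuous_on {0..1} f"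
  shows "(\<lambda>x. kappa_integral R p f x - kappa_integral M p f x) \<in> o[at_top](b)"
proof -
  interpret R: nonneg_distribution R by fact
  have Mmom: "integrable M (\<lambda>t. t ^ (p - 1))"
    using p by (intro integrable_power) (cases p; auto)
  obtain C x0 where C: "C > 0" "x0 > 0" "\<And>x. x \<ge> x0 \<Longrightarrow> (\<integral>t. kappa p (t / x) \<partial>M) \<le> C * b x"
    using integral_kappa_le[OF p] by blast
  have half: "continuous_on {0..1} (\<lambda>y::real. 1 / (1 - 1/2 * y))"
    by (intro continuous_intros) auto
  have "eventually (\<lambda>x. norm (kappa_integral R p (\<lambda>y. 1 / (1 - 1/2 * y)) x - kappa_integral M p (\<lambda>y. 1 / (1 - 1/2 * y)) x) \<le> 1 * norm (b x)) at_top"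
    by (rule landau_o.smallD[OF test]) auto
  with eventually_ge_at_top[of x0]
  have Rmass: "eventually (\<lambda>x. (\<integral>t. kappa p (t / x) \<partial>R) \<le> (2 * C + 1) * b x) at_top"
  proof eventually_elim
    case (elim x)
    have x: "x > 0" using elim C by simp
    have "(\<integral>t. kappa p (t / x) \<partial>R) \<le> kappa_integral R p (\<lambda>y. 1 / (1 - 1/2 * y)) x"
      unfolding kappa_integral_def
    proof (rule integral_mono_AE[OF R.integrable_kappa[OF Rmom x] R.integrable_kappa_mult[OF Rmom x half]])
      show "AE t in R. kappa p (t / x) \<le> kappa p (t / x) * (1 / (1 - 1/2 * max 0 (min 1 (1 / (1 + t / x)))))"
        using R.AE_nonneg
      proof eventually_elim
        case (elim t)
        have "1 \<le> 1 / (1 - 1/2 * max 0 (min 1 y))" for y :: real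
          by (auto simp: max_def min_def)
        from mult_left_mono[OF this[of "1 / (1 + t / x)"] kappa_nonneg[of "t / x" p]] elim x show ?case by simp
      qed
    qed
    also have "\<dots> \<le> kappa_integral M p (\<lambda>y. 1 / (1 - 1/2 * y)) x + b x" using elim by simp
    also have "kappa_integral M p (\<lambda>y. 1 / (1 - 1/2 * y)) x \<le> 2 * (\<integral>t. kappa p (t / x) \<partial>M)"
      by (rule order_trans[OF abs_ge_self abs_kappa_integral_le[OF Mmom x half]])
         (auto simp: abs_divide divide_le_eq)
    also have "\<dots> \<le> 2 * (C * b x)" using elim C by simp
    finally show ?case by (simp add: algebra_simps)
  qed
  show ?thesis
  proof (rule resolvents_total[where \<Lambda> = "\<lambda>f x. kappa_integral R p f x - kappa_integral M p f x" and C = "3 * C + 1", OF _ _ _ test f])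
    show "eventually (\<lambda>x. \<forall>f g c. continuous_on {0..1} f \<longrightarrow> continuous_on {0..1} g \<longrightarrow>
      kappa_integral R p (\<lambda>y. f y + c * g y) x - kappa_integral M p (\<lambda>y. f y + c * g y) x =
      kappa_integral R p f x - kappa_integral M p f x + c * (kappa_integral R p g x - kappa_integral M p g x)) at_top"
      using eventually_gt_at_top[of 0]
      by eventually_elim (auto simp: kappa_integral_add_cmult[OF Mmom] R.kappa_integral_add_cmult[OF Rmom] algebra_simps)
    show "eventually (\<lambda>x. \<forall>f B. continuous_on {0..1} f \<longrightarrow> (\<forall>y\<in>{0..1}. \<bar>f y\<bar> \<le> B) \<longrightarrow>
       \<bar>kappa_integral R p f x - kappa_integral M p f x\<bar> \<le> (3 * C + 1) * B * \<bar>b x\<bar>) at_top"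
      using Rmass eventually_ge_at_top[of x0]
    proof eventually_elim
      case (elim x)
      have x: "x > 0" using elim C by simp
      show ?case
      proof (intro allI impI)
        fix f :: "real \<Rightarrow> real" and B assume f: "continuous_on {0..1} f" and B: "\<forall>y\<in>{0..1}. \<bar>f y\<bar> \<le> B"
        have B0: "B \<ge> 0" using B[rule_format, of 0] by simp
        have "\<bar>kappa_integral R p f x\<bar> \<le> B * ((2 * C + 1) * b x)"
          using R.abs_kappa_integral_le[OF Rmom x f, of B] B mult_left_mono[OF elim(1) B0] by auto
        moreover have "\<bar>kappa_integral M p f x\<bar> \<le> B * (C * b x)"
          using abs_kappa_integral_le[OF Mmom x f, of B] B mult_left_mono[OF C(3)[OF elim(2)] B0] by auto
        ultimately have "\<bar>kappa_integral R p f x - kappa_integral M p f x\<bar> \<le> B * ((2 * C + 1) * b x) + B * (C * b x)" by linarith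
        then show "\<bar>kappa_integral R p f x - kappa_integral M p f x\<bar> \<le> (3 * C + 1) * B * \<bar>b x\<bar>"
          by (simp add: algebra_simps)
      qed
    qed
  qed (use C in auto)
qed

end

text \<open>
  In the variable \<open>u\<close> with \<open>y = 1 / (1 + u)\<close> this rises from \<open>0\<close> at \<open>u = 1\<close> to \<open>1\<close> at \<open>u = 1 + \<delta>\<close>.
\<close>
definition ramp :: "real \<Rightarrow> real \<Rightarrow> real" where
  "ramp \<delta> y = min 1 (max 0 ((1/2 - y) / (1/2 - 1 / (2 + \<delta>))))"

text \<open>
  The ramp divided by \<open>kappa\<close>, in the variable \<open>y\<close>: \<open>kappa p u = (1 - y)\<^sup>p\<^sup>+\<^sup>1 / y\<^sup>p\<^sup>-\<^sup>1\<close>. The maximum with \<open>1/2\<close> takes effect only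
  where the ramp vanishes and keeps the quotient continuous at \<open>y = 1\<close>. Continuity at \<open>y = 0\<close>, that is at
  \<open>u = \<infinity>\<close>, is where the growth of \<open>kappa\<close> at infinity is used.
\<close>
definition ramp_quot :: "nat \<Rightarrow> real \<Rightarrow> real \<Rightarrow> real" where
  "ramp_quot p \<delta> y = ramp \<delta> y * y ^ (p - 1) / max (1 - y) (1/2) ^ (p + 1)"

lemma continuous_on_ramp_quot: "\<delta> > 0 \<Longrightarrow> continuous_on A (ramp_quot p \<delta>)"
  unfolding ramp_quot_def ramp_def by (intro continuous_intros) (auto simp: max_def)

lemma kappa_ramp_quot:
  assumes "u \<ge> 0" "\<delta> > 0"
  shows "kappa p u * ramp_quot p \<delta> (1 / (1 + u)) = ramp \<delta> (1 / (1 + u))"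
proof (cases "u \<le> 1")
  case True
  have d: "1/2 - 1 / (2 + \<delta>) > 0" using assms by (simp add: field_simps)
  have "1/2 - 1 / (1 + u) \<le> 0" using True assms by (simp add: field_simps)
  then have "ramp \<delta> (1 / (1 + u)) = 0"
    using d unfolding ramp_def by (simp add: divide_nonpos_pos max_absorb1)
  then show ?thesis by (simp add: ramp_quot_def)
next
  case False
  have 1: "1 - 1 / (1 + u) = u / (1 + u)" using assms by (simp add: field_simps)
  have 2: "1/2 \<le> u / (1 + u)" using False by (simp add: field_simps)
  have "kappa p u * ramp_quot p \<delta> (1 / (1 + u)) =
      ramp \<delta> (1 / (1 + u)) * ((u / (1 + u)) ^ (p + 1) / (u / (1 + u)) ^ (p + 1)) * ((1 + u) ^ (p - 1) * (1 / (1 + u)) ^ (p - 1))"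
    unfolding ramp_quot_def kappa_def 1 max_absorb1[OF 2] by simp
  also have "(1 + u) ^ (p - 1) * (1 / (1 + u)) ^ (p - 1) = 1"
    using assms by (simp flip: power_mult_distrib)
  also have "(u / (1 + u)) ^ (p + 1) / (u / (1 + u)) ^ (p + 1) = 1"
    using False by simp
  finally show ?thesis by simp
qed

lemma ramp_bounds:
  assumes "u \<ge> 0" "\<delta> > 0"
  shows "indicator {1 + \<delta><..} u \<le> ramp \<delta> (1 / (1 + u))" "ramp \<delta> (1 / (1 + u)) \<le> indicator {1<..} u"
proof -
  have d: "1/2 - 1 / (2 + \<delta>) > 0" using assms by (simp add: field_simps)
  show "ramp \<delta> (1 / (1 + u)) \<le> indicator {1<..} u"
  proof (cases "u \<le> 1")
    case True
    have "1/2 - 1 / (1 + u) \<le> 0" using True assms by (simp add: field_simps)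
    then have "ramp \<delta> (1 / (1 + u)) = 0"
      using d unfolding ramp_def by (simp add: divide_nonpos_pos max_absorb1)
    then show ?thesis by simp
  qed (simp add: ramp_def)
  show "indicator {1 + \<delta><..} u \<le> ramp \<delta> (1 / (1 + u))"
  proof (cases "u > 1 + \<delta>")
    case True
    then have "1 / (1 + u) \<le> 1 / (2 + \<delta>)" using assms by (intro divide_left_mono) auto
    then have "1 \<le> (1/2 - 1 / (1 + u)) / (1/2 - 1 / (2 + \<delta>))" using d by (subst le_divide_eq) auto
    then show ?thesis by (simp add: ramp_def)
  qed (simp add: ramp_def)
qed

lemma (in nonneg_distribution) kappa_integral_ramp_quot_bounds:
  assumes mom: "integrable M (\<lambda>t. t ^ (p - 1))" and x: "x > 0" and \<delta>: "\<delta> > 0"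
  shows "measure M {(1 + \<delta>) * x<..} \<le> kappa_integral M p (ramp_quot p \<delta>) x"
    "kappa_integral M p (ramp_quot p \<delta>) x \<le> measure M {x<..}"
proof -
  note i = integrable_kappa_mult[OF mom x continuous_on_ramp_quot[OF \<delta>]]
  have AE: "AE t in M. indicator {(1 + \<delta>) * x<..} t \<le> kappa p (t / x) * ramp_quot p \<delta> (max 0 (min 1 (1 / (1 + t / x)))) \<and>
      kappa p (t / x) * ramp_quot p \<delta> (max 0 (min 1 (1 / (1 + t / x)))) \<le> indicator {x<..} t"
    using AE_nonneg
  proof eventually_elim
    case (elim t)
    then have u: "t / x \<ge> 0" using x by simp
    have "max 0 (min 1 (1 / (1 + t / x))) = 1 / (1 + t / x)"
      using u by (rule clamp_recip)
    moreover have "indicator {(1 + \<delta>) * x<..} t = (indicator {1 + \<delta><..} (t / x) :: real)"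
      "indicator {x<..} t = (indicator {1<..} (t / x) :: real)"
      using x by (auto simp: indicator_def less_divide_eq)
    ultimately show ?case
      using ramp_bounds[OF u \<delta>] kappa_ramp_quot[OF u \<delta>, of p] by (simp only: simp_thms)
  qed
  have "(\<integral>t. indicator {(1 + \<delta>) * x<..} t \<partial>M) \<le> kappa_integral M p (ramp_quot p \<delta>) x"
    unfolding kappa_integral_def by (rule integral_mono_AE[OF _ i]) (use AE in \<open>auto simp: emeasure_eq_measure\<close>)
  then show "measure M {(1 + \<delta>) * x<..} \<le> kappa_integral M p (ramp_quot p \<delta>) x" by simp
  have "kappa_integral M p (ramp_quot p \<delta>) x \<le> (\<integral>t. indicator {x<..} t \<partial>M)"
    unfolding kappa_integral_def by (rule integral_mono_AE[OF i]) (use AE in \<open>auto simp: emeasure_eq_measure\<close>)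
  then show "kappa_integral M p (ramp_quot p \<delta>) x \<le> measure M {x<..}" by simp
qed

text \<open>
  Up to \<open>\<delta> b x\<close>, the ramp integral of \<open>R\<close> equals that of \<open>M\<close>, and both are trapped between the tails at \<open>(1 + \<delta>) x\<close> and
  at \<open>x\<close>. Regular variation of \<open>b\<close> makes the resulting bounds for the ratio converge to \<open>1\<close> as \<open>\<delta> \<rightarrow> 0\<close>.
\<close>
lemma (in rv_tail) tail_ratio_tendsto_1:
  assumes R: "nonneg_distribution R"
    and p: "real p \<le> \<alpha>" "\<alpha> < real p + 1"
    and Rmom: "integrable R (\<lambda>t. t ^ (p - 1))"
    and diff: "\<And>f. continuous_on {0..1} f \<Longrightarrow> (\<lambda>x. kappa_integral R p f x - kappa_integral M p f x) \<in> o[at_top](b)"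
  shows "((\<lambda>x. measure R {x<..} / b x) \<longlongrightarrow> 1) at_top"
proof -
  interpret R: nonneg_distribution R by fact
  have Mmom: "integrable M (\<lambda>t. t ^ (p - 1))"
    using p by (intro integrable_power) (cases p; auto)
  have comp: "eventually (\<lambda>x. x > 0 \<and> \<bar>kappa_integral R p (ramp_quot p \<delta>) x - kappa_integral M p (ramp_quot p \<delta>) x\<bar> \<le> \<delta> * b x) at_top"
    if "\<delta> > 0" for \<delta>
    using landau_o.smallD[OF diff[OF continuous_on_ramp_quot[OF that]] that] eventually_gt_at_top[of 0]
    by eventually_elim auto
  show ?thesis
  proof (rule order_tendstoI)
    fix a :: real assume a: "a > 1"
    have "((\<lambda>\<delta>. (1 + \<delta>) * ((1 + \<delta>) powr \<alpha> + \<delta>)) \<longlongrightarrow> (1 + 0) * ((1 + 0) powr \<alpha> + 0)) (at_right 0)"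
      by (intro tendsto_intros) auto
    then have "eventually (\<lambda>\<delta>. (1 + \<delta>) * ((1 + \<delta>) powr \<alpha> + \<delta>) < a) (at_right 0)"
      using a by (intro order_tendstoD(2)) auto
    then obtain \<delta> where \<delta>: "\<delta> > 0" "(1 + \<delta>) * ((1 + \<delta>) powr \<alpha> + \<delta>) < a"
      using eventually_happens'[OF trivial_limit_at_right_real eventually_conj[OF _ eventually_at_right_less]] by blast
    have "filterlim (\<lambda>x. 1 / (1 + \<delta>) * x) at_top at_top"
      using \<delta> by (intro filterlim_tendsto_pos_mult_at_top[OF tendsto_const _ filterlim_ident]) auto
    note 1 = eventually_compose_filterlim[OF comp[OF \<delta>(1)] this]
    have "((\<lambda>x. b (1 / (1 + \<delta>) * x) / b x) \<longlongrightarrow> (1 + \<delta>) powr \<alpha>) at_top"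
      using tail_ratio[of "1 / (1 + \<delta>)"] \<delta> by (simp add: powr_divide powr_minus inverse_eq_divide)
    then have "eventually (\<lambda>x. b (1 / (1 + \<delta>) * x) / b x < (1 + \<delta>) powr \<alpha> + \<delta>) at_top"
      using \<delta> by (intro order_tendstoD(2)) auto
    with 1 show "eventually (\<lambda>x. measure R {x<..} / b x < a) at_top"
    proof eventually_elim
      case (elim x)
      define x' where "x' = 1 / (1 + \<delta>) * x"
      have x': "x' > 0" "(1 + \<delta>) * x' = x" using elim \<delta> by (auto simp: x'_def)
      have "measure R {x<..} \<le> kappa_integral R p (ramp_quot p \<delta>) x'"
        using R.kappa_integral_ramp_quot_bounds(1)[OF Rmom x'(1) \<delta>(1)] x' by simp
      also have "\<dots> \<le> kappa_integral M p (ramp_quot p \<delta>) x' + \<delta> * b x'"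
        using elim(1) unfolding x'_def by linarith
      also have "kappa_integral M p (ramp_quot p \<delta>) x' \<le> b x'"
        by (rule kappa_integral_ramp_quot_bounds(2)[OF Mmom x'(1) \<delta>(1)])
      finally have "measure R {x<..} / b x \<le> (1 + \<delta>) * (b x' / b x)"
        using tail_pos[of x] by (simp add: field_simps)
      also have "\<dots> \<le> (1 + \<delta>) * ((1 + \<delta>) powr \<alpha> + \<delta>)"
        using elim(2) \<delta> unfolding x'_def by (intro mult_left_mono) auto
      also have "\<dots> < a" by (rule \<delta>)
      finally show ?case .
    qed
  next
    fix a :: real assume a: "a < 1"
    have "((\<lambda>\<delta>. (1 + \<delta>) powr (-\<alpha>) - 2 * \<delta>) \<longlongrightarrow> (1 + 0) powr (-\<alpha>) - 2 * 0) (at_right 0)"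
      by (intro tendsto_intros) auto
    then have "eventually (\<lambda>\<delta>. a < (1 + \<delta>) powr (-\<alpha>) - 2 * \<delta>) (at_right 0)"
      using a by (intro order_tendstoD(1)) auto
    then obtain \<delta> where \<delta>: "\<delta> > 0" "a < (1 + \<delta>) powr (-\<alpha>) - 2 * \<delta>"
      using eventually_happens'[OF trivial_limit_at_right_real eventually_conj[OF _ eventually_at_right_less]] by blast
    have "eventually (\<lambda>x. (1 + \<delta>) powr (-\<alpha>) - \<delta> < b ((1 + \<delta>) * x) / b x) at_top"
      using \<delta> by (intro order_tendstoD(1)[OF tail_ratio]) auto
    with comp[OF \<delta>(1)] show "eventually (\<lambda>x. a < measure R {x<..} / b x) at_top"
    proof eventually_elim
      case (elim x)
      have "b ((1 + \<delta>) * x) \<le> kappa_integral M p (ramp_quot p \<delta>) x"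
        using kappa_integral_ramp_quot_bounds(1)[OF Mmom _ \<delta>(1)] elim by simp
      also have "\<dots> \<le> kappa_integral R p (ramp_quot p \<delta>) x + \<delta> * b x" using elim(1) by linarith
      also have "kappa_integral R p (ramp_quot p \<delta>) x \<le> measure R {x<..}"
        using R.kappa_integral_ramp_quot_bounds(2)[OF Rmom _ \<delta>(1)] elim by simp
      finally have "b ((1 + \<delta>) * x) / b x \<le> (measure R {x<..} + \<delta> * b x) / b x"
        using tail_pos[of x] by (intro divide_right_mono) auto
      then have "b ((1 + \<delta>) * x) / b x - \<delta> \<le> measure R {x<..} / b x"
        using tail_pos[of x] by (simp add: add_divide_distrib)
      with elim(2) \<delta>(2) show ?case by linarith
    qed
  qed
qed

text \<open>
  The analytic core, free of S-transforms: a measure whose psi-transform solves the fixed point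
  equation has the same tail as \<open>M\<close>.
\<close>
theorem (in rv_tail) tail_of_perturbed_psi:
  assumes R: "nontrivial_nonneg_distribution R"
    and p: "real p \<le> \<alpha>" "\<alpha> < real p + 1"
    and g1: "(g \<longlongrightarrow> 1) (at_left 0)" and gp: "poly_upto (real p) g"
    and eq: "eventually (\<lambda>w. psi_transform R w = stieltjes M 0 (w * g (psi_transform R w)) - 1) (at_left 0)"
  shows "((\<lambda>x. measure R {x<..} / measure M {x<..}) \<longlongrightarrow> 1) at_top"
proof -
  interpret R: nontrivial_nonneg_distribution R by fact
  have R': "nonneg_distribution R" by unfold_locales
  obtain q where "(\<lambda>w. psi_transform R w + 1 - stieltjes M 0 w - poly q w) \<in> o[at_left 0](\<lambda>w. b (-1 / w))"
    using composition_difference[OF p R.filterlim_psi_transform g1 gp eq] by blast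
  also have "?this \<longleftrightarrow> (\<lambda>w. stieltjes R 0 w - stieltjes M 0 w - poly q w) \<in> o[at_left 0](\<lambda>w. b (-1 / w))"
    by (rule landau_o.small.in_cong, rule eventually_mono[OF eventually_at_left_0_small[of 1]])
       (auto simp: R.psi_transform_eq_stieltjes)
  finally obtain c where c: "\<And>j. j < p \<Longrightarrow> integrable R (\<lambda>t. t ^ j)" "p = 0 \<Longrightarrow> c = 0"
    "(\<lambda>w. w ^ p * (stieltjes R p w - stieltjes M p w - c)) \<in> o[at_left 0](\<lambda>w. b (-1 / w))"
    using remainder_difference[OF R' p] by blast
  have Rmom: "integrable R (\<lambda>t. t ^ (p - 1))" using c(1)[of "p - 1"] by (cases p) auto
  have "(\<lambda>x. kappa_integral R p (\<lambda>y. 1 / (1 - \<theta> * y)) x - kappa_integral M p (\<lambda>y. 1 / (1 - \<theta> * y)) x) \<in> o[at_top](b)"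
    if \<theta>: "0 < \<theta>" "\<theta> < 1" for \<theta>
  proof -
    note resolvent_test[OF R' p c \<theta>]
    also have "((\<lambda>x. (\<integral>t. kappa p (t / x) * (1 / (1 - \<theta> * (1 / (1 + t / x)))) \<partial>R)
            - (\<integral>t. kappa p (t / x) * (1 / (1 - \<theta> * (1 / (1 + t / x)))) \<partial>M)) \<in> o[at_top](b)) \<longleftrightarrow> ?thesis"
      by (rule landau_o.small.in_cong, rule eventually_mono[OF eventually_gt_at_top[of 0]])
         (simp only: kappa_integral_resolvent R.kappa_integral_resolvent)
    finally show ?thesis .
  qed
  from kappa_integral_difference_smallo[OF R' p Rmom this]
  show ?thesis by (rule tail_ratio_tendsto_1[OF R' p Rmom])
qed

section \<open>Rescaling and the asymptotics of the free convolution\<close>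

text \<open>
  Eventual positivity of \<open>L\<close> makes the tail positive far out, hence everywhere by monotonicity.
\<close>
lemma rv_tail_of_asymp_equiv:
  assumes "nonneg_distribution M" and L: "slowly_varying L" and \<alpha>: "\<alpha> \<ge> 0"
    and eq: "(\<lambda>x. measure M {x<..}) \<sim>[at_top] (\<lambda>x. x powr (-\<alpha>) * L x)"
  shows "rv_tail M \<alpha>"
proof -
  interpret nonneg_distribution M by fact
  let ?b = "\<lambda>x. measure M {x<..}" and ?g = "\<lambda>x. x powr (-\<alpha>) * L x"
  from L obtain a where a: "\<And>x. x > a \<Longrightarrow> L x > 0"
    and ratio: "\<And>c. c > 0 \<Longrightarrow> ((\<lambda>x. L (c * x) / L x) \<longlongrightarrow> 1) at_top"
    unfolding slowly_varying_def by auto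
  have g_pos: "eventually (\<lambda>x. ?g x > 0) at_top"
    using eventually_gt_at_top[of "max a 0"] by eventually_elim (use a in auto)
  have b_pos: "eventually (\<lambda>x. ?b x > 0) at_top"
    using g_pos asymp_equiv_eventually_zeros[OF eq]
    by eventually_elim (use measure_nonneg in \<open>auto simp: zero_less_measure_iff\<close>)
  have pos: "?b x > 0" for x
  proof -
    obtain y where y: "y \<ge> x" "?b y > 0"
      using eventually_happens'[OF _ eventually_conj[OF eventually_ge_at_top[of x] b_pos]] by auto
    have "?b y \<le> ?b x" using y by (intro finite_measure_mono) auto
    with y show ?thesis by simp
  qed
  have bg: "((\<lambda>x. ?b x / ?g x) \<longlongrightarrow> 1) at_top"
    by (rule asymp_equivD_strong[OF eq]) (use pos in \<open>auto simp: less_imp_neq[symmetric]\<close>)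
  have "((\<lambda>x. ?b (c * x) / ?b x) \<longlongrightarrow> c powr (-\<alpha>)) at_top" if c: "c > 0" for c
  proof -
    have cx: "filterlim (\<lambda>x. c * x) at_top at_top"
      using c by (intro filterlim_tendsto_pos_mult_at_top[OF tendsto_const _ filterlim_ident])
    have "((\<lambda>x. ?b (c * x) / ?g (c * x) * (c powr (-\<alpha>) * (L (c * x) / L x)) / (?b x / ?g x))
        \<longlongrightarrow> 1 * (c powr (-\<alpha>) * 1) / 1) at_top"
      by (intro tendsto_intros filterlim_compose[OF bg cx] ratio c bg) auto
    moreover have "eventually (\<lambda>x. ?b (c * x) / ?g (c * x) * (c powr (-\<alpha>) * (L (c * x) / L x)) / (?b x / ?g x)
        = ?b (c * x) / ?b x) at_top"
      using g_pos eventually_compose_filterlim[OF g_pos cx] eventually_gt_at_top[of 0]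
    proof eventually_elim
      case (elim x)
      have *: "?g (c * x) = c powr (-\<alpha>) * (L (c * x) / L x) * ?g x"
        using elim c by (auto simp: powr_mult)
      have cancel: "u / v * v / w = u / w" if "v \<noteq> 0" for u v w :: real using that by simp
      have ne: "?g (c * x) \<noteq> 0" "?g x \<noteq> 0" "?b x \<noteq> 0" using elim pos[of x] by auto
      have "?b (c * x) / ?g (c * x) * (c powr (-\<alpha>) * (L (c * x) / L x)) / (?b x / ?g x)
         = ?b (c * x) / ?g (c * x) * ((c powr (-\<alpha>) * (L (c * x) / L x)) * ?g x) / ?b x"
        by simp
      also have "\<dots> = ?b (c * x) / ?g (c * x) * ?g (c * x) / ?b x" by (simp only: *)
      also have "\<dots> = ?b (c * x) / ?b x" by (rule cancel[OF ne(1)])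
      finally show ?case .
    qed
    ultimately show ?thesis by (simp add: Lim_transform_eventually)
  qed
  with \<alpha> pos show ?thesis by unfold_locales auto
qed

lemma nontrivial_if_not_dirac0:
  "nonneg_distribution M \<Longrightarrow> M \<noteq> dirac0 \<Longrightarrow> nontrivial_nonneg_distribution M"
  by (simp add: nontrivial_nonneg_distribution_def nontrivial_nonneg_distribution_axioms_def)

lemma (in rv_tail) nontrivial: "nontrivial_nonneg_distribution M"
proof (rule nontrivial_if_not_dirac0)
  show "M \<noteq> dirac0"
  proof
    assume "M = dirac0"
    then have "b 0 = 0" by (simp add: measure_return)
    with tail_pos[of 0] show False by simp
  qed
qed unfold_locales

lemma (in nonneg_distribution) moment_eq_nn_integral: "moment q M = (\<integral>\<^sup>+t. ennreal (t ^ q) \<partial>M)"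
  unfolding moment_def
  by (rule nn_integral_cong_AE) (use AE_nonneg in eventually_elim, simp)

lemma (in nonneg_distribution) integrable_power_of_moment:
  assumes "moment q M < \<infinity>" "j \<le> q"
  shows "integrable M (\<lambda>t. t ^ j)"
proof -
  have "integrable M (\<lambda>t. t ^ q)"
    by (rule integrableI_nonneg) (use assms moment_eq_nn_integral AE_nonneg in auto)
  then have "integrable M (\<lambda>t. 1 + t ^ q)" by simp
  then show ?thesis
  proof (rule Bochner_Integration.integrable_bound)
    show "AE t in M. norm (t ^ j) \<le> norm (1 + t ^ q)"
      using AE_nonneg
    proof eventually_elim
      case (elim t)
      show ?case
      proof (cases "t \<le> 1")
        case True
        then have "t ^ j \<le> 1" using elim by (intro power_le_one)
        moreover have "t ^ q \<ge> 0" using elim by simp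
        ultimately show ?thesis using elim by (simp add: add_increasing2)
      next
        case False
        then have "t ^ j \<le> t ^ q" using assms(2) by (intro power_increasing) auto
        then show ?thesis using elim by simp
      qed
    qed
  qed auto
qed

lemma (in nonneg_distribution) enn2real_moment:
  assumes "integrable M (\<lambda>t. t ^ q)"
  shows "enn2real (moment q M) = (\<integral>t. t ^ q \<partial>M)"
proof -
  have "AE t in M. 0 \<le> t ^ q" using AE_nonneg by eventually_elim simp
  from nn_integral_eq_integral[OF assms this] integral_nonneg_AE[OF this]
  show ?thesis by (simp add: moment_eq_nn_integral)
qed

lemma (in nonneg_distribution)
  assumes m: "m > 0"
  shows nonneg_distribution_scale: "nonneg_distribution (distr M borel ((*) m))"
    and measure_scale: "measure (distr M borel ((*) m)) {x<..} = measure M {x / m<..}"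
    and stieltjes_scale: "stieltjes (distr M borel ((*) m)) 0 w = stieltjes M 0 (m * w)"
proof -
  have "real_distribution (distr M borel ((*) m))" by (rule real_distribution_distr) simp
  then interpret D: real_distribution "distr M borel ((*) m)" .
  show "nonneg_distribution (distr M borel ((*) m))"
    by unfold_locales (use AE_nonneg m in \<open>auto simp: AE_distr_iff zero_le_mult_iff\<close>)
  have "(*) m -` {x<..} = {x / m<..}" using m by (auto simp: field_simps)
  then show "measure (distr M borel ((*) m)) {x<..} = measure M {x / m<..}"
    by (simp add: measure_distr)
  show "stieltjes (distr M borel ((*) m)) 0 w = stieltjes M 0 (m * w)"
    unfolding stieltjes_def by (subst integral_distr) (auto simp: mult_ac)
qed

text \<open>
  Rescaling by the first moment of \<open>\<nu>\<close> normalises the perturbing factor in the fixed point equation to have limit \<open>1\<close>.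
\<close>
lemma (in rv_tail) rv_tail_scale:
  assumes m: "m > 0" shows "rv_tail (distr M borel ((*) m)) \<alpha>"
proof -
  interpret D: nonneg_distribution "distr M borel ((*) m)" by (rule nonneg_distribution_scale[OF m])
  show ?thesis
  proof unfold_locales
    show "((\<lambda>x. measure (distr M borel ((*) m)) {c * x<..} / measure (distr M borel ((*) m)) {x<..}) \<longlongrightarrow> c powr (-\<alpha>)) at_top"
      if "c > 0" for c
    proof -
      have "filterlim (\<lambda>x. 1 / m * x) at_top at_top"
        using m by (intro filterlim_tendsto_pos_mult_at_top[OF tendsto_const _ filterlim_ident]) auto
      from filterlim_compose[OF tail_ratio[OF that] this] show ?thesis
        by (simp add: measure_scale[OF m])
    qed
  qed (use alpha_nonneg tail_pos in \<open>auto simp: measure_scale[OF m]\<close>)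
qed

theorem lemma7p2:
  fixes L :: "real \<Rightarrow> real" and \<alpha> :: real and \<mu> \<nu> \<rho> :: "real measure"
  assumes "slowly_varying L"
    and "\<alpha> \<ge> 0"
    and "\<mu> \<in> M_plus"
    and "\<nu> \<in> M_plus"
    and "\<nu> \<noteq> dirac0"
    and "(\<lambda>x. measure \<mu> {x<..}) \<sim>[at_top] (\<lambda>x. x powr (-\<alpha>) * L x)"
    and "moment (nat \<lfloor>\<alpha> + 1\<rfloor>) \<nu> < \<infinity>"
    and "is_free_mult_conv \<mu> \<nu> \<rho>"
  shows "(\<lambda>x. measure \<rho> {x<..}) \<sim>[at_top]
           (\<lambda>x. enn2real (moment 1 \<nu>) powr \<alpha> * measure \<mu> {x<..})"
proof -
  define p where "p = nat \<lfloor>\<alpha>\<rfloor>"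
  have "real p = real_of_int \<lfloor>\<alpha>\<rfloor>" using assms(2) by (simp add: p_def)
  then have p: "real p \<le> \<alpha>" "\<alpha> < real p + 1" by linarith+
  have q: "nat \<lfloor>\<alpha> + 1\<rfloor> = Suc p" using assms(2) by (simp add: p_def nat_add_distrib)
  interpret \<mu>: rv_tail \<mu> \<alpha>
    by (rule rv_tail_of_asymp_equiv[OF M_plus_imp_nonneg_distribution[OF assms(3)] assms(1,2,6)])
  interpret \<nu>: nontrivial_nonneg_distribution \<nu>
    by (intro nontrivial_if_not_dirac0 M_plus_imp_nonneg_distribution assms)
  have \<nu>_mom: "integrable \<nu> (\<lambda>t. t ^ j)" if "j \<le> Suc p" for j
    using \<nu>.integrable_power_of_moment assms(7) that unfolding q by blast
  then have \<nu>1: "integrable \<nu> (\<lambda>t. t)" using \<nu>_mom[of 1] by simp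
  define m where "m = (\<integral>t. t \<partial>\<nu>)"
  have m: "m > 0" unfolding m_def by (rule \<nu>.first_moment_pos[OF \<nu>1])
  have m_eq: "enn2real (moment 1 \<nu>) = m"
    using \<nu>.enn2real_moment[of 1] \<nu>1 by (simp add: m_def)
  define M where "M = distr \<mu> borel ((*) m)"
  interpret M: rv_tail M \<alpha> unfolding M_def by (rule \<mu>.rv_tail_scale[OF m])
  note conv = psi_free_mult_conv[OF \<mu>.nontrivial \<nu>.nontrivial_nonneg_distribution_axioms assms(8)]
  interpret \<rho>: nontrivial_nonneg_distribution \<rho> by (rule conv(1))
  define g where "g = (\<lambda>z. 1 / m * (1 / S_transform \<nu> z))"
  have g1: "(g \<longlongrightarrow> 1) (at_left 0)"
    unfolding g_def using m
    by (intro tendsto_eq_rhs[OF tendsto_mult[OF tendsto_const \<nu>.recip_S_transform_tendsto[OF \<nu>1]]])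
       (simp add: m_def)
  have gp: "poly_upto (real p) g"
    unfolding g_def by (intro poly_upto_cmult \<nu>.poly_upto_recip_S_transform \<nu>_mom)
  have "eventually (\<lambda>z. g z > 0) (at_left 0)" using order_tendstoD(1)[OF g1, of 0] by simp
  from eventually_compose_filterlim[OF this \<rho>.filterlim_psi_transform] conv(2) eventually_at_left_0_small[of 1, simplified]
  have "eventually (\<lambda>w. psi_transform \<rho> w = stieltjes M 0 (w * g (psi_transform \<rho> w)) - 1) (at_left 0)"
  proof eventually_elim
    case (elim w)
    have *: "w * (1 / S_transform \<nu> (psi_transform \<rho> w)) = m * (w * g (psi_transform \<rho> w))"
      using m by (simp add: g_def)
    have "m * (w * g (psi_transform \<rho> w)) < 0"
      using elim m by (intro mult_pos_neg mult_neg_pos) auto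
    with elim(2) show ?case
      unfolding * M_def \<mu>.stieltjes_scale[OF m] by (simp add: \<mu>.psi_transform_eq_stieltjes)
  qed
  from M.tail_of_perturbed_psi[OF conv(1) p g1 gp this]
  have "((\<lambda>x. measure \<rho> {x<..} / measure M {x<..}) \<longlongrightarrow> 1) at_top" .
  moreover have "((\<lambda>x. measure M {x<..} / measure \<mu> {x<..}) \<longlongrightarrow> m powr \<alpha>) at_top"
    using \<mu>.tail_ratio[of "1 / m"] m
    by (simp add: M_def \<mu>.measure_scale[OF m] powr_divide powr_minus inverse_eq_divide)
  ultimately have "((\<lambda>x. measure \<rho> {x<..} / measure M {x<..} * (measure M {x<..} / measure \<mu> {x<..}))
      \<longlongrightarrow> 1 * m powr \<alpha>) at_top"
    by (rule tendsto_mult)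
  then have "((\<lambda>x. measure \<rho> {x<..} / measure \<mu> {x<..}) \<longlongrightarrow> m powr \<alpha>) at_top"
    using M.tail_pos by (simp add: less_imp_neq[symmetric])
  then show ?thesis
    unfolding m_eq using m by (intro asymp_equivI'_const) auto
qed

end
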